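(* Consider the two-user Gaussian multiple-access wiretap channel with noncausal state information at the transmitters, degraded message sets and noiseless feedback described in the context, with power constraints $P_1,P_2>0$, state variance $Q>0$ and noise variances $\sigma_1^2,\sigma_2^2>0$. Its secrecy capacity region $\mathcal{C}^{f}_{s,gmac-ncsit-dms}$ equals \[ \bigcup_{0\le\rho\le1}\Big\{(R_1\ge0,R_2\ge0):\ R_2\le\tfrac12\log\Big(1+\tfrac{P_2(1-\rho^2)}{\sigma_1^2}\Big),\ R_1+R_2\le\tfrac12\log\Big(1+\tfrac{P_1+P_2+2\sqrt{P_1P_2}\rho}{\sigma_1^2}\Big)\Big\}, \] which is the capacity region of the same channel with feedback but without secrecy constraint.
   Context: All logarithms are base 2. Channel (GMAC-WT-NCSIT-DMS with feedback): for $i=1,\dots,N$, $Y_i=X_{1,i}+X_{2,i}+S_i+\eta_{1,i}$ and $Z_i=Y_i+\eta_{2,i}$, where $S_i\sim\mathcal N(0,Q)$, $\eta_{1,i}\sim\mathcal N(0,\sigma_1^2)$, $\eta_{2,i}\sim\mathcal N(0,\sigma_2^2)$ are each i.i.d. over $i$, mutually independent, and independent of the messages. Messages $W_1,W_2$ are independent, $W_j$ uniform on $\{1,\dots,|\mathcal W_j|\}$. $X_{1,i}$ is a (possibly stochastic) function of $W_1$, the whole state sequence $S^N$ (known noncausally to both transmitters, not to the receiver) and the noiseless feedback $Y^{i-1}$; $X_{2,i}$ is a (possibly stochastic) function of $W_1$, $W_2$, $S^N$ and $Y^{i-1}$. Power constraints: $\frac1N\sum_{i=1}^N E[X_{j,i}^2]\le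 P_j$. The receiver outputs $(\hat W_1,\hat W_2)=\psi(Y^N)$; $P_e$ is the average probability that $\psi(Y^N)\neq(W_1,W_2)$. Equivocation $\Delta=\frac1N H(W_1,W_2\mid Z^N)$. A pair $(R_1,R_2)$ is achievable with perfect weak secrecy if for every $\epsilon>0$ and all sufficiently large $N$ there exist encoders and a decoder with $\frac{\log|\mathcal W_j|}{N}=R_j$ ($j=1,2$), $\Delta\ge R_1+R_2-\epsilon$ and $P_e\le\epsilon$. $\mathcal{C}^{f}_{s,gmac-ncsit-dms}$ is the set of all such pairs.
   Formalization: The condition log|W_j|/N = R_j, which for all large N can hold only if 2^{R_j} is an integer, is replaced by the usual rounding |W_j| = ⌈2^{N R_j}⌉ (with R_j ≥ 0), so that log|W_j|/N tends to R_j. *)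

theory Defs
  imports "HOL-Probability.Probability"
begin

text \<open>Outcome of one block of N channel uses (time indices 0..N-1):
  (W1, W2, S, eta1, eta2, T1, T2), where T1, T2 are the private
  randomisers (uniform on [0,1]) of the two stochastic encoders.\<close>
type_synonym outcome =
  "nat \<times> nat \<times> (nat \<Rightarrow> real) \<times> (nat \<Rightarrow> real) \<times> (nat \<Rightarrow> real) \<times> real \<times> real"

definition oW1 :: "outcome \<Rightarrow> nat" where "oW1 \<omega> = fst \<omega>"
definition oW2 :: "outcome \<Rightarrow> nat" where "oW2 \<omega> = fst (snd \<omega>)"
definition oS :: "outcome \<Rightarrow> nat \<Rightarrow> real" where "oS \<omega> = fst (snd (snd \<omega>))"
definition oE1 :: "outcome \<Rightarrow> nat \<Rightarrow> real" where "oE1 \<omega> = fst (snd (snd (snd \<omega>)))"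
definition oE2 :: "outcome \<Rightarrow> nat \<Rightarrow> real" where "oE2 \<omega> = fst (snd (snd (snd (snd \<omega>))))"
definition oT1 :: "outcome \<Rightarrow> real" where "oT1 \<omega> = fst (snd (snd (snd (snd (snd \<omega>)))))"
definition oT2 :: "outcome \<Rightarrow> real" where "oT2 \<omega> = snd (snd (snd (snd (snd (snd \<omega>)))))"

text \<open>Encoder types. Encoder 1 at time i maps (W1, S^N, Y^{i-1}, T1) to X_{1,i};
  encoder 2 at time i maps (W1, W2, S^N, Y^{i-1}, T2) to X_{2,i}.
  Sequences are passed as extensional functions restricted to their index sets.\<close>
type_synonym enc1 = "nat \<Rightarrow> nat \<times> (nat \<Rightarrow> real) \<times> (nat \<Rightarrow> real) \<times> real \<Rightarrow> real"
type_synonym enc2 = "nat \<Rightarrow> nat \<times> nat \<times> (nat \<Rightarrow> real) \<times> (nat \<Rightarrow> real) \<times> real \<Rightarrow> real"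

primrec ylist :: "enc1 \<Rightarrow> enc2 \<Rightarrow> nat \<Rightarrow> nat \<Rightarrow> outcome \<Rightarrow> real list" where
  "ylist f1 f2 N 0 \<omega> = []"
| "ylist f1 f2 N (Suc i) \<omega> =
     (let yp = restrict (\<lambda>j. ylist f1 f2 N i \<omega> ! j) {..<i};
          sN = restrict (oS \<omega>) {..<N}
      in ylist f1 f2 N i \<omega> @
         [f1 i (oW1 \<omega>, sN, yp, oT1 \<omega>) + f2 i (oW1 \<omega>, oW2 \<omega>, sN, yp, oT2 \<omega>)
          + oS \<omega> i + oE1 \<omega> i])"

definition ypast :: "enc1 \<Rightarrow> enc2 \<Rightarrow> nat \<Rightarrow> nat \<Rightarrow> outcome \<Rightarrow> nat \<Rightarrow> real" where
  "ypast f1 f2 N i \<omega> = restrict (\<lambda>j. ylist f1 f2 N i \<omega> ! j) {..<i}"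

definition chX1 :: "enc1 \<Rightarrow> enc2 \<Rightarrow> nat \<Rightarrow> nat \<Rightarrow> outcome \<Rightarrow> real" where
  "chX1 f1 f2 N i \<omega> = f1 i (oW1 \<omega>, restrict (oS \<omega>) {..<N}, ypast f1 f2 N i \<omega>, oT1 \<omega>)"

definition chX2 :: "enc1 \<Rightarrow> enc2 \<Rightarrow> nat \<Rightarrow> nat \<Rightarrow> outcome \<Rightarrow> real" where
  "chX2 f1 f2 N i \<omega> = f2 i (oW1 \<omega>, oW2 \<omega>, restrict (oS \<omega>) {..<N}, ypast f1 f2 N i \<omega>, oT2 \<omega>)"

definition chY :: "enc1 \<Rightarrow> enc2 \<Rightarrow> nat \<Rightarrow> outcome \<Rightarrow> nat \<Rightarrow> real" where
  "chY f1 f2 N \<omega> = restrict (\<lambda>j. ylist f1 f2 N N \<omega> ! j) {..<N}"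

definition chZ :: "enc1 \<Rightarrow> enc2 \<Rightarrow> nat \<Rightarrow> outcome \<Rightarrow> nat \<Rightarrow> real" where
  "chZ f1 f2 N \<omega> = restrict (\<lambda>j. chY f1 f2 N \<omega> j + oE2 \<omega> j) {..<N}"

definition gauss :: "real \<Rightarrow> real measure" where
  "gauss v = density lborel (normal_density 0 (sqrt v))"

definition chan_space :: "nat \<Rightarrow> nat \<Rightarrow> nat \<Rightarrow> real \<Rightarrow> real \<Rightarrow> real \<Rightarrow> outcome measure" where
  "chan_space N M1 M2 Q v1 v2 =
     uniform_count_measure {1..M1} \<Otimes>\<^sub>M uniform_count_measure {1..M2} \<Otimes>\<^sub>M
     PiM {..<N} (\<lambda>_. gauss Q) \<Otimes>\<^sub>M PiM {..<N} (\<lambda>_. gauss v1) \<Otimes>\<^sub>M PiM {..<N} (\<lambda>_. gauss v2) \<Otimes>\<^sub>M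
     uniform_measure lborel {0..1} \<Otimes>\<^sub>M uniform_measure lborel {0..1}"

definition valid_code ::
  "nat \<Rightarrow> nat \<Rightarrow> nat \<Rightarrow> real \<Rightarrow> real \<Rightarrow> real \<Rightarrow> real \<Rightarrow> real \<Rightarrow>
   enc1 \<Rightarrow> enc2 \<Rightarrow> ((nat \<Rightarrow> real) \<Rightarrow> nat \<times> nat) \<Rightarrow> bool" where
  "valid_code N M1 M2 P1 P2 Q v1 v2 f1 f2 dec \<longleftrightarrow>
     (\<forall>i<N. f1 i \<in> measurable (count_space UNIV \<Otimes>\<^sub>M PiM {..<N} (\<lambda>_. borel) \<Otimes>\<^sub>M
                                 PiM {..<i} (\<lambda>_. borel) \<Otimes>\<^sub>M borel) borel) \<and>
     (\<forall>i<N. f2 i \<in> measurable (count_space UNIV \<Otimes>\<^sub>M count_space UNIV \<Otimes>\<^sub>M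
                                 PiM {..<N} (\<lambda>_. borel) \<Otimes>\<^sub>M PiM {..<i} (\<lambda>_. borel) \<Otimes>\<^sub>M borel) borel) \<and>
     dec \<in> measurable (PiM {..<N} (\<lambda>_. borel)) (count_space UNIV) \<and>
     (\<Sum>i<N. \<integral>\<^sup>+\<omega>. ennreal ((chX1 f1 f2 N i \<omega>)\<^sup>2) \<partial>chan_space N M1 M2 Q v1 v2)
        \<le> ennreal (real N * P1) \<and>
     (\<Sum>i<N. \<integral>\<^sup>+\<omega>. ennreal ((chX2 f1 f2 N i \<omega>)\<^sup>2) \<partial>chan_space N M1 M2 Q v1 v2)
        \<le> ennreal (real N * P2)"

definition err_prob :: "nat \<Rightarrow> nat \<Rightarrow> nat \<Rightarrow> real \<Rightarrow> real \<Rightarrow> real \<Rightarrow>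
   enc1 \<Rightarrow> enc2 \<Rightarrow> ((nat \<Rightarrow> real) \<Rightarrow> nat \<times> nat) \<Rightarrow> real" where
  "err_prob N M1 M2 Q v1 v2 f1 f2 dec =
     measure (chan_space N M1 M2 Q v1 v2)
       {\<omega> \<in> space (chan_space N M1 M2 Q v1 v2). dec (chY f1 f2 N \<omega>) \<noteq> (oW1 \<omega>, oW2 \<omega>)}"

definition equivocation :: "nat \<Rightarrow> nat \<Rightarrow> nat \<Rightarrow> real \<Rightarrow> real \<Rightarrow> real \<Rightarrow> enc1 \<Rightarrow> enc2 \<Rightarrow> real" where
  "equivocation N M1 M2 Q v1 v2 f1 f2 =
     prob_space.conditional_entropy (chan_space N M1 M2 Q v1 v2) 2
       (count_space UNIV) (PiM {..<N} (\<lambda>_. lborel))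
       (\<lambda>\<omega>. (oW1 \<omega>, oW2 \<omega>)) (chZ f1 f2 N) / real N"

text \<open>Message set sizes |W_j| = ceiling (2^(N R_j)), so that log|W_j|/N -> R_j.
  With secrecy = False the equivocation requirement is dropped (feedback capacity
  region without secrecy constraint).\<close>
definition achievable :: "bool \<Rightarrow> real \<Rightarrow> real \<Rightarrow> real \<Rightarrow> real \<Rightarrow> real \<Rightarrow> real \<Rightarrow> real \<Rightarrow> bool" where
  "achievable secrecy P1 P2 Q v1 v2 R1 R2 \<longleftrightarrow>
     0 \<le> R1 \<and> 0 \<le> R2 \<and>
     (\<forall>\<epsilon>>0. \<exists>N0. \<forall>N\<ge>N0.
        (let M1 = nat \<lceil>2 powr (real N * R1)\<rceil>; M2 = nat \<lceil>2 powr (real N * R2)\<rceil> in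
         \<exists>f1 f2 dec. valid_code N M1 M2 P1 P2 Q v1 v2 f1 f2 dec \<and>
           err_prob N M1 M2 Q v1 v2 f1 f2 dec \<le> \<epsilon> \<and>
           (secrecy \<longrightarrow> equivocation N M1 M2 Q v1 v2 f1 f2 \<ge> R1 + R2 - \<epsilon>)))"

definition cap_region :: "bool \<Rightarrow> real \<Rightarrow> real \<Rightarrow> real \<Rightarrow> real \<Rightarrow> real \<Rightarrow> (real \<times> real) set" where
  "cap_region secrecy P1 P2 Q v1 v2 = {(R1, R2). achievable secrecy P1 P2 Q v1 v2 R1 R2}"

end

theory Submission
  imports Defs
begin

text \<open>
  Converse: replace the channel by one whose i-th output is normal with mean
  \<open>s i + c * x1 i\<close> and variance A. Such an output does not depend on the second message (nor, for
  c = 0, on the first), so it is decoded with probability at most 1/m, where m is the number of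
  messages. The logarithm of the likelihood ratio is an explicit quadratic whose expectation only
  involves second moments of the inputs, and comparing the two probabilities of correct decoding
  bounds \<open>ln m\<close> by \<open>N / 2 * ln (A / v1)\<close> up to a constant. Taking c = 0 gives the sum rate; the best
  linear prediction of \<open>x2\<close> from \<open>x1\<close> gives the rate of the second message with the same correlation.

  Achievability: a Schalkwijk--Kailath scheme with two superposed layers. The first two channel uses
  carry the two message points, and all later inputs are the normalised errors of the receiver's
  linear estimates of the noise in those two uses. The output noise seen by the
  coherent layer is white, because it consists of a private layer that is itself such a scheme. The
  receiver's estimates are linear in the state, so the encoders subtract the total
  contribution of the state in advance, at a bounded cost in power. As all but the first two inputs
  are independent of the messages given state and noise, only a bounded amount of information leaks.
\<close>

section \<open>Causal shifts and Gaussian product measures\<close>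

text \<open>The region is closed and the message counts are tied to the exact rates, so boundary
  points need slack that neither the rates nor the nominal powers offer. It comes from an event of
  small positive probability seen by both encoders, the first state sample being low, on which they
  stay silent: this costs little error probability and scales every input power after the first two
  uses by a factor below 1, whatever the block length. Encoders may be stochastic and read the state
  and the feedback, and only second moments of their inputs are controlled. A change of measure
  suits this, since with everything else fixed the output is a triangular shift of the receiver
  noise. Such a shift preserves Lebesgue measure, so likelihoods remain explicit products of normal
  densities. For secrecy, two message pairs under the same noise and state give outputs that agree
  except for bounded shifts at two times. Their wiretap densities are therefore comparable up to a
  constant that does not grow with the block length.\<close>

abbreviation seqs :: "nat \<Rightarrow> (nat \<Rightarrow> real) measure" where
  "seqs n \<equiv> PiM {..<n} (\<lambda>_. borel)"

abbreviation lebs :: "nat \<Rightarrow> (nat \<Rightarrow> real) measure" where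
  "lebs n \<equiv> PiM {..<n} (\<lambda>_. lborel)"

abbreviation noises :: "nat \<Rightarrow> real \<Rightarrow> (nat \<Rightarrow> real) measure" where
  "noises n v \<equiv> PiM {..<n} (\<lambda>_. gauss v)"

abbreviation phi :: "real \<Rightarrow> real \<Rightarrow> real" where
  "phi v \<equiv> normal_density 0 (sqrt v)"

interpretation lebs: product_sigma_finite "\<lambda>_. lborel :: real measure"
  by (simp add: product_sigma_finite_def lborel.sigma_finite_measure_axioms)

lemma sets_gauss [simp, measurable_cong]: "sets (gauss v) = sets borel"
  and space_gauss [simp]: "space (gauss v) = UNIV"
  by (auto simp: gauss_def)

lemma prob_space_gauss: "v > 0 \<Longrightarrow> prob_space (gauss v)"
  unfolding gauss_def by (rule prob_space_normal_density) simp

lemma nn_integral_gauss: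
  "f \<in> borel_measurable borel \<Longrightarrow>
    (\<integral>\<^sup>+x. f x \<partial>gauss v) = (\<integral>\<^sup>+x. ennreal (phi v x) * f x \<partial>lborel)"
  unfolding gauss_def by (subst nn_integral_density) auto

lemma nn_integral_normal_density:
  "v > 0 \<Longrightarrow> (\<integral>\<^sup>+x. ennreal (normal_density m (sqrt v) x) \<partial>lborel) = 1"
  by (subst nn_integral_eq_integral) auto

lemma gauss_second_moment:
  assumes "v > 0"
  shows "(\<integral>\<^sup>+y. ennreal ((a + k * y)\<^sup>2) \<partial>gauss v) = ennreal (a\<^sup>2) + ennreal (k\<^sup>2 * v)"
proof -
  let ?d = "phi v"
  have sq: "integrable lborel (\<lambda>y. ?d y * (y - 0)^2)" and li: "integrable lborel (\<lambda>y. ?d y * y)"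
    using assms integrable_normal_moment[of "sqrt v" 0 2] integrable_normal_moment_nz_1[of "sqrt v" 0] by auto
  have m1: "(\<integral>y. ?d y * y \<partial>lborel) = 0"
    using assms normal_moment_nz_1[of "sqrt v" 0] by (simp add: has_bochner_integral_iff)
  have m2: "(\<integral>y. ?d y * y\<^sup>2 \<partial>lborel) = v"
    using assms integral_normal_moment_even[of "sqrt v" 0 1] by simp
  have eq: "?d y * (a + k * y)\<^sup>2 = a\<^sup>2 * ?d y + (2 * a * k) * (?d y * y) + k\<^sup>2 * (?d y * y\<^sup>2)" for y
    by (simp add: power2_eq_square algebra_simps)
  have i: "integrable lborel (\<lambda>y. ?d y * (a + k * y)\<^sup>2)"
    unfolding eq using sq li assms by auto
  have "(\<integral>\<^sup>+y. ennreal ((a + k * y)\<^sup>2) \<partial>gauss v) = (\<integral>\<^sup>+y. ennreal (?d y * (a + k * y)\<^sup>2) \<partial>lborel)"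
    by (subst nn_integral_gauss) (auto simp: ennreal_mult)
  also have "\<dots> = ennreal (\<integral>y. ?d y * (a + k * y)\<^sup>2 \<partial>lborel)"
    by (rule nn_integral_eq_integral[OF i]) auto
  also have "(\<integral>y. ?d y * (a + k * y)\<^sup>2 \<partial>lborel) = a\<^sup>2 + k\<^sup>2 * v"
    unfolding eq using sq li assms m1 m2 by simp
  finally show ?thesis using assms by (simp add: ennreal_plus)
qed

section \<open>Lebesgue densities of Gaussian product measures\<close>

lemma nn_integral_PiM_density:
  fixes f :: "real \<Rightarrow> real"
  assumes [measurable]: "f \<in> borel_measurable borel" and sf: "sigma_finite_measure (density lborel f)"
    and I: "finite I" and F: "F \<in> borel_measurable (PiM I (\<lambda>_. borel))"
  shows "(\<integral>\<^sup>+x. F x \<partial>PiM I (\<lambda>_. density lborel f)) =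
         (\<integral>\<^sup>+x. (\<Prod>i\<in>I. ennreal (f (x i))) * F x \<partial>PiM I (\<lambda>_. lborel))"
  using I F
proof (induction I arbitrary: F rule: finite_induct)
  case empty
  then show ?case by (simp add: PiM_empty)
next
  case (insert i I)
  interpret d: product_sigma_finite "\<lambda>_. density lborel f"
    using sf by (simp add: product_sigma_finite_def)
  note [measurable] = insert.prems
  have c: "sets (PiM J (\<lambda>_. density lborel f)) = sets (PiM J (\<lambda>_. borel))" for J :: "'a set"
    by (intro sets_PiM_cong) auto
  have c': "sets (PiM J (\<lambda>_. lborel :: real measure)) = sets (PiM J (\<lambda>_. borel))" for J :: "'a set"
    by (intro sets_PiM_cong) auto
  have F1: "F \<in> borel_measurable (PiM (insert i I) (\<lambda>_. density lborel f))"
    using insert.prems by (simp cong: measurable_cong_sets add: c)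
  have upd[measurable]: "(\<lambda>x. F ((fst x)(i := snd x))) \<in> borel_measurable (PiM I (\<lambda>_. borel) \<Otimes>\<^sub>M borel)"
    by measurable
  have "(\<integral>\<^sup>+x. F x \<partial>PiM (insert i I) (\<lambda>_. density lborel f)) =
     (\<integral>\<^sup>+x. (\<integral>\<^sup>+y. F (x(i := y)) \<partial>density lborel f) \<partial>PiM I (\<lambda>_. density lborel f))"
    using insert.hyps F1 by (rule d.product_nn_integral_insert)
  \<comment> \<open>The inner integral over the new coordinate is itself a function of the remaining
    ones; this is why F is arbitrary in the induction.\<close>
  also have "\<dots> = (\<integral>\<^sup>+x. (\<Prod>j\<in>I. ennreal (f (x j))) * (\<integral>\<^sup>+y. F (x(i := y)) \<partial>density lborel f) \<partial>PiM I (\<lambda>_. lborel))"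
  proof (rule insert.IH)
    have "(\<lambda>x. \<integral>\<^sup>+y. F ((fst (x, y))(i := snd (x, y))) \<partial>density lborel f) \<in> borel_measurable (PiM I (\<lambda>_. borel))"
    proof (rule sigma_finite_measure.borel_measurable_nn_integral)
      show "sigma_finite_measure (density lborel f)" by fact
      show "(\<lambda>(x, y). F ((fst (x, y))(i := snd (x, y)))) \<in> borel_measurable (PiM I (\<lambda>_. borel) \<Otimes>\<^sub>M density lborel f)"
        using upd by (simp add: split_beta' cong: measurable_cong_sets)
    qed
    then show "(\<lambda>x. \<integral>\<^sup>+y. F (x(i := y)) \<partial>density lborel f) \<in> borel_measurable (PiM I (\<lambda>_. borel))" by simp
  qed
  also have "\<dots> = (\<integral>\<^sup>+x. (\<integral>\<^sup>+y. (\<Prod>j\<in>I. ennreal (f (x j))) * (ennreal (f y) * F (x(i := y))) \<partial>lborel) \<partial>PiM I (\<lambda>_. lborel))"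
  proof (rule nn_integral_cong)
    fix x :: "'a \<Rightarrow> real" assume x: "x \<in> space (PiM I (\<lambda>_. lborel))"
    then have "(\<lambda>y. x(i := y)) \<in> borel \<rightarrow>\<^sub>M PiM (insert i I) (\<lambda>_. borel)"
      by (intro measurable_fun_upd[where J=I]) (auto simp: space_PiM)
    then have [measurable]: "(\<lambda>y. F (x(i := y))) \<in> borel_measurable borel"
      by measurable
    show "(\<Prod>j\<in>I. ennreal (f (x j))) * (\<integral>\<^sup>+y. F (x(i := y)) \<partial>density lborel f) =
       (\<integral>\<^sup>+y. (\<Prod>j\<in>I. ennreal (f (x j))) * (ennreal (f y) * F (x(i := y))) \<partial>lborel)"
      by (subst nn_integral_density) (auto simp: nn_integral_cmult)
  qed
  also have "\<dots> = (\<integral>\<^sup>+x. (\<integral>\<^sup>+y. (\<Prod>j\<in>insert i I. ennreal (f ((x(i:=y)) j))) * F (x(i := y)) \<partial>lborel) \<partial>PiM I (\<lambda>_. lborel))"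
  proof -
    have "(\<Prod>j\<in>insert i I. ennreal (f ((x(i:=y)) j))) = (\<Prod>j\<in>I. ennreal (f (x j))) * ennreal (f y)" for x y
    proof -
      have "(\<Prod>j\<in>I. ennreal (f ((x(i:=y)) j))) = (\<Prod>j\<in>I. ennreal (f (x j)))"
        by (rule prod.cong) (use insert.hyps in auto)
      then show ?thesis using insert.hyps by (simp add: mult.commute)
    qed
    then show ?thesis by (simp add: mult.assoc)
  qed
  also have "\<dots> = (\<integral>\<^sup>+x. (\<Prod>j\<in>insert i I. ennreal (f (x j))) * F x \<partial>PiM (insert i I) (\<lambda>_. lborel))"
    using insert.hyps by (subst lebs.product_nn_integral_insert) auto
  finally show ?case .
qed

lemma nn_integral_PiM_gauss:
  assumes "v > 0" "finite I" "F \<in> borel_measurable (PiM I (\<lambda>_. borel))"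
  shows "(\<integral>\<^sup>+x. F x \<partial>PiM I (\<lambda>_. gauss v)) =
         (\<integral>\<^sup>+x. (\<Prod>i\<in>I. ennreal (phi v (x i))) * F x \<partial>PiM I (\<lambda>_. lborel))"
  unfolding gauss_def
  using assms prob_space_gauss[OF assms(1)]
  by (intro nn_integral_PiM_density)
     (auto simp: gauss_def prob_space_imp_sigma_finite)

text \<open>The output sequence of a channel with additive noise x whose i-th input is the function
  g i of the past outputs.\<close>
primrec tri :: "(nat \<Rightarrow> (nat \<Rightarrow> real) \<Rightarrow> real) \<Rightarrow> nat \<Rightarrow> (nat \<Rightarrow> real) \<Rightarrow> nat \<Rightarrow> real" where
  "tri g 0 x = (\<lambda>_. undefined)"
| "tri g (Suc n) x = (tri g n x)(n := g n (tri g n x) + x n)"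

text \<open>The default \<open>undefined\<close> beyond n makes outputs extensional: they lie in the
  space of \<open>seqs n\<close>, and restricting a longer output gives exactly the shorter
  one.\<close>

lemma tri_undefined: "i \<ge> n \<Longrightarrow> tri g n x i = undefined"
  by (induction n) auto

lemma tri_stable: "m \<le> n \<Longrightarrow> i < m \<Longrightarrow> tri g n x i = tri g m x i"
  by (induction n) (auto elim: le_SucE)

lemma restrict_tri: "m \<le> n \<Longrightarrow> restrict (tri g n x) {..<m} = tri g m x"
  by (rule ext) (auto simp: tri_stable tri_undefined not_less)

lemma tri_nth: "i < n \<Longrightarrow> tri g n x i = g i (tri g i x) + x i"
  using tri_stable[of "Suc i" n i g x] by simp

lemma tri_cong: "(\<And>i. i < n \<Longrightarrow> x i = x' i) \<Longrightarrow>
    (\<And>i. i < n \<Longrightarrow> g i (tri g i x) = g' i (tri g i x)) \<Longrightarrow> tri g n x = tri g' n x'"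
proof (induction n)
  case (Suc n)
  then have IH: "tri g n x = tri g' n x'" by simp
  have "g n (tri g n x) = g' n (tri g n x)" "x n = x' n" using Suc.prems by auto
  then show ?case by (simp add: IH)
qed simp

lemma tri_space: "tri g n x \<in> space (seqs n)"
  by (auto simp: space_PiM PiE_def extensional_def tri_undefined)

text \<open>The parameter a stands for what the drift reads besides past outputs: messages, state
  and randomisers.\<close>

lemma measurable_tri:
  assumes "\<And>i. i < n \<Longrightarrow> (\<lambda>(a, y). g a i y) \<in> borel_measurable (M \<Otimes>\<^sub>M seqs i)"
    and "\<And>i. i < n \<Longrightarrow> (\<lambda>a. x a i) \<in> borel_measurable M"
  shows "(\<lambda>a. tri (g a) n (x a)) \<in> M \<rightarrow>\<^sub>M seqs n"
  using assms
proof (induction n)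
  case 0
  then show ?case by (simp add: PiM_empty space_PiM)
next
  case (Suc n)
  then have [measurable]: "(\<lambda>a. tri (g a) n (x a)) \<in> M \<rightarrow>\<^sub>M seqs n" by simp
  have [measurable]: "(\<lambda>(a, y). g a n y) \<in> borel_measurable (M \<Otimes>\<^sub>M seqs n)"
    "(\<lambda>a. x a n) \<in> borel_measurable M" using Suc.prems by auto
  have "(\<lambda>a. (\<lambda>(a, y). g a n y) (a, tri (g a) n (x a)) + x a n) \<in> borel_measurable M"
    by measurable
  then show ?case
    by (simp only: tri.simps) (rule measurable_fun_upd[where J="{..<n}"], auto)
qed

lemma measurable_tri':
  assumes "\<And>i. i < n \<Longrightarrow> g i \<in> borel_measurable (seqs i)"
  shows "tri g n \<in> seqs n \<rightarrow>\<^sub>M seqs n"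
proof -
  have "(\<lambda>a. tri ((\<lambda>_. g) a) n ((\<lambda>a. a) a)) \<in> seqs n \<rightarrow>\<^sub>M seqs n"
  proof (rule measurable_tri)
    fix i assume i: "i < n"
    note [measurable] = assms[OF i]
    show "(\<lambda>(a, y). g i y) \<in> borel_measurable (seqs n \<Otimes>\<^sub>M seqs i)"
      by measurable
    show "(\<lambda>a. a i) \<in> borel_measurable (seqs n)" using i by simp
  qed
  then show ?thesis by simp
qed

text \<open>The map is a composition of unit-Jacobian shears, so it preserves Lebesgue measure.\<close>
lemma nn_integral_tri:
  assumes "\<And>i. i < n \<Longrightarrow> g i \<in> borel_measurable (seqs i)"
    and "F \<in> borel_measurable (seqs n)"
  shows "(\<integral>\<^sup>+x. F (tri g n x) \<partial>lebs n) = (\<integral>\<^sup>+x. F x \<partial>lebs n)"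
  using assms
proof (induction n arbitrary: F)
  case 0
  show ?case by (simp add: PiM_empty nn_integral_count_space_finite)
next
  case (Suc n)
  note [measurable] = Suc.prems(2)
  have [measurable]: "tri g (Suc n) \<in> seqs (Suc n) \<rightarrow>\<^sub>M seqs (Suc n)"
    using Suc.prems(1) by (rule measurable_tri')
  have S: "{..<Suc n} = insert n {..<n}" by auto
  have [measurable]: "(\<lambda>x. F ((fst x)(n := snd x))) \<in> borel_measurable (seqs n \<Otimes>\<^sub>M borel)"
    using Suc.prems(2) unfolding S by measurable
  have "(\<integral>\<^sup>+x. F (tri g (Suc n) x) \<partial>lebs (Suc n)) =
     (\<integral>\<^sup>+x. \<integral>\<^sup>+y. F (tri g (Suc n) (x(n := y))) \<partial>lborel \<partial>lebs n)"
    unfolding S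
  proof (rule lebs.product_nn_integral_insert)
    have "(\<lambda>x. F (tri g (Suc n) x)) \<in> borel_measurable (lebs (Suc n))" by measurable
    then show "(\<lambda>x. F (tri g (Suc n) x)) \<in> borel_measurable (PiM (insert n {..<n}) (\<lambda>_. lborel))" 
      unfolding S .
  qed auto
  also have "\<dots> = (\<integral>\<^sup>+x. \<integral>\<^sup>+y. F ((tri g n x)(n := g n (tri g n x) + y)) \<partial>lborel \<partial>lebs n)"
  proof -
    \<comment> \<open>The first n outputs do not see the last noise sample. In the inner integral
      the shift is therefore a constant, and translation invariance removes it.\<close>
    have "tri g n (x(n := y)) = tri g n x" for x y by (rule tri_cong) auto
    then show ?thesis by simp
  qed
  also have "\<dots> = (\<integral>\<^sup>+x. \<integral>\<^sup>+y. F ((tri g n x)(n := y)) \<partial>lborel \<partial>lebs n)"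
  proof (rule nn_integral_cong)
    fix x
    have "(\<lambda>y. (tri g n x)(n := y)) \<in> borel \<rightarrow>\<^sub>M seqs (Suc n)"
      unfolding S using tri_space[of g n x]
      by (intro measurable_fun_upd[where J="{..<n}"]) (auto simp: space_PiM)
    then have "(\<lambda>y. F ((tri g n x)(n := y))) \<in> borel_measurable borel"
      by measurable
    from nn_integral_real_affine[OF this, of 1 "g n (tri g n x)"]
    show "(\<integral>\<^sup>+y. F ((tri g n x)(n := g n (tri g n x) + y)) \<partial>lborel) = (\<integral>\<^sup>+y. F ((tri g n x)(n := y)) \<partial>lborel)"
      by simp
  qed
  also have "\<dots> = (\<integral>\<^sup>+x. \<integral>\<^sup>+y. F (x(n := y)) \<partial>lborel \<partial>lebs n)"
  proof (rule Suc.IH)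
    have "(\<lambda>x. \<integral>\<^sup>+y. F ((fst (x, y))(n := snd (x, y))) \<partial>lborel) \<in> borel_measurable (seqs n)"
      by measurable
    then show "(\<lambda>x. \<integral>\<^sup>+y. F (x(n := y)) \<partial>lborel) \<in> borel_measurable (seqs n)" by simp
  qed (use Suc.prems in auto)
  also have "\<dots> = (\<integral>\<^sup>+x. F x \<partial>lebs (Suc n))"
    using Suc.prems(2) unfolding S
    by (subst lebs.product_nn_integral_insert) (auto cong: measurable_cong_sets)
  finally show ?case .
qed

text \<open>As u ignores coordinate i, that coordinate is an independent centred Gaussian and the
  cross term vanishes. Nonnegative integrals allow both sides to be infinite, so integrability of u
  need not be known first.\<close>

lemma gauss_resample:
  assumes v: "v > 0" and I: "finite I" "i \<in> I" and u[measurable]: "u \<in> borel_measurable (PiM I (\<lambda>_. borel))"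
    and ind: "\<And>x y. u (x(i := y)) = u x"
  shows "(\<integral>\<^sup>+x. ennreal ((u x + k * x i)\<^sup>2) \<partial>PiM I (\<lambda>_. gauss v)) =
         (\<integral>\<^sup>+x. ennreal ((u x)\<^sup>2) \<partial>PiM I (\<lambda>_. gauss v)) + ennreal (k\<^sup>2 * v)"
proof -
  interpret g: prob_space "gauss v" using v by (rule prob_space_gauss)
  interpret p: product_prob_space "\<lambda>_. gauss v" by unfold_locales
  let ?J = "I - {i}"
  interpret J: prob_space "PiM ?J (\<lambda>_. gauss v)" by (intro prob_space_PiM) unfold_locales
  have S: "I = insert i ?J" using I by auto
  have [measurable]: "u \<in> borel_measurable (PiM (insert i ?J) (\<lambda>_. borel))" using u S by simp
  \<comment> \<open>Fixing coordinate i at 0 exhibits u as a measurable function of the remaining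
    coordinates.\<close>
  have ue: "u = (\<lambda>x. u (x(i := 0)))" using ind by metis
  have [measurable]: "(\<lambda>x. u (x(i := 0))) \<in> borel_measurable (PiM ?J (\<lambda>_. borel))" by measurable
  have [measurable]: "u \<in> borel_measurable (PiM ?J (\<lambda>_. borel))" by (subst ue) measurable
  have m: "(\<lambda>x. ennreal ((u x + l * x i)\<^sup>2)) \<in> borel_measurable (PiM (insert i ?J) (\<lambda>_. gauss v))" for l
    by (subst measurable_cong_sets[OF sets_PiM_cong[OF refl sets_gauss] refl]) measurable
  have "(\<integral>\<^sup>+x. ennreal ((u x + l * x i)\<^sup>2) \<partial>PiM I (\<lambda>_. gauss v)) =
     (\<integral>\<^sup>+x. ennreal ((u x)\<^sup>2) \<partial>PiM ?J (\<lambda>_. gauss v)) + ennreal (l\<^sup>2 * v)" for l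
  proof -
    \<comment> \<open>Proved for every l because l = 0 converts the integral over the remaining
      coordinates back into one over all of I.\<close>
    have "(\<integral>\<^sup>+x. ennreal ((u x + l * x i)\<^sup>2) \<partial>PiM (insert i ?J) (\<lambda>_. gauss v)) =
      (\<integral>\<^sup>+x. \<integral>\<^sup>+y. ennreal ((u (x(i:=y)) + l * y)\<^sup>2) \<partial>gauss v \<partial>PiM ?J (\<lambda>_. gauss v))"
      by (subst p.product_nn_integral_insert) (use I m in auto)
    also have "\<dots> = (\<integral>\<^sup>+x. ennreal ((u x)\<^sup>2) + ennreal (l\<^sup>2 * v) \<partial>PiM ?J (\<lambda>_. gauss v))"
      using v by (simp add: ind gauss_second_moment)
    also have "\<dots> = (\<integral>\<^sup>+x. ennreal ((u x)\<^sup>2) \<partial>PiM ?J (\<lambda>_. gauss v)) + ennreal (l\<^sup>2 * v)"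
      using v by (subst nn_integral_add) (auto simp: J.emeasure_space_1 cong: measurable_cong_sets)
    finally show ?thesis using S by simp
  qed
  from this[of k] this[of 0] show ?thesis by simp
qed

section \<open>The channel space\<close>

text \<open>Makes one noise sequence the innermost variable while everything before and after it is
  held fixed.\<close>

lemma nn_integral_pair_middle:
  assumes "prob_space A" "prob_space B" "prob_space C"
    and F[measurable]: "F \<in> borel_measurable (A \<Otimes>\<^sub>M (B \<Otimes>\<^sub>M C))"
  shows "(\<integral>\<^sup>+x. F x \<partial>(A \<Otimes>\<^sub>M (B \<Otimes>\<^sub>M C))) = (\<integral>\<^sup>+x. \<integral>\<^sup>+b. F (fst x, b, snd x) \<partial>B \<partial>(A \<Otimes>\<^sub>M C))"
proof -
  interpret A: prob_space A by fact
  interpret B: prob_space B by fact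
  interpret C: prob_space C by fact
  interpret BC: pair_prob_space B C ..
  interpret CB: pair_sigma_finite C B ..
  have "(\<integral>\<^sup>+x. F x \<partial>(A \<Otimes>\<^sub>M (B \<Otimes>\<^sub>M C))) = (\<integral>\<^sup>+a. \<integral>\<^sup>+y. F (a, y) \<partial>(B \<Otimes>\<^sub>M C) \<partial>A)"
    by (rule BC.nn_integral_fst[symmetric]) (rule F)
  also have "\<dots> = (\<integral>\<^sup>+a. \<integral>\<^sup>+c. \<integral>\<^sup>+b. F (a, b, c) \<partial>B \<partial>C \<partial>A)"
  proof (rule nn_integral_cong)
    fix a assume [measurable]: "a \<in> space A"
    show "(\<integral>\<^sup>+y. F (a, y) \<partial>(B \<Otimes>\<^sub>M C)) = (\<integral>\<^sup>+c. \<integral>\<^sup>+b. F (a, b, c) \<partial>B \<partial>C)"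
      by (subst BC.nn_integral_snd[symmetric]) auto
  qed
  also have "\<dots> = (\<integral>\<^sup>+x. \<integral>\<^sup>+b. F (fst x, b, snd x) \<partial>B \<partial>(A \<Otimes>\<^sub>M C))"
    by (subst C.nn_integral_fst[symmetric]) auto
  finally show ?thesis .
qed

lemma nn_integral_uniform_count_measure:
  assumes "finite A"
  shows "(\<integral>\<^sup>+x. f x \<partial>uniform_count_measure A) = ennreal (1 / real (card A)) * (\<Sum>x\<in>A. f x)"
  using assms unfolding uniform_count_measure_def
  by (subst nn_integral_point_measure_finite)
     (auto simp: sum_distrib_left)

abbreviation unit_unif :: "real measure" where
  "unit_unif \<equiv> uniform_measure lborel {0..1}"

definition noise_space :: "nat \<Rightarrow> real \<Rightarrow> real \<Rightarrow> real \<Rightarrow>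
    ((nat \<Rightarrow> real) \<times> (nat \<Rightarrow> real) \<times> (nat \<Rightarrow> real) \<times> real \<times> real) measure" where
  "noise_space N Q v1 v2 =
     noises N Q \<Otimes>\<^sub>M noises N v1 \<Otimes>\<^sub>M noises N v2 \<Otimes>\<^sub>M
     unit_unif \<Otimes>\<^sub>M unit_unif"

lemma sets_PiM_gauss [measurable_cong]: "sets (PiM I (\<lambda>_. gauss v)) = sets (PiM I (\<lambda>_. borel))"
  by (rule sets_PiM_cong) auto

lemma sets_PiM_lborel [measurable_cong]: "sets (PiM I (\<lambda>_. lborel)) = sets (PiM I (\<lambda>_. borel :: real measure))"
  by (rule sets_PiM_cong) auto

lemma sets_noise_space [measurable_cong]:
  "sets (noise_space N Q v1 v2) = sets (seqs N \<Otimes>\<^sub>M seqs N \<Otimes>\<^sub>M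
     seqs N \<Otimes>\<^sub>M borel \<Otimes>\<^sub>M borel)"
  unfolding noise_space_def by (intro sets_pair_measure_cong sets_PiM_gauss) auto

lemma sets_chan_space [measurable_cong]:
  "sets (chan_space N M1 M2 Q v1 v2) = sets (count_space {1..M1} \<Otimes>\<^sub>M count_space {1..M2} \<Otimes>\<^sub>M
     seqs N \<Otimes>\<^sub>M seqs N \<Otimes>\<^sub>M seqs N \<Otimes>\<^sub>M borel \<Otimes>\<^sub>M borel)"
  unfolding chan_space_def
  by (intro sets_pair_measure_cong sets_PiM_gauss) (auto simp: sets_uniform_count_measure)

lemma prob_space_unit_unif: "prob_space unit_unif"
  by (rule prob_space_uniform_measure) auto

lemma prob_space_PiM_gauss: "v > 0 \<Longrightarrow> prob_space (PiM I (\<lambda>_. gauss v))"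
  by (intro prob_space_PiM prob_space_gauss)

lemma prob_space_pair: "prob_space A \<Longrightarrow> prob_space B \<Longrightarrow> prob_space (A \<Otimes>\<^sub>M B)"
  by (simp add: pair_prob_space.intro pair_sigma_finite_def prob_space_imp_sigma_finite
      prob_space_pair)

lemma prob_space_noise_space: "Q > 0 \<Longrightarrow> v1 > 0 \<Longrightarrow> v2 > 0 \<Longrightarrow> prob_space (noise_space N Q v1 v2)"
  unfolding noise_space_def by (intro prob_space_pair prob_space_PiM_gauss prob_space_unit_unif)

lemma prob_space_uniform_count_measure: "finite A \<Longrightarrow> A \<noteq> {} \<Longrightarrow> prob_space (uniform_count_measure A)"
  by (rule prob_spaceI) (simp add: emeasure_uniform_count_measure space_uniform_count_measure)

lemma chan_space_eq: "chan_space N M1 M2 Q v1 v2 =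
    uniform_count_measure {1..M1} \<Otimes>\<^sub>M uniform_count_measure {1..M2} \<Otimes>\<^sub>M noise_space N Q v1 v2"
  by (simp add: chan_space_def noise_space_def)

lemma prob_space_chan_space:
  "Q > 0 \<Longrightarrow> v1 > 0 \<Longrightarrow> v2 > 0 \<Longrightarrow> M1 > 0 \<Longrightarrow> M2 > 0 \<Longrightarrow> prob_space (chan_space N M1 M2 Q v1 v2)"
  unfolding chan_space_eq
  by (intro prob_space_pair prob_space_noise_space prob_space_uniform_count_measure) auto

lemma nn_integral_chan_space:
  assumes "Q > 0" "v1 > 0" "v2 > 0" "M1 > 0" "M2 > 0"
    and F[measurable]: "F \<in> borel_measurable (chan_space N M1 M2 Q v1 v2)"
  shows "(\<integral>\<^sup>+\<omega>. F \<omega> \<partial>chan_space N M1 M2 Q v1 v2) =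
    ennreal (1 / (real M1 * real M2)) *
      (\<Sum>w1\<in>{1..M1}. \<Sum>w2\<in>{1..M2}. \<integral>\<^sup>+x. F (w1, w2, x) \<partial>noise_space N Q v1 v2)"
proof -
  interpret n: prob_space "noise_space N Q v1 v2" using assms by (intro prob_space_noise_space)
  interpret c2: prob_space "uniform_count_measure {1..M2}"
    using assms by (intro prob_space_uniform_count_measure) auto
  interpret nc: pair_prob_space "uniform_count_measure {1..M2}" "noise_space N Q v1 v2" ..
  have F': "F \<in> borel_measurable (uniform_count_measure {1..M1} \<Otimes>\<^sub>M uniform_count_measure {1..M2} \<Otimes>\<^sub>M noise_space N Q v1 v2)"
    using F by (simp add: chan_space_eq)
  have "(\<integral>\<^sup>+\<omega>. F \<omega> \<partial>chan_space N M1 M2 Q v1 v2) =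
     (\<integral>\<^sup>+w1. \<integral>\<^sup>+y. F (w1, y) \<partial>(uniform_count_measure {1..M2} \<Otimes>\<^sub>M noise_space N Q v1 v2) \<partial>uniform_count_measure {1..M1})"
    unfolding chan_space_eq by (rule nc.nn_integral_fst[symmetric]) (rule F')
  also have "\<dots> = (\<integral>\<^sup>+w1. \<integral>\<^sup>+w2. \<integral>\<^sup>+x. F (w1, w2, x) \<partial>noise_space N Q v1 v2 \<partial>uniform_count_measure {1..M2} \<partial>uniform_count_measure {1..M1})"
  proof (rule nn_integral_cong)
    fix w1 assume "w1 \<in> space (uniform_count_measure {1..M1})"
    then have "(\<lambda>y. F (w1, y)) \<in> borel_measurable (uniform_count_measure {1..M2} \<Otimes>\<^sub>M noise_space N Q v1 v2)"
      using F' by measurable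
    then show "(\<integral>\<^sup>+y. F (w1, y) \<partial>(uniform_count_measure {1..M2} \<Otimes>\<^sub>M noise_space N Q v1 v2)) =
       (\<integral>\<^sup>+w2. \<integral>\<^sup>+x. F (w1, w2, x) \<partial>noise_space N Q v1 v2 \<partial>uniform_count_measure {1..M2})"
      by (subst n.nn_integral_fst[symmetric]) auto
  qed
  also have "\<dots> = ennreal (1 / (real M1 * real M2)) *
      (\<Sum>w1\<in>{1..M1}. \<Sum>w2\<in>{1..M2}. \<integral>\<^sup>+x. F (w1, w2, x) \<partial>noise_space N Q v1 v2)"
    by (simp add: nn_integral_uniform_count_measure sum_distrib_left[symmetric] mult.assoc[symmetric] ennreal_mult[symmetric])
  finally show ?thesis .
qed

lemma measurable_noise_section:
  assumes "F \<in> borel_measurable (chan_space N M1 M2 Q v1 v2)" "w1 \<in> {1..M1}" "w2 \<in> {1..M2}"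
  shows "(\<lambda>x. F (w1, w2, x)) \<in> borel_measurable (noise_space N Q v1 v2)"
proof -
  have "(\<lambda>x. (w1, w2, x)) \<in> noise_space N Q v1 v2 \<rightarrow>\<^sub>M chan_space N M1 M2 Q v1 v2"
    unfolding chan_space_eq using assms by (intro measurable_Pair) (auto simp: space_uniform_count_measure)
  from measurable_compose[OF this assms(1)] show ?thesis .
qed

lemma nn_integral_noise_inner1:
  assumes "Q > 0" "v1 > 0" "v2 > 0" "F \<in> borel_measurable (noise_space N Q v1 v2)"
  shows "(\<integral>\<^sup>+x. F x \<partial>noise_space N Q v1 v2) =
    (\<integral>\<^sup>+x. \<integral>\<^sup>+e. F (fst x, e, snd x) \<partial>noises N v1
      \<partial>(noises N Q \<Otimes>\<^sub>M noises N v2 \<Otimes>\<^sub>M unit_unif \<Otimes>\<^sub>M unit_unif))"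
  using assms(4) unfolding noise_space_def
  by (intro nn_integral_pair_middle prob_space_pair prob_space_PiM_gauss prob_space_unit_unif assms)

lemma measurable_oW1 [measurable]: "oW1 \<in> chan_space N M1 M2 Q v1 v2 \<rightarrow>\<^sub>M count_space UNIV"
proof -
  have "(\<lambda>\<omega>. (\<lambda>x. x) (fst \<omega>)) \<in> chan_space N M1 M2 Q v1 v2 \<rightarrow>\<^sub>M count_space UNIV" 
    by (rule measurable_compose[where N="count_space {1..M1}"], measurable)
  then show ?thesis unfolding oW1_def[abs_def] .
qed

lemma measurable_oW2 [measurable]: "oW2 \<in> chan_space N M1 M2 Q v1 v2 \<rightarrow>\<^sub>M count_space UNIV"
proof -
  have "(\<lambda>\<omega>. (\<lambda>x. x) (fst (snd \<omega>))) \<in> chan_space N M1 M2 Q v1 v2 \<rightarrow>\<^sub>M count_space UNIV" 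
    by (rule measurable_compose[where N="count_space {1..M2}"], measurable)
  then show ?thesis unfolding oW2_def[abs_def] .
qed

lemma measurable_oS [measurable]: "oS \<in> chan_space N M1 M2 Q v1 v2 \<rightarrow>\<^sub>M seqs N"
  unfolding oS_def by measurable

lemma measurable_oE1 [measurable]: "oE1 \<in> chan_space N M1 M2 Q v1 v2 \<rightarrow>\<^sub>M seqs N"
  unfolding oE1_def by measurable

lemma measurable_oE2 [measurable]: "oE2 \<in> chan_space N M1 M2 Q v1 v2 \<rightarrow>\<^sub>M seqs N"
  unfolding oE2_def by measurable

lemma measurable_oT1 [measurable]: "oT1 \<in> chan_space N M1 M2 Q v1 v2 \<rightarrow>\<^sub>M borel"
  unfolding oT1_def by measurable

lemma measurable_oT2 [measurable]: "oT2 \<in> chan_space N M1 M2 Q v1 v2 \<rightarrow>\<^sub>M borel"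
  unfolding oT2_def by measurable

section \<open>The output as a triangular function of the receiver noise\<close>

definition drift :: "enc1 \<Rightarrow> enc2 \<Rightarrow> nat \<Rightarrow> outcome \<Rightarrow> nat \<Rightarrow> (nat \<Rightarrow> real) \<Rightarrow> real" where
  "drift f1 f2 N \<omega> i y = f1 i (oW1 \<omega>, restrict (oS \<omega>) {..<N}, y, oT1 \<omega>)
     + f2 i (oW1 \<omega>, oW2 \<omega>, restrict (oS \<omega>) {..<N}, y, oT2 \<omega>) + oS \<omega> i"

lemma length_ylist [simp]: "length (ylist f1 f2 N i \<omega>) = i"
  by (induction i) (auto simp: Let_def)

text \<open>Replaces the list recursion of the channel by \<open>tri\<close>. The drift does not
  read the noise coordinate of \<omega>, so for fixed messages, state and randomisers it is one
  fixed family of functions of past outputs.\<close>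

lemma ypast_eq_tri: "ypast f1 f2 N i \<omega> = tri (drift f1 f2 N \<omega>) i (oE1 \<omega>)"
proof (induction i)
  case 0
  show ?case by (auto simp: ypast_def)
next
  case (Suc i)
  have y: "restrict (\<lambda>j. ylist f1 f2 N i \<omega> ! j) {..<i} = tri (drift f1 f2 N \<omega>) i (oE1 \<omega>)"
    using Suc.IH unfolding ypast_def .
  show ?case
  proof
    fix j
    consider "j < i" | "j = i" | "j > i" by linarith
    then show "ypast f1 f2 N (Suc i) \<omega> j = tri (drift f1 f2 N \<omega>) (Suc i) (oE1 \<omega>) j"
    proof cases
      case 1
      then show ?thesis using fun_cong[OF Suc.IH, of j] by (simp add: ypast_def Let_def nth_append)
    next
      case 2
      then show ?thesis by (simp add: ypast_def y Let_def nth_append) (simp add: drift_def)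
    next
      case 3
      then show ?thesis by (simp add: ypast_def tri_undefined)
    qed
  qed
qed

lemma chY_eq_ypast: "chY f1 f2 N \<omega> = ypast f1 f2 N N \<omega>"
  by (simp add: chY_def ypast_def)

lemma chY_eq_tri: "chY f1 f2 N \<omega> = tri (drift f1 f2 N \<omega>) N (oE1 \<omega>)"
  by (simp add: chY_eq_ypast ypast_eq_tri)

lemma restrict_chY: "i \<le> N \<Longrightarrow> restrict (chY f1 f2 N \<omega>) {..<i} = ypast f1 f2 N i \<omega>"
  by (simp add: chY_eq_tri ypast_eq_tri restrict_tri)

lemma chY_nth: "i < N \<Longrightarrow> chY f1 f2 N \<omega> i = chX1 f1 f2 N i \<omega> + chX2 f1 f2 N i \<omega> + oS \<omega> i + oE1 \<omega> i"
  by (simp add: chY_eq_tri tri_nth chX1_def chX2_def ypast_eq_tri) (simp add: drift_def)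

text \<open>The measurability part of \<open>valid_code\<close>. Causality sits in the types: the
  encoders at time i are measurable on \<open>seqs i\<close>, the outputs strictly before i.\<close>

definition causal_encoders :: "nat \<Rightarrow> enc1 \<Rightarrow> enc2 \<Rightarrow> bool" where
  "causal_encoders N f1 f2 \<longleftrightarrow>
    (\<forall>i<N. f1 i \<in> borel_measurable (count_space UNIV \<Otimes>\<^sub>M seqs N \<Otimes>\<^sub>M seqs i \<Otimes>\<^sub>M borel)) \<and>
    (\<forall>i<N. f2 i \<in> borel_measurable (count_space UNIV \<Otimes>\<^sub>M count_space UNIV \<Otimes>\<^sub>M seqs N \<Otimes>\<^sub>M seqs i \<Otimes>\<^sub>M borel))"

lemmas causal_encoders_enc1 = causal_encoders_def[THEN iffD1, THEN conjunct1, rule_format]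
lemmas causal_encoders_enc2 = causal_encoders_def[THEN iffD1, THEN conjunct2, rule_format]

lemma valid_code_measurable:
  assumes "valid_code N M1 M2 P1 P2 Q v1 v2 f1 f2 dec"
  shows "causal_encoders N f1 f2" and "dec \<in> measurable (seqs N) (count_space UNIV)"
  using assms by (auto simp: valid_code_def causal_encoders_def)

context
  fixes f1 :: enc1 and f2 :: enc2 and N :: nat
  assumes enc: "causal_encoders N f1 f2"
begin

lemma measurable_drift:
  assumes "i < N"
  shows "(\<lambda>(\<omega>, y). drift f1 f2 N \<omega> i y) \<in>
    borel_measurable (chan_space N M1 M2 Q v1 v2 \<Otimes>\<^sub>M seqs i)"
proof -
  note [measurable] = causal_encoders_enc1[OF enc assms] causal_encoders_enc2[OF enc assms]
  have [measurable]: "(\<lambda>\<omega>. oS \<omega> i) \<in> borel_measurable (chan_space N M1 M2 Q v1 v2)"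
    by (rule measurable_compose[OF measurable_oS]) (use assms in simp)
  show ?thesis unfolding drift_def by measurable
qed

lemma measurable_ypast:
  assumes "i \<le> N"
  shows "ypast f1 f2 N i \<in> chan_space N M1 M2 Q v1 v2 \<rightarrow>\<^sub>M seqs i"
  unfolding ypast_eq_tri[abs_def]
proof (rule measurable_tri)
  fix j assume j: "j < i"
  show "(\<lambda>(a, y). drift f1 f2 N a j y) \<in> borel_measurable (chan_space N M1 M2 Q v1 v2 \<Otimes>\<^sub>M seqs j)"
    using j assms by (intro measurable_drift) auto
  show "(\<lambda>a. oE1 a j) \<in> borel_measurable (chan_space N M1 M2 Q v1 v2)"
    by (rule measurable_compose[OF measurable_oE1]) (use j assms in simp)
qed

lemma measurable_chY: "chY f1 f2 N \<in> chan_space N M1 M2 Q v1 v2 \<rightarrow>\<^sub>M seqs N"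
  using measurable_ypast[OF order_refl] by (simp add: chY_eq_ypast[abs_def])

lemma measurable_chX1:
  assumes "i < N"
  shows "chX1 f1 f2 N i \<in> borel_measurable (chan_space N M1 M2 Q v1 v2)"
proof -
  note [measurable] = causal_encoders_enc1[OF enc assms] measurable_ypast[OF less_imp_le[OF assms]]
  show ?thesis unfolding chX1_def[abs_def] by measurable
qed

lemma measurable_chX2:
  assumes "i < N"
  shows "chX2 f1 f2 N i \<in> borel_measurable (chan_space N M1 M2 Q v1 v2)"
proof -
  note [measurable] = causal_encoders_enc2[OF enc assms] measurable_ypast[OF less_imp_le[OF assms]]
  show ?thesis unfolding chX2_def[abs_def] by measurable
qed

lemma measurable_chZ: "chZ f1 f2 N \<in> chan_space N M1 M2 Q v1 v2 \<rightarrow>\<^sub>M seqs N"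
proof -
  note [measurable] = measurable_chY
  show ?thesis unfolding chZ_def[abs_def] by measurable
qed

end

section \<open>Change of measure\<close>

text \<open>Lifts \<open>gauss_resample\<close> to the channel space: U is determined before the
  receiver noise at time i acts, so that noise only adds its variance.\<close>

lemma resample_noise1:
  assumes pos: "Q > 0" "v1 > 0" "v2 > 0" "M1 > 0" "M2 > 0" and i: "i < N"
    and U: "U \<in> borel_measurable (chan_space N M1 M2 Q v1 v2)"
    and ind: "\<And>w1 w2 s e r y. U (w1, w2, s, e(i := y), r) = U (w1, w2, s, e, r)"
  shows "(\<integral>\<^sup>+\<omega>. ennreal ((U \<omega> + oE1 \<omega> i)\<^sup>2) \<partial>chan_space N M1 M2 Q v1 v2) =
         (\<integral>\<^sup>+\<omega>. ennreal ((U \<omega>)\<^sup>2) \<partial>chan_space N M1 M2 Q v1 v2) + ennreal v1"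
proof -
  let ?P = "chan_space N M1 M2 Q v1 v2" and ?n = "noise_space N Q v1 v2"
  let ?r = "noises N Q \<Otimes>\<^sub>M noises N v2 \<Otimes>\<^sub>M unit_unif \<Otimes>\<^sub>M unit_unif"
  interpret r: prob_space ?r using pos by (intro prob_space_pair prob_space_PiM_gauss prob_space_unit_unif)
  interpret g: prob_space "noises N v1" using pos by (intro prob_space_PiM_gauss)
  note [measurable] = U
  have [measurable]: "(\<lambda>\<omega>. oE1 \<omega> i) \<in> borel_measurable ?P"
    by (rule measurable_compose[OF measurable_oE1]) (use i in simp)
  have F: "(\<lambda>\<omega>. ennreal ((U \<omega> + oE1 \<omega> i)\<^sup>2)) \<in> borel_measurable ?P"
    and G: "(\<lambda>\<omega>. ennreal ((U \<omega>)\<^sup>2)) \<in> borel_measurable ?P" by measurable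
  have sec: "(\<integral>\<^sup>+x. ennreal ((U (w1, w2, x) + oE1 (w1, w2, x) i)\<^sup>2) \<partial>?n) =
       (\<integral>\<^sup>+x. ennreal ((U (w1, w2, x))\<^sup>2) \<partial>?n) + ennreal v1" (is "?L = ?R")
    if w: "w1 \<in> {1..M1}" "w2 \<in> {1..M2}" for w1 w2
  proof -
    have Un: "(\<lambda>x. U (w1, w2, x)) \<in> borel_measurable ?n"
      by (rule measurable_noise_section[OF U w])
    have Fn: "(\<lambda>x. ennreal ((U (w1, w2, x) + oE1 (w1, w2, x) i)\<^sup>2)) \<in> borel_measurable ?n"
      by (rule measurable_noise_section[OF F w])
    have Gn: "(\<lambda>x. ennreal ((U (w1, w2, x))\<^sup>2)) \<in> borel_measurable ?n"
      by (rule measurable_noise_section[OF G w])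
    have swap[measurable]: "(\<lambda>z. (fst (fst z), snd z, snd (fst z))) \<in> (?r \<Otimes>\<^sub>M noises N v1) \<rightarrow>\<^sub>M ?n"
      unfolding noise_space_def by measurable
    have [measurable]: "(\<lambda>x. \<integral>\<^sup>+e. ennreal ((U (w1, w2, fst x, e, snd x))\<^sup>2) \<partial>noises N v1) \<in> borel_measurable ?r"
    proof (rule g.borel_measurable_nn_integral)
      show "(\<lambda>(x, e). ennreal ((U (w1, w2, fst x, e, snd x))\<^sup>2)) \<in> borel_measurable (?r \<Otimes>\<^sub>M noises N v1)"
        using measurable_compose[OF swap Gn] by (simp add: split_beta')
    qed
    have "?L = (\<integral>\<^sup>+x. (\<integral>\<^sup>+e. ennreal ((U (w1, w2, fst x, e, snd x) + e i)\<^sup>2) \<partial>noises N v1) \<partial>?r)"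
      by (subst nn_integral_noise_inner1) (use pos Fn in \<open>auto simp: oE1_def\<close>)
    also have "\<dots> = (\<integral>\<^sup>+x. (\<integral>\<^sup>+e. ennreal ((U (w1, w2, fst x, e, snd x))\<^sup>2) \<partial>noises N v1) + ennreal v1 \<partial>?r)"
    proof (rule nn_integral_cong)
      fix x assume x: "x \<in> space ?r"
      have "(\<lambda>e. (fst x, e, snd x)) \<in> noises N v1 \<rightarrow>\<^sub>M ?n"
        unfolding noise_space_def using x by (intro measurable_Pair) (auto simp: space_pair_measure)
      from measurable_compose[OF this Un]
      have m: "(\<lambda>e. U (w1, w2, fst x, e, snd x)) \<in> borel_measurable (seqs N)"
        by (simp cong: measurable_cong_sets add: sets_PiM_gauss)
      from gauss_resample[where v=v1 and I="{..<N}" and i=i and k=1, OF pos(2) _ _ m] i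
      show "(\<integral>\<^sup>+e. ennreal ((U (w1, w2, fst x, e, snd x) + e i)\<^sup>2) \<partial>noises N v1) =
        (\<integral>\<^sup>+e. ennreal ((U (w1, w2, fst x, e, snd x))\<^sup>2) \<partial>noises N v1) + ennreal v1"
        by (simp add: ind)
    qed
    also have "\<dots> = (\<integral>\<^sup>+x. (\<integral>\<^sup>+e. ennreal ((U (w1, w2, fst x, e, snd x))\<^sup>2) \<partial>noises N v1) \<partial>?r) + ennreal v1"
      by (subst nn_integral_add) (auto simp: r.emeasure_space_1)
    also have "\<dots> = ?R"
      by (subst nn_integral_noise_inner1) (use pos Gn in auto)
    finally show ?thesis .
  qed
  let ?C = "ennreal (1 / (real M1 * real M2))"
  have c1: "?C * (\<Sum>w1\<in>{1..M1}. \<Sum>w2\<in>{1..M2}. ennreal v1) = ennreal v1"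
    using pos by (simp add: ennreal_mult[symmetric] ennreal_of_nat_eq_real_of_nat)
  have "(\<integral>\<^sup>+\<omega>. ennreal ((U \<omega> + oE1 \<omega> i)\<^sup>2) \<partial>?P) =
     ?C * (\<Sum>w1\<in>{1..M1}. \<Sum>w2\<in>{1..M2}. \<integral>\<^sup>+x. ennreal ((U (w1, w2, x) + oE1 (w1, w2, x) i)\<^sup>2) \<partial>?n)"
    by (rule nn_integral_chan_space[OF pos F])
  also have "\<dots> = ?C * (\<Sum>w1\<in>{1..M1}. \<Sum>w2\<in>{1..M2}. (\<integral>\<^sup>+x. ennreal ((U (w1, w2, x))\<^sup>2) \<partial>?n) + ennreal v1)"
    by (intro arg_cong2[where f="(*)"] refl sum.cong sec)
  also have "\<dots> = ?C * (\<Sum>w1\<in>{1..M1}. \<Sum>w2\<in>{1..M2}. (\<integral>\<^sup>+x. ennreal ((U (w1, w2, x))\<^sup>2) \<partial>?n)) + ennreal v1"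
    by (simp only: sum.distrib distrib_left c1)
  also have "\<dots> = (\<integral>\<^sup>+\<omega>. ennreal ((U \<omega>)\<^sup>2) \<partial>?P) + ennreal v1"
    by (subst nn_integral_chan_space[OF pos G]) simp
  finally show ?thesis .
qed

text \<open>Likelihood of y under the auxiliary law in which the i-th output is
  normal with mean s i + c * x1 i and variance A: it does not involve the second message.\<close>
definition aux_lik :: "enc1 \<Rightarrow> nat \<Rightarrow> real \<Rightarrow> real \<Rightarrow> nat \<Rightarrow> (nat \<Rightarrow> real) \<Rightarrow> real \<Rightarrow> (nat \<Rightarrow> real) \<Rightarrow> ennreal" where
  "aux_lik f1 N A c w1 s t y = (\<Prod>i<N. ennreal (phi A
      (y i - s i - c * f1 i (w1, restrict s {..<N}, restrict y {..<i}, t))))"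

text \<open>Auxiliary over true output density, evaluated along the actual trajectory. There
  \<open>y i - s i - c * x1 i\<close> equals x2 + (1 - c) * x1 plus the noise, and the true density
  of the output is that of the noise sample.\<close>

definition lik_ratio :: "enc1 \<Rightarrow> enc2 \<Rightarrow> nat \<Rightarrow> real \<Rightarrow> real \<Rightarrow> real \<Rightarrow> outcome \<Rightarrow> real" where
  "lik_ratio f1 f2 N v A c \<omega> = (\<Prod>i<N. phi A
      (chX2 f1 f2 N i \<omega> + (1 - c) * chX1 f1 f2 N i \<omega> + oE1 \<omega> i) / phi v (oE1 \<omega> i))"

context
  fixes f1 :: enc1 and f2 :: enc2 and N M1 M2 :: nat and Q v1 v2 A :: real
  assumes enc: "causal_encoders N f1 f2"
    and pos: "Q > 0" "v1 > 0" "v2 > 0" "M1 > 0" "M2 > 0" and A: "A > 0"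
begin

private lemmas f1 = causal_encoders_enc1[OF enc]
private lemmas f2 = causal_encoders_enc2[OF enc]
private abbreviation "chan_meas \<equiv> chan_space N M1 M2 Q v1 v2"
private abbreviation "lik c w1 x \<equiv> aux_lik f1 N A c w1 (fst x) (fst (snd (snd x)))"
private abbreviation "side_meas \<equiv> noises N Q \<Otimes>\<^sub>M noises N v2 \<Otimes>\<^sub>M unit_unif \<Otimes>\<^sub>M unit_unif"

lemma measurable_oE1_nth: "i < N \<Longrightarrow> (\<lambda>\<omega>. oE1 \<omega> i) \<in> borel_measurable chan_meas"
  by (rule measurable_compose[OF measurable_oE1]) simp

lemma measurable_Y: "chY f1 f2 N \<in> chan_meas \<rightarrow>\<^sub>M seqs N"
  by (rule measurable_chY) (rule enc)

lemma measurable_lik_ratio: "lik_ratio f1 f2 N v A' c \<in> borel_measurable chan_meas"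
  unfolding lik_ratio_def[abs_def]
proof (rule borel_measurable_prod)
  fix i assume "i \<in> {..<N}"
  then have [measurable]: "chX1 f1 f2 N i \<in> borel_measurable chan_meas" "chX2 f1 f2 N i \<in> borel_measurable chan_meas"
     "(\<lambda>\<omega>. oE1 \<omega> i) \<in> borel_measurable chan_meas"
    using measurable_chX1[OF enc] measurable_chX2[OF enc] measurable_oE1_nth by auto
  show "(\<lambda>\<omega>. normal_density 0 (sqrt A') (chX2 f1 f2 N i \<omega> + (1 - c) * chX1 f1 f2 N i \<omega> + oE1 \<omega> i) /
     phi v (oE1 \<omega> i)) \<in> borel_measurable chan_meas"
    by measurable
qed

lemma measurable_aux_lik:
  "(\<lambda>(x, y). lik c w1 x y) \<in> borel_measurable (side_meas \<Otimes>\<^sub>M lebs N)"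
  unfolding aux_lik_def split_beta'
proof (rule borel_measurable_prod_ennreal)
  fix i assume i: "i \<in> {..<N}"
  then have i': "i < N" by simp
  note [measurable] = f1[OF i']
  have [measurable]: "(\<lambda>x. fst (fst x) i) \<in> borel_measurable (side_meas \<Otimes>\<^sub>M lebs N)"
    "(\<lambda>x. snd x i) \<in> borel_measurable (side_meas \<Otimes>\<^sub>M lebs N)"
    using i by measurable
  have [measurable]: "(\<lambda>x. restrict (snd x) {..<i}) \<in> (side_meas \<Otimes>\<^sub>M lebs N) \<rightarrow>\<^sub>M seqs i"
  proof (rule measurable_restrict)
    fix j assume "j \<in> {..<i}"
    then have "j \<in> {..<N}" using i by auto
    then show "(\<lambda>x. snd x j) \<in> borel_measurable (side_meas \<Otimes>\<^sub>M lebs N)" by measurable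
  qed
  show "(\<lambda>x. ennreal (phi A (snd x i - fst (fst x) i - c * f1 i
      (w1, restrict (fst (fst x)) {..<N}, restrict (snd x) {..<i}, fst (snd (snd (fst x))))))) \<in> borel_measurable (side_meas \<Otimes>\<^sub>M lebs N)"
    by measurable
qed

lemma measurable_aux_lik_y:
  assumes "x \<in> space side_meas"
  shows "lik c w1 x \<in> borel_measurable (seqs N)"
  using measurable_compose[OF measurable_Pair1'[OF assms] measurable_aux_lik[of c w1]]
  by (simp cong: measurable_cong_sets add: sets_PiM_lborel)

lemma measurable_f1_y:
  assumes "x \<in> space side_meas" "i < N"
  shows "(\<lambda>y. f1 i (w1, restrict (fst x) {..<N}, y, t)) \<in> borel_measurable (seqs i)"
proof -
  note [measurable] = f1[OF assms(2)]
  have "restrict (fst x) {..<N} \<in> space (seqs N)" by (auto simp: space_PiM)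
  then show ?thesis by measurable
qed

lemma measurable_f2_y:
  assumes "x \<in> space side_meas" "i < N"
  shows "(\<lambda>y. f2 i (w1, w2, restrict (fst x) {..<N}, y, t)) \<in> borel_measurable (seqs i)"
proof -
  note [measurable] = f2[OF assms(2)]
  have "restrict (fst x) {..<N} \<in> space (seqs N)" by (auto simp: space_PiM)
  then show ?thesis by measurable
qed

text \<open>The auxiliary law is itself a channel with feedback: its own triangular shift turns the
  likelihood into a product of centred normal densities.\<close>

lemma nn_integral_aux_lik:
  assumes x: "x \<in> space side_meas"
  shows "(\<integral>\<^sup>+y. lik c w1 x y \<partial>lebs N) = 1"
proof -
  let ?t = "fst (snd (snd x))"
  define h where "h = (\<lambda>i y. fst x i + c * f1 i (w1, restrict (fst x) {..<N}, y, ?t))"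
  have h: "h i \<in> borel_measurable (seqs i)" if "i < N" for i
    unfolding h_def using measurable_f1_y[OF x that, of w1 ?t] by measurable
  have "(\<integral>\<^sup>+y. lik c w1 x y \<partial>lebs N) = (\<integral>\<^sup>+y. lik c w1 x (tri h N y) \<partial>lebs N)"
    by (rule nn_integral_tri[symmetric]) (use h measurable_aux_lik_y[OF x] in auto)
  also have "\<dots> = (\<integral>\<^sup>+y. (\<Prod>i<N. ennreal (phi A (y i))) \<partial>lebs N)"
  proof (rule nn_integral_cong)
    fix y
    show "lik c w1 x (tri h N y) = (\<Prod>i<N. ennreal (phi A (y i)))"
      unfolding aux_lik_def
      by (rule prod.cong) (auto simp: restrict_tri tri_nth h_def)
  qed
  also have "\<dots> = (\<Prod>i<N. \<integral>\<^sup>+z. ennreal (phi A z) \<partial>lborel)"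
    by (rule lebs.product_nn_integral_prod) auto
  also have "\<dots> = 1" using A by (simp add: nn_integral_normal_density)
  finally show ?thesis .
qed

text \<open>Weighting by the ratio cancels the true noise density. The triangular map from noise to
  output preserves Lebesgue measure, so what remains is integration of K against the auxiliary
  likelihood.\<close>

lemma nn_integral_lik_ratio_section:
  assumes w: "w1 \<in> {1..M1}" "w2 \<in> {1..M2}" and K[measurable]: "K \<in> borel_measurable (seqs N)"
  shows "(\<integral>\<^sup>+x. ennreal (lik_ratio f1 f2 N v1 A c (w1, w2, x)) * K (chY f1 f2 N (w1, w2, x)) \<partial>noise_space N Q v1 v2) =
    (\<integral>\<^sup>+x. \<integral>\<^sup>+y. lik c w1 x y * K y \<partial>lebs N \<partial>side_meas)"
proof -
  note [measurable] = measurable_lik_ratio measurable_Y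
  have F: "(\<lambda>\<omega>. ennreal (lik_ratio f1 f2 N v1 A c \<omega>) * K (chY f1 f2 N \<omega>)) \<in> borel_measurable chan_meas"
    by measurable
  have Fn: "(\<lambda>x. ennreal (lik_ratio f1 f2 N v1 A c (w1, w2, x)) * K (chY f1 f2 N (w1, w2, x))) \<in> borel_measurable (noise_space N Q v1 v2)"
    by (rule measurable_noise_section[OF F w])
  show ?thesis
  proof (subst nn_integral_noise_inner1[OF pos(1-3) Fn], rule nn_integral_cong)
    fix x assume x: "x \<in> space side_meas"
    let ?t = "fst (snd (snd x))"
    let ?\<omega> = "\<lambda>e. (w1, w2, fst x, e, snd x)"
    \<comment> \<open>The drift never reads the noise, so the dummy value \<open>undefined\<close>
      yields the same g for every e.\<close>
    define g where "g = drift f1 f2 N (?\<omega> undefined)"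
    have dr: "drift f1 f2 N (?\<omega> e) = g" for e
      unfolding g_def by (intro ext) (simp add: drift_def oW1_def oW2_def oS_def oT1_def oT2_def)
    have Y: "chY f1 f2 N (?\<omega> e) = tri g N e" for e
      by (simp add: chY_eq_tri dr oE1_def)
    have g: "g i \<in> borel_measurable (seqs i)" if "i < N" for i
      unfolding g_def drift_def 
      using measurable_f1_y[OF x that, of w1 ?t] measurable_f2_y[OF x that, of w1 w2 "snd (snd (snd x))"]
      by (simp add: oW1_def oW2_def oS_def oT1_def oT2_def)
    have Fe: "(\<lambda>e. ennreal (lik_ratio f1 f2 N v1 A c (?\<omega> e)) * K (chY f1 f2 N (?\<omega> e))) \<in> borel_measurable (seqs N)"
    proof -
      have "(\<lambda>e. (fst x, e, snd x)) \<in> noises N v1 \<rightarrow>\<^sub>M noise_space N Q v1 v2"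
        unfolding noise_space_def using x by (intro measurable_Pair) (auto simp: space_pair_measure)
      from measurable_compose[OF this Fn] show ?thesis
        by (simp cong: measurable_cong_sets add: sets_PiM_gauss)
    qed
    have "(\<integral>\<^sup>+e. ennreal (lik_ratio f1 f2 N v1 A c (?\<omega> e)) * K (chY f1 f2 N (?\<omega> e)) \<partial>noises N v1)
       = (\<integral>\<^sup>+e. (\<Prod>i<N. ennreal (phi v1 (e i))) *
            (ennreal (lik_ratio f1 f2 N v1 A c (?\<omega> e)) * K (chY f1 f2 N (?\<omega> e))) \<partial>lebs N)"
      by (rule nn_integral_PiM_gauss[OF pos(2) _ Fe]) simp
    also have "\<dots> = (\<integral>\<^sup>+e. lik c w1 x (tri g N e) * K (tri g N e) \<partial>lebs N)"
    proof (rule nn_integral_cong)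
      fix e
      have eq: "phi v1 (e i) * (phi A
          (chX2 f1 f2 N i (?\<omega> e) + (1 - c) * chX1 f1 f2 N i (?\<omega> e) + e i) / phi v1 (e i))
         = phi A (tri g N e i - fst x i - c * f1 i (w1, restrict (fst x) {..<N}, restrict (tri g N e) {..<i}, ?t))"
        if i: "i < N" for i
      proof -
        have y: "tri g N e i = chX1 f1 f2 N i (?\<omega> e) + chX2 f1 f2 N i (?\<omega> e) + fst x i + e i"
          using chY_nth[OF i, of f1 f2 "?\<omega> e"] by (simp add: Y oS_def oE1_def)
        have x1: "f1 i (w1, restrict (fst x) {..<N}, restrict (tri g N e) {..<i}, ?t) = chX1 f1 f2 N i (?\<omega> e)"
          using restrict_chY[of i N f1 f2 "?\<omega> e"] i
          by (simp add: chX1_def Y oW1_def oS_def oT1_def)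
        have "phi v1 (e i) \<noteq> 0" using normal_density_pos[of "sqrt v1" 0 "e i"] pos by simp
        then show ?thesis unfolding y x1 by (simp add: algebra_simps)
      qed
      have "(\<Prod>i<N. ennreal (phi v1 (e i))) * ennreal (lik_ratio f1 f2 N v1 A c (?\<omega> e))
         = lik c w1 x (tri g N e)"
      proof -
        have "ennreal (lik_ratio f1 f2 N v1 A c (?\<omega> e)) = (\<Prod>i<N. ennreal (phi A
          (chX2 f1 f2 N i (?\<omega> e) + (1 - c) * chX1 f1 f2 N i (?\<omega> e) + e i) / phi v1 (e i)))"
          unfolding lik_ratio_def by (subst prod_ennreal) (auto simp: oE1_def)
        then show ?thesis
          unfolding aux_lik_def by (simp add: prod.distrib[symmetric] ennreal_mult[symmetric] eq del: times_divide_eq_right)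
      qed
      then show "(\<Prod>i<N. ennreal (phi v1 (e i))) *
            (ennreal (lik_ratio f1 f2 N v1 A c (?\<omega> e)) * K (chY f1 f2 N (?\<omega> e))) =
         lik c w1 x (tri g N e) * K (tri g N e)"
        by (simp add: Y mult.assoc[symmetric])
    qed
    also have "\<dots> = (\<integral>\<^sup>+y. lik c w1 x y * K y \<partial>lebs N)"
      by (rule nn_integral_tri[of N g "\<lambda>y. lik c w1 x y * K y"])
         (use g measurable_aux_lik_y[OF x, of c w1] in auto)
    finally show "(\<integral>\<^sup>+e. ennreal (lik_ratio f1 f2 N v1 A c (w1, w2, fst x, e, snd x)) * K (chY f1 f2 N (w1, w2, fst x, e, snd x)) \<partial>noises N v1)
       = (\<integral>\<^sup>+y. lik c w1 x y * K y \<partial>lebs N)" .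
  qed
qed

lemma prob_space_rest: "prob_space side_meas"
  using pos by (intro prob_space_pair prob_space_PiM_gauss prob_space_unit_unif)

lemma nn_integral_lik_ratio: "(\<integral>\<^sup>+\<omega>. ennreal (lik_ratio f1 f2 N v1 A c \<omega>) \<partial>chan_meas) = 1"
proof -
  interpret r: prob_space side_meas by (rule prob_space_rest)
  note [measurable] = measurable_lik_ratio
  have one: "(\<integral>\<^sup>+x. \<integral>\<^sup>+y. lik c w1 x y \<partial>lebs N \<partial>side_meas) = 1" for w1
  proof -
    have "(\<integral>\<^sup>+x. \<integral>\<^sup>+y. lik c w1 x y \<partial>lebs N \<partial>side_meas) = (\<integral>\<^sup>+x. 1 \<partial>side_meas)"
      by (rule nn_integral_cong) (rule nn_integral_aux_lik)
    then show ?thesis by (simp add: r.emeasure_space_1)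
  qed
  have "(\<integral>\<^sup>+\<omega>. ennreal (lik_ratio f1 f2 N v1 A c \<omega>) \<partial>chan_meas) = ennreal (1 / (real M1 * real M2)) *
     (\<Sum>w1\<in>{1..M1}. \<Sum>w2\<in>{1..M2}. \<integral>\<^sup>+x. ennreal (lik_ratio f1 f2 N v1 A c (w1, w2, x)) \<partial>noise_space N Q v1 v2)"
    by (rule nn_integral_chan_space[OF pos]) measurable
  also have "\<dots> = ennreal (1 / (real M1 * real M2)) * (\<Sum>w1\<in>{1..M1}. \<Sum>w2\<in>{1..M2}. 1)"
    using nn_integral_lik_ratio_section[where K="\<lambda>_. 1" and c=c] one
    by (intro arg_cong2[where f="(*)"] refl sum.cong) auto
  also have "\<dots> = 1" using pos
    by (simp add: ennreal_mult[symmetric] ennreal_of_nat_eq_real_of_nat flip: ennreal_1)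
  finally show ?thesis .
qed

text \<open>For fixed w1 the output law is one and the same for every candidate w, and the events
  that the decoder returns w are disjoint, so their probabilities add up to at most 1.\<close>

lemma sum_decoding_le_1:
  assumes dec[measurable]: "dec \<in> measurable (seqs N) (count_space UNIV)" and W: "finite W"
  shows "(\<Sum>w\<in>W. \<integral>\<^sup>+x. \<integral>\<^sup>+y. lik c w1 x y * indicator {w} (dec y :: nat \<times> nat) \<partial>lebs N \<partial>side_meas) \<le> 1"
proof -
  interpret r: prob_space side_meas by (rule prob_space_rest)
  interpret leb: sigma_finite_measure "lebs N" by (rule lebs.sigma_finite) simp
  note [measurable] = measurable_aux_lik[of c w1]
  have [measurable]: "(\<lambda>y. indicator {w} (dec y) :: ennreal) \<in> borel_measurable (seqs N)" for w
    by (rule measurable_compose[OF dec]) simp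
  let ?H = "\<lambda>x y. lik c w1 x y"
  have m: "(\<lambda>(x, y). ?H x y * indicator {w} (dec y)) \<in> borel_measurable (side_meas \<Otimes>\<^sub>M lebs N)" for w
  proof -
    have "(\<lambda>z. (\<lambda>(x, y). ?H x y) z * indicator {w} (dec (snd z))) \<in> borel_measurable (side_meas \<Otimes>\<^sub>M lebs N)"
      by measurable
    then show ?thesis by (simp add: split_beta')
  qed
  have "(\<Sum>w\<in>W. \<integral>\<^sup>+x. \<integral>\<^sup>+y. ?H x y * indicator {w} (dec y) \<partial>lebs N \<partial>side_meas) =
     (\<integral>\<^sup>+x. (\<Sum>w\<in>W. \<integral>\<^sup>+y. ?H x y * indicator {w} (dec y) \<partial>lebs N) \<partial>side_meas)"
    by (rule nn_integral_sum[symmetric]) (rule leb.borel_measurable_nn_integral, rule m)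
  also have "\<dots> \<le> (\<integral>\<^sup>+x. 1 \<partial>side_meas)"
  proof (rule nn_integral_mono)
    fix x assume x: "x \<in> space side_meas"
    note [measurable] = measurable_aux_lik_y[OF x, of c w1]
    have "(\<Sum>w\<in>W. \<integral>\<^sup>+y. ?H x y * indicator {w} (dec y) \<partial>lebs N) = (\<integral>\<^sup>+y. (\<Sum>w\<in>W. ?H x y * indicator {w} (dec y)) \<partial>lebs N)"
      by (rule nn_integral_sum[symmetric]) measurable
    also have "\<dots> \<le> (\<integral>\<^sup>+y. ?H x y \<partial>lebs N)"
    proof (rule nn_integral_mono)
      fix y
      have "(\<Sum>w\<in>W. ?H x y * indicator {w} (dec y)) = ?H x y * (\<Sum>w\<in>W. indicator {w} (dec y))"
        by (simp add: sum_distrib_left)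
      also have "(\<Sum>w\<in>W. indicator {w} (dec y)) = (if dec y \<in> W then 1 else 0 :: ennreal)"
        using W by (simp add: indicator_def of_bool_def)
      finally show "(\<Sum>w\<in>W. ?H x y * indicator {w} (dec y)) \<le> ?H x y"
        by (auto split: if_splits)
    qed
    also have "\<dots> = 1" by (rule nn_integral_aux_lik[OF x])
    finally show "(\<Sum>w\<in>W. \<integral>\<^sup>+y. ?H x y * indicator {w} (dec y) \<partial>lebs N) \<le> 1" .
  qed
  also have "\<dots> = 1" by (simp add: r.emeasure_space_1)
  finally show ?thesis .
qed

text \<open>Under the auxiliary law the decoder is guessing. In general this holds for the second
  message only: each w1 contributes at most 1 and the average has M1 such terms. For c = 0 it holds
  for the pair, and all terms together contribute at most 1.\<close>

lemma nn_integral_lik_ratio_success: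
  assumes dec[measurable]: "dec \<in> measurable (seqs N) (count_space UNIV)"
  shows "(\<integral>\<^sup>+\<omega>. ennreal (lik_ratio f1 f2 N v1 A c \<omega>) * indicator {(oW1 \<omega>, oW2 \<omega>)} (dec (chY f1 f2 N \<omega>)) \<partial>chan_meas)
      \<le> ennreal (1 / real M2)"
    and "(\<integral>\<^sup>+\<omega>. ennreal (lik_ratio f1 f2 N v1 A 0 \<omega>) * indicator {(oW1 \<omega>, oW2 \<omega>)} (dec (chY f1 f2 N \<omega>)) \<partial>chan_meas)
      \<le> ennreal (1 / (real M1 * real M2))"
proof -
  note [measurable] = measurable_lik_ratio measurable_Y
  let ?C = "ennreal (1 / (real M1 * real M2))"
  let ?J = "\<lambda>c w1 w. \<integral>\<^sup>+x. \<integral>\<^sup>+y. lik c w1 x y * indicator {w} (dec y) \<partial>lebs N \<partial>side_meas"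
  have eq: "(\<integral>\<^sup>+\<omega>. ennreal (lik_ratio f1 f2 N v1 A c \<omega>) * indicator {(oW1 \<omega>, oW2 \<omega>)} (dec (chY f1 f2 N \<omega>)) \<partial>chan_meas)
     = ?C * (\<Sum>w1\<in>{1..M1}. \<Sum>w2\<in>{1..M2}. ?J c w1 (w1, w2))" for c
  proof (subst nn_integral_chan_space[OF pos])
    have *: "(\<lambda>\<omega>. indicator {(oW1 \<omega>, oW2 \<omega>)} (dec (chY f1 f2 N \<omega>)) :: ennreal) =
      (\<lambda>\<omega>. indicator {(a, b). a = b} ((oW1 \<omega>, oW2 \<omega>), dec (chY f1 f2 N \<omega>)))"
      by (auto simp: indicator_def fun_eq_iff)
    have p: "(\<lambda>\<omega>. ((oW1 \<omega>, oW2 \<omega>), dec (chY f1 f2 N \<omega>))) \<in> chan_meas \<rightarrow>\<^sub>M count_space UNIV"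
    proof -
      have "(\<lambda>\<omega>. (oW1 \<omega>, oW2 \<omega>)) \<in> chan_meas \<rightarrow>\<^sub>M count_space UNIV" by measurable
      then have "(\<lambda>\<omega>. ((oW1 \<omega>, oW2 \<omega>), dec (chY f1 f2 N \<omega>))) \<in> chan_meas \<rightarrow>\<^sub>M (count_space UNIV \<Otimes>\<^sub>M count_space UNIV)"
        by measurable
      then show ?thesis by (simp add: pair_measure_countable)
    qed
    have "(\<lambda>\<omega>. indicator {(oW1 \<omega>, oW2 \<omega>)} (dec (chY f1 f2 N \<omega>)) :: ennreal) \<in> borel_measurable chan_meas"
      unfolding * by (rule measurable_compose[OF p]) simp
    then show "(\<lambda>\<omega>. ennreal (lik_ratio f1 f2 N v1 A c \<omega>) * indicator {(oW1 \<omega>, oW2 \<omega>)} (dec (chY f1 f2 N \<omega>))) \<in> borel_measurable chan_meas"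
      by measurable
    show "?C * (\<Sum>w1 = 1..M1. \<Sum>w2 = 1..M2. \<integral>\<^sup>+ x. ennreal (lik_ratio f1 f2 N v1 A c (w1, w2, x)) *
         indicator {(oW1 (w1, w2, x), oW2 (w1, w2, x))} (dec (chY f1 f2 N (w1, w2, x))) \<partial>noise_space N Q v1 v2) =
      ?C * (\<Sum>w1\<in>{1..M1}. \<Sum>w2\<in>{1..M2}. ?J c w1 (w1, w2))"
    proof (intro arg_cong2[where f="(*)"] refl sum.cong)
      fix w1 w2 assume w: "w1 \<in> {1..M1}" "w2 \<in> {1..M2}"
      show "(\<integral>\<^sup>+ x. ennreal (lik_ratio f1 f2 N v1 A c (w1, w2, x)) *
         indicator {(oW1 (w1, w2, x), oW2 (w1, w2, x))} (dec (chY f1 f2 N (w1, w2, x))) \<partial>noise_space N Q v1 v2) = ?J c w1 (w1, w2)"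
        using nn_integral_lik_ratio_section[OF w measurable_compose[OF dec], of "indicator {(w1, w2)}" c]
        by (simp add: oW1_def oW2_def)
    qed
  qed
  have "(\<Sum>w1\<in>{1..M1}. \<Sum>w2\<in>{1..M2}. ?J c w1 (w1, w2)) \<le> (\<Sum>w1\<in>{1..M1}. 1)"
  proof (rule sum_mono)
    fix w1
    have "(\<Sum>w2\<in>{1..M2}. ?J c w1 (w1, w2)) = (\<Sum>w\<in>Pair w1 ` {1..M2}. ?J c w1 w)"
      by (subst sum.reindex) (auto simp: inj_on_def)
    also have "\<dots> \<le> 1" by (rule sum_decoding_le_1) auto
    finally show "(\<Sum>w2\<in>{1..M2}. ?J c w1 (w1, w2)) \<le> 1" .
  qed
  then have "?C * (\<Sum>w1\<in>{1..M1}. \<Sum>w2\<in>{1..M2}. ?J c w1 (w1, w2)) \<le> ?C * (\<Sum>w1\<in>{1..M1}. 1)"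
    by (rule mult_left_mono) simp
  also have "\<dots> = ennreal (1 / real M2)"
    using pos by (simp add: ennreal_mult[symmetric] ennreal_of_nat_eq_real_of_nat)
  finally show "(\<integral>\<^sup>+\<omega>. ennreal (lik_ratio f1 f2 N v1 A c \<omega>) * indicator {(oW1 \<omega>, oW2 \<omega>)} (dec (chY f1 f2 N \<omega>)) \<partial>chan_meas)
      \<le> ennreal (1 / real M2)" unfolding eq .
  \<comment> \<open>With c = 0 the first input drops out of the auxiliary mean, so every w1 can be
    replaced by the representative 1.\<close>
  have J0: "?J 0 w1 w = ?J 0 1 w" for w1 w by (simp add: aux_lik_def)
  have "(\<Sum>w1\<in>{1..M1}. \<Sum>w2\<in>{1..M2}. ?J 0 w1 (w1, w2)) = (\<Sum>w1\<in>{1..M1}. \<Sum>w2\<in>{1..M2}. ?J 0 1 (w1, w2))"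
    by (subst J0) (rule refl)
  also have "\<dots> = (\<Sum>w\<in>{1..M1} \<times> {1..M2}. ?J 0 1 w)"
    by (simp add: sum.cartesian_product split_beta')
  also have "\<dots> \<le> 1" by (rule sum_decoding_le_1) auto
  finally have "?C * (\<Sum>w1\<in>{1..M1}. \<Sum>w2\<in>{1..M2}. ?J 0 w1 (w1, w2)) \<le> ?C * 1"
    by (rule mult_left_mono) simp
  then show "(\<integral>\<^sup>+\<omega>. ennreal (lik_ratio f1 f2 N v1 A 0 \<omega>) * indicator {(oW1 \<omega>, oW2 \<omega>)} (dec (chY f1 f2 N \<omega>)) \<partial>chan_meas)
      \<le> ?C" unfolding eq by simp
qed

end

text \<open>The constant 2 bounds the auxiliary mass of m on A plus 1 off A; then
  ln x <= x / 2 - 1 + ln 2 is the Donsker--Varadhan inequality.\<close>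
lemma (in prob_space) change_of_measure_bound:
  fixes L :: "'a \<Rightarrow> real"
  assumes L[measurable]: "L \<in> borel_measurable M" and Lpos: "\<And>x. L x > 0"
    and int: "integrable M (\<lambda>x. ln (L x))" and A[measurable]: "A \<in> events" and m: "m \<ge> 1"
    and L1: "(\<integral>\<^sup>+x. ennreal (L x) \<partial>M) \<le> 1"
    and LA: "(\<integral>\<^sup>+x. ennreal (L x) * indicator A x \<partial>M) \<le> ennreal (1 / m)"
  shows "prob A * ln m \<le> - expectation (\<lambda>x. ln (L x)) + ln 2"
proof -
  let ?a = "\<lambda>x. L x * indicator A x"
  have ea: "ennreal (?a x) = ennreal (L x) * indicator A x" for x
    by (simp add: indicator_def)
  have iL: "integrable M L"
    by (rule integrableI_nonneg) (use L1 Lpos in \<open>auto simp: less_imp_le intro: le_less_trans\<close>)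
  have ia: "integrable M ?a"
    by (rule integrableI_nonneg) (use LA Lpos in \<open>auto simp: ea less_imp_le intro: le_less_trans\<close>)
  have eL: "expectation L \<le> 1"
    using L1 Lpos by (subst integral_eq_nn_integral) (auto simp: less_imp_le intro: enn2real_leI)
  have ea1: "expectation ?a \<le> 1 / m"
    using LA Lpos m by (subst integral_eq_nn_integral) (auto simp: ea less_imp_le intro!: enn2real_leI)
  \<comment> \<open>The argument of the logarithm is m * L on A and L off A. Adding both terms
    covers either case, and after integration each contributes at most 1/2, which cancels the
    -1.\<close>
  have pw: "indicator A x * ln m + ln (L x) \<le> m * ?a x / 2 + L x / 2 - 1 + ln 2" for x
  proof -
    have ln2: "ln y \<le> y / 2 - 1 + ln 2" if "y > 0" for y :: real
      using ln_le_minus_one[of "y / 2"] that by (simp add: ln_div)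
    show ?thesis
    proof (cases "x \<in> A")
      case True
      then have "indicator A x * ln m + ln (L x) = ln (m * L x)" using m Lpos[of x] by (simp add: ln_mult)
      also have "\<dots> \<le> m * L x / 2 - 1 + ln 2" using ln2[of "m * L x"] m Lpos[of x] by simp
      finally show ?thesis using True Lpos[of x] by simp
    next
      case False
      then show ?thesis using ln2[of "L x"] Lpos[of x] by simp
    qed
  qed
  have "expectation (\<lambda>x. indicator A x * ln m + ln (L x)) \<le> expectation (\<lambda>x. m * ?a x / 2 + L x / 2 - 1 + ln 2)"
  proof (rule integral_mono)
    show "integrable M (\<lambda>x. indicator A x * ln m + ln (L x))"
      using int by (intro Bochner_Integration.integrable_add integrable_mult_left integrable_real_indicator)
        (auto simp: emeasure_eq_measure)
  qed (use iL ia pw in auto)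
  also have "expectation (\<lambda>x. m * ?a x / 2 + L x / 2 - 1 + ln 2) = m * expectation ?a / 2 + expectation L / 2 - 1 + ln 2"
    using iL ia by (simp add: prob_space)
  also have "\<dots> \<le> ln 2" using eL mult_left_mono[OF ea1, of m] m by simp
  finally have "expectation (\<lambda>x. indicator A x * ln m + ln (L x)) \<le> ln 2" .
  moreover have "expectation (\<lambda>x. indicator A x * ln m + ln (L x)) = prob A * ln m + expectation (\<lambda>x. ln (L x))"
    using int by (subst Bochner_Integration.integral_add)
      (auto intro!: integrable_mult_left integrable_real_indicator simp: emeasure_eq_measure)
  ultimately show ?thesis by simp
qed

lemma integral_of_nn_integral:
  assumes "f \<in> borel_measurable M" "\<And>x. f x \<ge> 0" "(\<integral>\<^sup>+x. ennreal (f x) \<partial>M) = ennreal r" "r \<ge> 0"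
  shows "integrable M f" "(\<integral>x. f x \<partial>M) = r"
  using assms by (auto simp: integral_eq_nn_integral intro!: integrableI_nonneg)

section \<open>Rate bounds for a single code of given block length\<close>

context
  fixes f1 :: enc1 and f2 :: enc2 and dec N M1 M2 and P1 P2 Q v1 v2 :: real
  assumes valid: "valid_code N M1 M2 P1 P2 Q v1 v2 f1 f2 dec"
    and pos: "Q > 0" "v1 > 0" "v2 > 0" "M1 > 0" "M2 > 0" and N: "N > 0" and P0: "P1 > 0" "P2 > 0"
begin

private abbreviation "CH \<equiv> chan_space N M1 M2 Q v1 v2"
private abbreviation "X1 \<equiv> chX1 f1 f2 N"
private abbreviation "X2 \<equiv> chX2 f1 f2 N"
private abbreviation "E1 i \<equiv> (\<lambda>\<omega>. oE1 \<omega> i)"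

private lemmas enc = valid_code_measurable(1)[OF valid]

private lemma mX1: "i < N \<Longrightarrow> X1 i \<in> borel_measurable CH" by (rule measurable_chX1[OF enc])
private lemma mX2: "i < N \<Longrightarrow> X2 i \<in> borel_measurable CH" by (rule measurable_chX2[OF enc])
private lemma mE1: "i < N \<Longrightarrow> E1 i \<in> borel_measurable CH" 
  by (rule measurable_compose[OF measurable_oE1]) simp

private lemma power_to_real:
  assumes m: "\<And>i. i < N \<Longrightarrow> X i \<in> borel_measurable CH"
    and le: "(\<Sum>i<N. \<integral>\<^sup>+\<omega>. ennreal ((X i \<omega>)\<^sup>2) \<partial>CH) \<le> ennreal (real N * p)" and p: "p > 0"
  shows "i < N \<Longrightarrow> integrable CH (\<lambda>\<omega>. (X i \<omega>)\<^sup>2)" "(\<Sum>i<N. \<integral>\<omega>. (X i \<omega>)\<^sup>2 \<partial>CH) \<le> real N * p"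
proof -
  have int: "integrable CH (\<lambda>\<omega>. (X i \<omega>)\<^sup>2)" if i: "i < N" for i
  proof (rule integrableI_nonneg)
    have "(\<integral>\<^sup>+\<omega>. ennreal ((X i \<omega>)\<^sup>2) \<partial>CH) \<le> (\<Sum>i<N. \<integral>\<^sup>+\<omega>. ennreal ((X i \<omega>)\<^sup>2) \<partial>CH)"
      by (rule member_le_sum) (use i in auto)
    also have "\<dots> < \<infinity>" using le by (rule le_less_trans) simp
    finally show "(\<integral>\<^sup>+\<omega>. ennreal ((X i \<omega>)\<^sup>2) \<partial>CH) < \<infinity>" .
  qed (use m[OF i] in auto)
  then show "i < N \<Longrightarrow> integrable CH (\<lambda>\<omega>. (X i \<omega>)\<^sup>2)" .
  have "ennreal (\<Sum>i<N. \<integral>\<omega>. (X i \<omega>)\<^sup>2 \<partial>CH) = (\<Sum>i<N. \<integral>\<^sup>+\<omega>. ennreal ((X i \<omega>)\<^sup>2) \<partial>CH)"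
    by (subst sum_ennreal[symmetric]) (auto simp: nn_integral_eq_integral[OF int] intro!: sum.cong)
  then show "(\<Sum>i<N. \<integral>\<omega>. (X i \<omega>)\<^sup>2 \<partial>CH) \<le> real N * p"
    using le p ennreal_le_iff[of "real N * p" "\<Sum>i<N. \<integral>\<omega>. (X i \<omega>)\<^sup>2 \<partial>CH"] by (metis less_imp_le mult_nonneg_nonneg of_nat_0_le_iff)
qed

private lemma pow1: "i < N \<Longrightarrow> integrable CH (\<lambda>\<omega>. (X1 i \<omega>)\<^sup>2)" "(\<Sum>i<N. \<integral>\<omega>. (X1 i \<omega>)\<^sup>2 \<partial>CH) \<le> real N * P1"
  using power_to_real[of X1 P1] valid P0 mX1 by (auto simp: valid_code_def)

private lemma pow2: "i < N \<Longrightarrow> integrable CH (\<lambda>\<omega>. (X2 i \<omega>)\<^sup>2)" "(\<Sum>i<N. \<integral>\<omega>. (X2 i \<omega>)\<^sup>2 \<partial>CH) \<le> real N * P2"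
  using power_to_real[of X2 P2] valid P0 mX2 by (auto simp: valid_code_def)

private lemma cross: "i < N \<Longrightarrow> integrable CH (\<lambda>\<omega>. X1 i \<omega> * X2 i \<omega>)"
proof (rule Bochner_Integration.integrable_bound)
  assume i: "i < N"
  show "integrable CH (\<lambda>\<omega>. (X1 i \<omega>)\<^sup>2 + (X2 i \<omega>)\<^sup>2)" using pow1(1) pow2(1) i by auto
  show "(\<lambda>\<omega>. X1 i \<omega> * X2 i \<omega>) \<in> borel_measurable CH" using mX1[OF i] mX2[OF i] by measurable
  have "\<bar>x * y\<bar> \<le> x\<^sup>2 + y\<^sup>2" for x y :: real
  proof -
    have "2 * \<bar>x * y\<bar> \<le> x\<^sup>2 + y\<^sup>2" using zero_le_power2[of "\<bar>x\<bar> - \<bar>y\<bar>"] by (simp add: power2_diff abs_mult)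
    moreover have "0 \<le> \<bar>x * y\<bar>" by simp
    ultimately show ?thesis by linarith
  qed
  then show "AE \<omega> in CH. norm (X1 i \<omega> * X2 i \<omega>) \<le> norm ((X1 i \<omega>)\<^sup>2 + (X2 i \<omega>)\<^sup>2)"
    by (intro always_eventually allI) (metis abs_ge_self order_trans real_norm_def)
qed

text \<open>Time averages of the two powers and of the correlation; the code enters the bounds on
  its rates only through these three numbers and its error probability.\<close>

private definition "pw1 = (\<Sum>i<N. \<integral>\<omega>. (X1 i \<omega>)\<^sup>2 \<partial>CH) / N"
private definition "pw2 = (\<Sum>i<N. \<integral>\<omega>. (X2 i \<omega>)\<^sup>2 \<partial>CH) / N"
private definition "cor = (\<Sum>i<N. \<integral>\<omega>. X1 i \<omega> * X2 i \<omega> \<partial>CH) / N"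

private abbreviation "U c i \<equiv> (\<lambda>\<omega>. X2 i \<omega> + (1 - c) * X1 i \<omega>)"

private lemma U_sq:
  assumes i: "i < N"
  shows "integrable CH (\<lambda>\<omega>. (U c i \<omega>)\<^sup>2)"
    "(\<integral>\<omega>. (U c i \<omega>)\<^sup>2 \<partial>CH) = (\<integral>\<omega>. (X2 i \<omega>)\<^sup>2 \<partial>CH) + 2 * (1 - c) * (\<integral>\<omega>. X1 i \<omega> * X2 i \<omega> \<partial>CH)
       + (1 - c)\<^sup>2 * (\<integral>\<omega>. (X1 i \<omega>)\<^sup>2 \<partial>CH)"
proof -
  have eq: "(U c i \<omega>)\<^sup>2 = (X2 i \<omega>)\<^sup>2 + 2 * (1 - c) * (X1 i \<omega> * X2 i \<omega>) + (1 - c)\<^sup>2 * (X1 i \<omega>)\<^sup>2" for \<omega>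
    by (simp add: power2_eq_square algebra_simps)
  note I = pow1(1)[OF i] pow2(1)[OF i] cross[OF i]
  show "integrable CH (\<lambda>\<omega>. (U c i \<omega>)\<^sup>2)" unfolding eq using I by auto
  show "(\<integral>\<omega>. (U c i \<omega>)\<^sup>2 \<partial>CH) = (\<integral>\<omega>. (X2 i \<omega>)\<^sup>2 \<partial>CH) + 2 * (1 - c) * (\<integral>\<omega>. X1 i \<omega> * X2 i \<omega> \<partial>CH)
       + (1 - c)\<^sup>2 * (\<integral>\<omega>. (X1 i \<omega>)\<^sup>2 \<partial>CH)"
    unfolding eq using I by simp
qed

private lemma sum_U_sq:
  "(\<Sum>i<N. \<integral>\<omega>. (U c i \<omega>)\<^sup>2 \<partial>CH) = N * (pw2 + 2 * (1 - c) * cor + (1 - c)\<^sup>2 * pw1)"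
  using N by (simp add: U_sq(2) sum.distrib sum_distrib_left[symmetric] pw1_def pw2_def cor_def distrib_left)

text \<open>This is the time average of E (X2 + b X1)^2. Its nonnegativity for all b is the form in
  which Cauchy-Schwarz is used below.\<close>

private lemma quad_nonneg: "pw2 + 2 * b * cor + b\<^sup>2 * pw1 \<ge> 0"
proof -
  have "N * (pw2 + 2 * (1 - (1 - b)) * cor + (1 - (1 - b))\<^sup>2 * pw1) \<ge> 0"
    unfolding sum_U_sq[symmetric] by (intro sum_nonneg integral_nonneg_AE) auto
  then show ?thesis using N by (simp add: zero_le_mult_iff)
qed

private lemma UE_sq:
  assumes i: "i < N"
  shows "integrable CH (\<lambda>\<omega>. (U c i \<omega> + E1 i \<omega>)\<^sup>2)" (is ?A)
    "(\<integral>\<omega>. (U c i \<omega> + E1 i \<omega>)\<^sup>2 \<partial>CH) = (\<integral>\<omega>. (U c i \<omega>)\<^sup>2 \<partial>CH) + v1" (is ?B)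
    "integrable CH (\<lambda>\<omega>. (E1 i \<omega>)\<^sup>2)" (is ?C) "(\<integral>\<omega>. (E1 i \<omega>)\<^sup>2 \<partial>CH) = v1" (is ?D)
proof -
  note [measurable] = mX1[OF i] mX2[OF i] mE1[OF i]
  have "(\<integral>\<^sup>+\<omega>. ennreal ((U c i \<omega> + E1 i \<omega>)\<^sup>2) \<partial>CH) = (\<integral>\<^sup>+\<omega>. ennreal ((U c i \<omega>)\<^sup>2) \<partial>CH) + ennreal v1"
  proof (rule resample_noise1[OF pos i])
    have t: "tri g i (e(i := y)) = tri g i e" for g e y by (rule tri_cong) auto
    have d: "drift f1 f2 N (w1, w2, s, e, r) = drift f1 f2 N (w1, w2, s, e', r)" for w1 w2 s e e' r
      by (intro ext) (simp add: drift_def oW1_def oW2_def oS_def oT1_def oT2_def)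
    \<comment> \<open>The inputs at time i read only outputs before i, and those do not contain the
      noise sample i.\<close>
    have y: "ypast f1 f2 N i (w1, w2, s, e(i := y), r) = ypast f1 f2 N i (w1, w2, s, e, r)" for w1 w2 s e r y
      using d[of w1 w2 s "e(i:=y)" r e] by (simp add: ypast_eq_tri oE1_def t)
    fix w1 w2 s e r y
    show "U c i (w1, w2, s, e(i := y), r) = U c i (w1, w2, s, e, r)"
      unfolding chX1_def chX2_def y by (simp add: oW1_def oW2_def oS_def oT1_def oT2_def)
  qed measurable
  also have "\<dots> = ennreal ((\<integral>\<omega>. (U c i \<omega>)\<^sup>2 \<partial>CH) + v1)"
    using pos by (subst nn_integral_eq_integral[OF U_sq(1)[OF i]]) (auto simp: ennreal_plus)
  finally have e: "(\<integral>\<^sup>+\<omega>. ennreal ((U c i \<omega> + E1 i \<omega>)\<^sup>2) \<partial>CH) = ennreal ((\<integral>\<omega>. (U c i \<omega>)\<^sup>2 \<partial>CH) + v1)" .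
  show ?A ?B by (rule integral_of_nn_integral[OF _ _ e]; use pos in simp)+
  interpret prob_space CH using pos by (rule prob_space_chan_space)
  have "(\<integral>\<^sup>+\<omega>. ennreal ((0 + E1 i \<omega>)\<^sup>2) \<partial>CH) = (\<integral>\<^sup>+\<omega>. ennreal (0\<^sup>2) \<partial>CH) + ennreal v1"
    by (rule resample_noise1[OF pos i]) auto
  then have e: "(\<integral>\<^sup>+\<omega>. ennreal ((E1 i \<omega>)\<^sup>2) \<partial>CH) = ennreal v1" by simp
  show ?C ?D by (rule integral_of_nn_integral[OF _ _ e]; use pos in simp)+
qed

private lemma ln_lik_ratio:
  assumes A: "A > 0"
  shows "ln (lik_ratio f1 f2 N v1 A c \<omega>) =
    (\<Sum>i<N. ln (v1 / A) / 2 - (U c i \<omega> + E1 i \<omega>)\<^sup>2 / (2 * A) + (E1 i \<omega>)\<^sup>2 / (2 * v1))"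
proof -
  have ln_nd: "ln (phi s x) = - ln (2 * pi) / 2 - ln s / 2 - x\<^sup>2 / (2 * s)" if "s > 0" for s x
    using that by (simp add: normal_density_def ln_mult ln_div ln_sqrt real_sqrt_mult)
  have np: "phi s x > 0" if "s > 0" for s x using that by (intro normal_density_pos) simp
  have "ln (lik_ratio f1 f2 N v1 A c \<omega>) = (\<Sum>i<N. ln (phi A
      (U c i \<omega> + oE1 \<omega> i) / phi v1 (oE1 \<omega> i)))"
  proof -
    have "phi A x \<noteq> 0" "phi v1 x \<noteq> 0" for x
      using np[OF A, of x] np[OF pos(2), of x] by auto
    then show ?thesis unfolding lik_ratio_def by (subst ln_prod) auto
  qed
  also have "\<dots> = (\<Sum>i<N. ln (v1 / A) / 2 - (U c i \<omega> + E1 i \<omega>)\<^sup>2 / (2 * A) + (E1 i \<omega>)\<^sup>2 / (2 * v1))"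
  proof (rule sum.cong)
    fix i
    show "ln (phi A (U c i \<omega> + oE1 \<omega> i) / phi v1 (oE1 \<omega> i)) =
      ln (v1 / A) / 2 - (U c i \<omega> + E1 i \<omega>)\<^sup>2 / (2 * A) + (E1 i \<omega>)\<^sup>2 / (2 * v1)"
      using np[OF A, of "U c i \<omega> + oE1 \<omega> i"] np[OF pos(2), of "oE1 \<omega> i"] A pos
      by (subst ln_div) (auto simp: ln_nd ln_div diff_divide_distrib)
  qed simp
  finally show ?thesis .
qed

private lemma measurable_success:
  "{\<omega> \<in> space CH. dec (chY f1 f2 N \<omega>) = (oW1 \<omega>, oW2 \<omega>)} \<in> sets CH"
proof -
  note [measurable] = valid_code_measurable(2)[OF valid]
  have [measurable]: "chY f1 f2 N \<in> CH \<rightarrow>\<^sub>M seqs N"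
    by (rule measurable_chY) (rule enc)
  have "(\<lambda>\<omega>. (oW1 \<omega>, oW2 \<omega>)) \<in> CH \<rightarrow>\<^sub>M count_space UNIV \<Otimes>\<^sub>M count_space UNIV" by measurable
  then have "(\<lambda>\<omega>. (dec (chY f1 f2 N \<omega>), (oW1 \<omega>, oW2 \<omega>))) \<in> CH \<rightarrow>\<^sub>M count_space UNIV \<Otimes>\<^sub>M count_space UNIV"
    by (simp add: pair_measure_countable)
  then have "(\<lambda>\<omega>. (dec (chY f1 f2 N \<omega>), (oW1 \<omega>, oW2 \<omega>))) \<in> CH \<rightarrow>\<^sub>M count_space UNIV"
    by (simp add: pair_measure_countable)
  from measurable_sets[OF this, of "{(a, b). a = b}"] show ?thesis
    by (auto elim!: back_subst[of "\<lambda>S. S \<in> sets CH"])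
qed

text \<open>Here m is the number of messages among which the auxiliary law forces a blind guess: M2
  for general c, M1 * M2 for c = 0.\<close>

private lemma fano_bound:
  assumes m: "m \<ge> 1" and err: "err_prob N M1 M2 Q v1 v2 f1 f2 dec \<le> \<epsilon>"
    and succ: "\<And>A. A > 0 \<Longrightarrow> (\<integral>\<^sup>+\<omega>. ennreal (lik_ratio f1 f2 N v1 A c \<omega>) *
        indicator {(oW1 \<omega>, oW2 \<omega>)} (dec (chY f1 f2 N \<omega>)) \<partial>CH) \<le> ennreal (1 / m)"
  shows "(1 - \<epsilon>) * ln m \<le> N / 2 * ln (1 + (pw2 + 2 * (1 - c) * cor + (1 - c)\<^sup>2 * pw1) / v1) + ln 2"
proof -
  interpret prob_space CH using pos by (rule prob_space_chan_space)
  define V where "V = pw2 + 2 * (1 - c) * cor + (1 - c)\<^sup>2 * pw1"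
  have V: "V \<ge> 0" unfolding V_def by (rule quad_nonneg)
  \<comment> \<open>The auxiliary variance is matched to the average second moment of X2 + (1 - c)
    X1 plus noise. The two quadratic terms of the expected log-likelihood ratio then cancel and only
    the logarithm remains.\<close>
  define A where "A = v1 + V"
  have A: "A > 0" using V pos by (simp add: A_def)
  define S where "S = {\<omega> \<in> space CH. dec (chY f1 f2 N \<omega>) = (oW1 \<omega>, oW2 \<omega>)}"
  have S[measurable]: "S \<in> events" unfolding S_def by (rule measurable_success)
  let ?L = "lik_ratio f1 f2 N v1 A c"
  have int: "integrable CH (\<lambda>\<omega>. ln (?L \<omega>))"
    unfolding ln_lik_ratio[OF A] using UE_sq by (intro Bochner_Integration.integrable_sum) auto
  have "expectation (\<lambda>\<omega>. ln (?L \<omega>)) =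
     (\<Sum>i<N. ln (v1 / A) / 2 - ((\<integral>\<omega>. (U c i \<omega>)\<^sup>2 \<partial>CH) + v1) / (2 * A) + v1 / (2 * v1))"
    unfolding ln_lik_ratio[OF A] using UE_sq
    by (subst Bochner_Integration.integral_sum) (auto simp: prob_space)
  also have "\<dots> = N * (ln (v1 / A) / 2 + 1 / 2) - ((\<Sum>i<N. \<integral>\<omega>. (U c i \<omega>)\<^sup>2 \<partial>CH) + N * v1) / (2 * A)"
    using pos by (simp add: sum.distrib sum_subtractf sum_divide_distrib[symmetric] distrib_left)
  also have "(\<Sum>i<N. \<integral>\<omega>. (U c i \<omega>)\<^sup>2 \<partial>CH) + N * v1 = N * A"
    unfolding sum_U_sq V_def[symmetric] A_def by (simp add: algebra_simps)
  also have "N * (ln (v1 / A) / 2 + 1 / 2) - N * A / (2 * A) = - (N / 2 * ln (1 + V / v1))"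
  proof -
    have "1 + V / v1 = A / v1" using pos by (simp add: A_def field_simps)
    then show ?thesis using A pos by (simp add: ln_div field_simps)
  qed
  finally have E: "expectation (\<lambda>\<omega>. ln (?L \<omega>)) = - (N / 2 * ln (1 + V / v1))" .
  have "prob S * ln m \<le> - expectation (\<lambda>\<omega>. ln (?L \<omega>)) + ln 2"
  proof (rule change_of_measure_bound)
    show "?L \<in> borel_measurable CH" by (rule measurable_lik_ratio) (use enc pos in auto)
    show "?L \<omega> > 0" for \<omega>
      unfolding lik_ratio_def using A pos by (intro prod_pos ballI divide_pos_pos normal_density_pos) auto
    show "integrable CH (\<lambda>\<omega>. ln (?L \<omega>))" by (rule int)
    show "(\<integral>\<^sup>+\<omega>. ennreal (?L \<omega>) \<partial>CH) \<le> 1"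
      using nn_integral_lik_ratio[OF enc pos A] by simp
    show "(\<integral>\<^sup>+\<omega>. ennreal (?L \<omega>) * indicator S \<omega> \<partial>CH) \<le> ennreal (1 / m)"
    proof -
      have "(\<integral>\<^sup>+\<omega>. ennreal (?L \<omega>) * indicator S \<omega> \<partial>CH) =
         (\<integral>\<^sup>+\<omega>. ennreal (?L \<omega>) * indicator {(oW1 \<omega>, oW2 \<omega>)} (dec (chY f1 f2 N \<omega>)) \<partial>CH)"
        by (rule nn_integral_cong) (auto simp: S_def indicator_def)
      then show ?thesis using succ[OF A] by simp
    qed
  qed (use m S in auto)
  moreover have "prob S = 1 - err_prob N M1 M2 Q v1 v2 f1 f2 dec"
  proof -
    have "{\<omega> \<in> space CH. dec (chY f1 f2 N \<omega>) \<noteq> (oW1 \<omega>, oW2 \<omega>)} = space CH - S" by (auto simp: S_def)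
    then show ?thesis by (simp add: err_prob_def prob_compl)
  qed
  moreover have "(1 - \<epsilon>) * ln m \<le> (1 - err_prob N M1 M2 Q v1 v2 f1 f2 dec) * ln m"
    using m err by (intro mult_right_mono) auto
  ultimately show ?thesis using E by (simp add: V_def)
qed

lemma code_converse:
  assumes err: "err_prob N M1 M2 Q v1 v2 f1 f2 dec \<le> \<epsilon>"
  shows "\<exists>\<rho>\<in>{0..1}. (1 - \<epsilon>) * ln M2 \<le> N / 2 * ln (1 + P2 * (1 - \<rho>\<^sup>2) / v1) + ln 2 \<and>
    (1 - \<epsilon>) * ln (real M1 * real M2) \<le> N / 2 * ln (1 + (P1 + P2 + 2 * sqrt (P1 * P2) * \<rho>) / v1) + ln 2"
proof -
  have dec: "dec \<in> measurable (seqs N) (count_space UNIV)"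
    using valid_code_measurable(2)[OF valid] .
  have p1: "0 \<le> pw1" "pw1 \<le> P1" and p2: "0 \<le> pw2" "pw2 \<le> P2"
    using pow1(2) pow2(2) N
    by (auto simp: pw1_def pw2_def divide_le_eq mult.commute intro!: divide_nonneg_nonneg sum_nonneg integral_nonneg_AE)
  have CS: "cor\<^sup>2 \<le> pw1 * pw2" "pw1 = 0 \<Longrightarrow> cor = 0"
  proof -
    show z: "cor = 0" if "pw1 = 0"
    proof (rule ccontr)
      assume "cor \<noteq> 0"
      \<comment> \<open>With vanishing pw1 the quadratic form is affine in b, so a nonzero slope
        would make it negative; this b gives -1.\<close>
      then have "pw2 + 2 * (- (pw2 + 1) / (2 * cor)) * cor = -1" by (simp add: field_simps)
      then show False using quad_nonneg[of "- (pw2 + 1) / (2 * cor)"] that by simp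
    qed
    show "cor\<^sup>2 \<le> pw1 * pw2"
    proof (cases "pw1 = 0")
      case False
      then have "pw1 > 0" using p1 by simp
      then show ?thesis using quad_nonneg[of "- cor / pw1"] 
        by (simp add: power2_eq_square field_simps)
    qed (use z in simp)
  qed
  \<comment> \<open>Only the positive part of the correlation counts. A negative correlation is
    replaced by \<rho> = 0, where both right-hand sides are still large enough.\<close>
  define \<rho> where "\<rho> = max 0 cor / sqrt (P1 * P2)"
  have sP: "sqrt (P1 * P2) > 0" using P0 by simp
  have "pw1 * pw2 \<le> P1 * P2" using p1 p2 P0 by (intro mult_mono) auto
  then have c2: "cor\<^sup>2 \<le> P1 * P2" using CS(1) by linarith
  have "cor \<le> sqrt (P1 * P2)" using c2 real_le_rsqrt by blast
  then have \<rho>: "\<rho> \<in> {0..1}" using sP by (simp add: \<rho>_def)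
  have "sqrt (P1 * P2) * \<rho> = max 0 cor" using P0 by (simp add: \<rho>_def)
  then have s: "cor \<le> sqrt (P1 * P2) * \<rho>" by simp
  have \<rho>2: "P2 * \<rho>\<^sup>2 = (max 0 cor)\<^sup>2 / P1"
    using P0 by (simp add: \<rho>_def power_divide)
  \<comment> \<open>The coefficient of the best linear prediction of X2 from X1, with opposite sign.
    If pw1 = 0, division by zero makes it 0, which is the right choice there since cor = 0.\<close>
  let ?b = "- cor / pw1"
  have V: "pw2 + 2 * ?b * cor + ?b\<^sup>2 * pw1 \<le> P2 * (1 - \<rho>\<^sup>2)"
  proof (cases "pw1 = 0")
    case True
    then have "\<rho> = 0" using CS(2) by (simp add: \<rho>_def)
    then show ?thesis using True CS(2) p2 by simp
  next
    case False
    then have p: "pw1 > 0" using p1 by simp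
    have "pw2 + 2 * ?b * cor + ?b\<^sup>2 * pw1 = pw2 - cor\<^sup>2 / pw1"
      using p by (simp add: power2_eq_square field_simps)
    also have "\<dots> \<le> P2 - (max 0 cor)\<^sup>2 / P1"
    proof -
      have "(max 0 cor)\<^sup>2 / P1 \<le> cor\<^sup>2 / pw1"
        using p p1 by (intro frac_le) (auto simp: max_def)
      then show ?thesis using p2 by simp
    qed
    finally show ?thesis using \<rho>2 by (simp add: right_diff_distrib)
  qed
  have "(1 - \<epsilon>) * ln (real M2) \<le> N / 2 * ln (1 + (pw2 + 2 * (1 - (1 - ?b)) * cor + (1 - (1 - ?b))\<^sup>2 * pw1) / v1) + ln 2"
    by (rule fano_bound[OF _ err])
       (use pos nn_integral_lik_ratio_success(1)[OF enc pos _ dec] in auto)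
  also have "\<dots> \<le> N / 2 * ln (1 + P2 * (1 - \<rho>\<^sup>2) / v1) + ln 2"
    using V quad_nonneg[of ?b] pos
    by (intro add_right_mono mult_left_mono ln_mono add_left_mono divide_right_mono) (auto intro!: add_pos_nonneg divide_nonneg_nonneg)
  finally have 1: "(1 - \<epsilon>) * ln (real M2) \<le> N / 2 * ln (1 + P2 * (1 - \<rho>\<^sup>2) / v1) + ln 2" .
  have "(1 - \<epsilon>) * ln (real M1 * real M2) \<le> N / 2 * ln (1 + (pw2 + 2 * (1 - 0) * cor + (1 - 0)\<^sup>2 * pw1) / v1) + ln 2"
  proof (rule fano_bound[OF _ err])
    show "1 \<le> real M1 * real M2" using pos by (metis One_nat_def Suc_leI nat_0_less_mult_iff of_nat_1 of_nat_le_iff of_nat_mult)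
  qed (use nn_integral_lik_ratio_success(2)[OF enc pos _ dec] in auto)
  also have "\<dots> \<le> N / 2 * ln (1 + (P1 + P2 + 2 * sqrt (P1 * P2) * \<rho>) / v1) + ln 2"
    using s p1 p2 quad_nonneg[of 1] pos
    by (intro add_right_mono mult_left_mono ln_mono add_left_mono divide_right_mono) (auto intro!: add_pos_nonneg divide_nonneg_nonneg)
  finally show ?thesis using 1 \<rho> by blast
qed

end

section \<open>Converse\<close>

definition rate_pair :: "real \<Rightarrow> real \<Rightarrow> real \<Rightarrow> real \<Rightarrow> real \<Rightarrow> real \<Rightarrow> bool" where
  "rate_pair P1 P2 v \<rho> R1 R2 \<longleftrightarrow> R2 \<le> 1/2 * log 2 (1 + P2 * (1 - \<rho>\<^sup>2) / v) \<and>
     R1 + R2 \<le> 1/2 * log 2 (1 + (P1 + P2 + 2 * sqrt (P1 * P2) * \<rho>) / v)"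

abbreviation msgs :: "nat \<Rightarrow> real \<Rightarrow> nat" where
  "msgs N R \<equiv> nat \<lceil>2 powr (real N * R)\<rceil>"

lemma le_nat_ceiling_powr: "2 powr x \<le> real (nat \<lceil>2 powr x\<rceil>)" "nat \<lceil>2 powr x\<rceil> > 0"
  "real (nat \<lceil>2 powr x\<rceil>) \<le> 2 powr x + 1"
proof -
  have "0 < (2::real) powr x" by simp
  then have c: "0 < \<lceil>(2::real) powr x\<rceil>" by (simp only: zero_less_ceiling)
  then have e: "real (nat \<lceil>2 powr x\<rceil>) = of_int \<lceil>2 powr x\<rceil>" by simp
  show "2 powr x \<le> real (nat \<lceil>2 powr x\<rceil>)" unfolding e by (rule le_of_int_ceiling)
  show "nat \<lceil>2 powr x\<rceil> > 0" using c by (simp only: zero_less_nat_eq)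
  show "real (nat \<lceil>2 powr x\<rceil>) \<le> 2 powr x + 1" unfolding e by (rule of_int_ceiling_le_add_one)
qed

text \<open>The correlation depends on the code, hence on the tolerance. Each tolerance 1 / (n + 1)
  yields its own \<rho>, and compactness of the unit interval with continuity of both bounds
  produces one \<rho> that serves the limit.\<close>

lemma converse:
  assumes pos: "P1 > 0" "P2 > 0" "Q > 0" "v1 > 0" "v2 > 0"
    and ach: "achievable False P1 P2 Q v1 v2 R1 R2"
  shows "\<exists>\<rho>\<in>{0..1}. rate_pair P1 P2 v1 \<rho> R1 R2"
proof -
  let ?f = "\<lambda>\<rho>. 1/2 * log 2 (1 + P2 * (1 - \<rho>\<^sup>2) / v1)"
  let ?g = "\<lambda>\<rho>. 1/2 * log 2 (1 + (P1 + P2 + 2 * sqrt (P1 * P2) * \<rho>) / v1)"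
  have R: "R1 \<ge> 0" "R2 \<ge> 0" using ach by (auto simp: achievable_def)
  have "\<exists>\<rho>\<in>{0..1}. (1 - 1 / real (Suc n)) * R2 \<le> ?f \<rho> + 1 / real (Suc n) \<and>
      (1 - 1 / real (Suc n)) * (R1 + R2) \<le> ?g \<rho> + 1 / real (Suc n)" for n
  proof -
    define \<epsilon> where "\<epsilon> = 1 / real (Suc n)"
    have \<epsilon>: "\<epsilon> > 0" "\<epsilon> \<le> 1" by (auto simp: \<epsilon>_def)
    obtain N0 where N0: "\<And>N. N \<ge> N0 \<Longrightarrow> \<exists>f1 f2 dec. valid_code N (msgs N R1) (msgs N R2) P1 P2 Q v1 v2 f1 f2 dec \<and>
           err_prob N (msgs N R1) (msgs N R2) Q v1 v2 f1 f2 dec \<le> \<epsilon>"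
      using ach \<epsilon> unfolding achievable_def Let_def by blast
    \<comment> \<open>Block length at least \<open>Suc n\<close>: the additive ln 2 of
      \<open>code_converse\<close> costs 1 / N bits per use, which is then at most
      \<epsilon>.\<close>
    define N where "N = max N0 (Suc n)"
    have N: "N > 0" "N \<ge> N0" "N \<ge> Suc n" by (auto simp: N_def)
    define M1 where "M1 = msgs N R1"
    define M2 where "M2 = msgs N R2"
    have M: "M1 > 0" "M2 > 0" "2 powr (real N * R1) \<le> M1" "2 powr (real N * R2) \<le> M2"
      unfolding M1_def M2_def by (rule le_nat_ceiling_powr)+
    obtain f1 f2 dec where c: "valid_code N M1 M2 P1 P2 Q v1 v2 f1 f2 dec" "err_prob N M1 M2 Q v1 v2 f1 f2 dec \<le> \<epsilon>"
      using N0[OF N(2)] unfolding M1_def M2_def by blast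
    from code_converse[OF c(1) pos(3-5) M(1,2) N(1) pos(1,2) c(2)]
    obtain \<rho> where \<rho>: "\<rho> \<in> {0..1}" "(1 - \<epsilon>) * ln M2 \<le> N / 2 * ln (1 + P2 * (1 - \<rho>\<^sup>2) / v1) + ln 2"
      "(1 - \<epsilon>) * ln (real M1 * real M2) \<le> N / 2 * ln (1 + (P1 + P2 + 2 * sqrt (P1 * P2) * \<rho>) / v1) + ln 2"
      by blast
    have conv: "(1 - \<epsilon>) * r \<le> 1/2 * log 2 x + \<epsilon>"
      if "(1 - \<epsilon>) * ln m \<le> N / 2 * ln x + ln 2" "2 powr (real N * r) \<le> m" for r m x :: real
    proof -
      have "ln (2 powr (real N * r)) \<le> ln m" using that(2) by (intro ln_mono) auto
      then have "N * r * ln 2 \<le> ln m" by (simp add: ln_powr)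
      then have "(1 - \<epsilon>) * (N * r * ln 2) \<le> N / 2 * ln x + ln 2"
        using mult_left_mono[of _ _ "1 - \<epsilon>"] \<epsilon> that(1) by (smt (verit))
      moreover have "N * ln 2 * (1/2 * log 2 x + 1 / N) = N / 2 * ln x + ln 2"
        using N(1) by (simp add: log_def distrib_left)
      moreover have "(1 - \<epsilon>) * (N * r * ln 2) = N * ln 2 * ((1 - \<epsilon>) * r)" by (simp add: algebra_simps)
      ultimately have "N * ln 2 * ((1 - \<epsilon>) * r) \<le> N * ln 2 * (1/2 * log 2 x + 1 / N)" by simp
      then have "(1 - \<epsilon>) * r \<le> 1/2 * log 2 x + 1 / N"
        using N(1) by (simp add: mult_le_cancel_left_pos)
      moreover have "1 / N \<le> \<epsilon>" using N(3) by (simp add: \<epsilon>_def frac_le)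
      ultimately show ?thesis by linarith
    qed
    have "2 powr (N * (R1 + R2)) \<le> real M1 * real M2"
      using mult_mono[OF M(3,4)] by (simp add: powr_add distrib_left)
    from conv[OF \<rho>(3) this] conv[OF \<rho>(2) M(4)] \<rho>(1) show ?thesis unfolding \<epsilon>_def by blast
  qed
  then obtain r where r: "\<And>n. r n \<in> {0..1}"
    "\<And>n. (1 - 1 / real (Suc n)) * R2 \<le> ?f (r n) + 1 / real (Suc n)"
    "\<And>n. (1 - 1 / real (Suc n)) * (R1 + R2) \<le> ?g (r n) + 1 / real (Suc n)" by metis
  have "seq_compact {0..1::real}" using compact_Icc compact_eq_seq_compact_metric by blast
  then obtain \<rho> s where s: "\<rho> \<in> {0..1}" "strict_mono s" "(r \<circ> s) \<longlonglongrightarrow> \<rho>"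
    using r(1) unfolding seq_compact_def by metis
  have lim: "(\<lambda>n. r (s n)) \<longlonglongrightarrow> \<rho>" using s(3) by (simp add: o_def)
  have inv: "(\<lambda>n. 1 / real (Suc (s n))) \<longlonglongrightarrow> 0"
    using LIMSEQ_subseq_LIMSEQ[OF LIMSEQ_Suc[OF lim_1_over_n] s(2)] by (simp add: o_def)
  have "\<rho>\<^sup>2 \<le> 1" using s(1) by (auto simp: power_le_one)
  then have fpos: "1 + P2 * (1 - \<rho>\<^sup>2) / v1 > 0" using pos by (intro add_pos_nonneg) auto
  have gpos: "1 + (P1 + P2 + 2 * sqrt (P1 * P2) * \<rho>) / v1 > 0" 
    using pos s(1) by (intro add_pos_nonneg divide_nonneg_nonneg) auto
  have f: "(\<lambda>n. ?f (r (s n)) + 1 / real (Suc (s n))) \<longlonglongrightarrow> ?f \<rho> + 0"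
    using fpos pos by (intro tendsto_intros lim inv) auto
  have g: "(\<lambda>n. ?g (r (s n)) + 1 / real (Suc (s n))) \<longlonglongrightarrow> ?g \<rho> + 0"
    using gpos pos by (intro tendsto_intros lim inv) auto
  have lR: "(\<lambda>n. (1 - 1 / real (Suc (s n))) * x) \<longlonglongrightarrow> (1 - 0) * x" for x
    by (intro tendsto_intros inv)
  have "(1 - 0) * R2 \<le> ?f \<rho> + 0" by (rule LIMSEQ_le[OF lR f]) (use r(2) in blast)
  then have "R2 \<le> ?f \<rho>" by simp
  moreover
  have "(1 - 0) * (R1 + R2) \<le> ?g \<rho> + 0" by (rule LIMSEQ_le[OF lR g]) (use r(3) in blast)
  then have "R1 + R2 \<le> ?g \<rho>" by simp
  ultimately show ?thesis using s(1) unfolding rate_pair_def by blast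
qed

text \<open>With strictly more power, every rate pair of the closed region becomes interior for a
  superposition of a coherent layer (amplitudes \<open>a1\<close>, \<open>a2\<close>) and a private layer (amplitude b).\<close>
lemma superposition_parameters:
  assumes pos: "P1 > 0" "P2 > 0" "v > 0" and k: "k > 1" and \<rho>: "\<rho> \<in> {0..1}"
    and R: "R1 \<ge> 0" "R2 \<ge> 0" and rp: "rate_pair P1 P2 v \<rho> R1 R2"
  obtains a1 a2 b where "a1 > 0" "a2 \<ge> 0" "b > 0" "a1\<^sup>2 \<le> k * P1" "a2\<^sup>2 + b\<^sup>2 \<le> k * P2"
    "2 powr (2 * R1) < ((a1 + a2)\<^sup>2 + b\<^sup>2 + v) / (b\<^sup>2 + v)" "2 powr (2 * R2) < (b\<^sup>2 + v) / v"
proof -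
  have \<rho>2: "\<rho>\<^sup>2 \<le> 1" using \<rho> by (auto simp: power_le_one)
  have l2: "2 powr (2 * r) \<le> x" if "r \<le> 1/2 * log 2 x" "x > 0" for r x :: real
  proof -
    have "2 * r \<le> log 2 x" using that by simp
    then have "2 powr (2 * r) \<le> 2 powr (log 2 x)" by (intro powr_mono) auto
    then show ?thesis using that by simp
  qed
  have r2: "2 powr (2 * R2) \<le> 1 + P2 * (1 - \<rho>\<^sup>2) / v"
    using rp \<rho>2 pos by (intro l2) (auto simp: rate_pair_def intro!: add_pos_nonneg)
  have r12: "2 powr (2 * (R1 + R2)) \<le> 1 + (P1 + P2 + 2 * sqrt (P1 * P2) * \<rho>) / v"
    using rp \<rho> pos by (intro l2) (auto simp: rate_pair_def intro!: add_pos_nonneg divide_nonneg_nonneg)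
  \<comment> \<open>The private power that supports R2 exactly: b0 + v = v * 2 powr (2 *
    R2).\<close>
  define b0 where "b0 = v * (2 powr (2 * R2) - 1)"
  have b0: "b0 \<ge> 0" using pos R ge_one_powr_ge_zero[of 2 "2 * R2"] by (simp add: b0_def)
  have b0P: "b0 \<le> P2 * (1 - \<rho>\<^sup>2)" using r2 pos by (simp add: b0_def field_simps)
  \<comment> \<open>Slack in the condition on R1 when the private power is b0 + t and both encoders
    spend the rest of their enlarged power coherently. A small t > 0 makes the condition on R2
    strict, and continuity keeps this slack positive.\<close>
  define h where "h = (\<lambda>t. (sqrt (k * P1) + sqrt (k * P2 - (b0 + t)))\<^sup>2 + (b0 + t) + v - 2 powr (2 * R1) * (b0 + t + v))"
  have kP: "P1 < k * P1" "P2 < k * P2" using pos k by auto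
  have "P2 * (1 - \<rho>\<^sup>2) \<le> P2" using pos by (simp add: algebra_simps)
  then have slack: "b0 < k * P2" using b0P kP by linarith
  have h0: "h 0 > 0"
  proof -
    \<comment> \<open>The private layer leaves the second encoder at least \<rho>^2 P2, so the
      coherent cross term reaches the one in the sum-rate bound.\<close>
    have a: "P2 * \<rho>\<^sup>2 \<le> k * P2 - b0" using b0P kP by (simp add: algebra_simps)
    have "sqrt (P1 * P2) * \<rho> = sqrt (P1 * (P2 * \<rho>\<^sup>2))" using \<rho> pos by (simp add: real_sqrt_mult)
    also have "\<dots> \<le> sqrt (k * P1 * (k * P2 - b0))"
      using a kP pos by (intro real_sqrt_le_mono mult_mono) auto
    finally have s: "sqrt (P1 * P2) * \<rho> \<le> sqrt (k * P1) * sqrt (k * P2 - b0)" by (simp add: real_sqrt_mult)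
    have "2 powr (2 * R1) * (b0 + v) = v * 2 powr (2 * (R1 + R2))"
      by (simp add: b0_def algebra_simps flip: powr_add)
    also have "\<dots> \<le> v + (P1 + P2 + 2 * sqrt (P1 * P2) * \<rho>)"
      using r12 pos by (simp add: field_simps)
    also have "\<dots> < v + (k * P1 + k * P2 + 2 * (sqrt (k * P1) * sqrt (k * P2 - b0)))"
      using s kP by linarith
    also have "\<dots> = (sqrt (k * P1) + sqrt (k * P2 - b0))\<^sup>2 + b0 + v"
      using pos k slack by (simp add: power2_sum)
    finally show ?thesis by (simp add: h_def)
  qed
  have "(h \<longlongrightarrow> h 0) (at_right 0)" unfolding h_def by (intro tendsto_eq_intros refl) auto
  then have "eventually (\<lambda>t. h t > 0) (at_right 0)" using h0 by (rule order_tendstoD)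
  moreover have "eventually (\<lambda>t. t < k * P2 - b0) (at_right 0)"
    using slack by (intro eventually_at_rightI[of 0 "k * P2 - b0"]) auto
  ultimately have "eventually (\<lambda>t. h t > 0 \<and> t < k * P2 - b0 \<and> t > 0) (at_right 0)"
    by (intro eventually_conj eventually_at_right_less)
  then obtain t where t: "h t > 0" "t < k * P2 - b0" "t > 0"
    using eventually_happens'[OF trivial_limit_at_right_real] by blast
  show ?thesis
  proof (rule that[of "sqrt (k * P1)" "sqrt (k * P2 - (b0 + t))" "sqrt (b0 + t)"])
    show "2 powr (2 * R1) < ((sqrt (k * P1) + sqrt (k * P2 - (b0 + t)))\<^sup>2 + (sqrt (b0 + t))\<^sup>2 + v) / ((sqrt (b0 + t))\<^sup>2 + v)"
      using t b0 pos by (simp add: h_def pos_less_divide_eq)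
    show "2 powr (2 * R2) < ((sqrt (b0 + t))\<^sup>2 + v) / v"
      using t b0 pos by (simp add: pos_less_divide_eq) (simp add: b0_def algebra_simps)
  qed (use pos k b0 t in auto)
qed

section \<open>Equivocation\<close>

text \<open>If every conditional density is at most C times a common subdensity, then the expected
  posterior probability of X is at most C / card W; the tangent of - log at that value turns
  this into the entropy bound.\<close>
lemma (in prob_space) conditional_entropy_ge:
  fixes p :: "'x :: countable \<Rightarrow> 'z \<Rightarrow> real" and X :: "'a \<Rightarrow> 'x" and Z :: "'a \<Rightarrow> 'z"
  assumes T: "sigma_finite_measure T" and W: "finite W" "W \<noteq> {}"
    and X[measurable]: "X \<in> measurable M (count_space UNIV)" and Z[measurable]: "Z \<in> measurable M T"
    and p[measurable]: "\<And>w. w \<in> W \<Longrightarrow> p w \<in> borel_measurable T" and p0: "\<And>w z. p w z \<ge> 0"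
    and q[measurable]: "q \<in> borel_measurable T" and q0: "\<And>z. q z \<ge> 0"
    and q1: "(\<integral>\<^sup>+z. ennreal (q z) \<partial>T) \<le> 1" and C: "C > 0"
    and pq: "\<And>w z. w \<in> W \<Longrightarrow> z \<in> space T \<Longrightarrow> p w z \<le> C * q z"
    and dist: "\<And>F. F \<in> borel_measurable (count_space UNIV \<Otimes>\<^sub>M T) \<Longrightarrow>
       (\<integral>\<^sup>+\<omega>. F (X \<omega>, Z \<omega>) \<partial>M) = ennreal (1 / real (card W)) * (\<Sum>w\<in>W. \<integral>\<^sup>+z. F (w, z) * ennreal (p w z) \<partial>T)"
  shows "log 2 (real (card W)) - log 2 C \<le> conditional_entropy 2 (count_space UNIV) T X Z"
proof -
  interpret T: sigma_finite_measure T by fact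
  interpret information_space M 2 by unfold_locales simp
  let ?S = "count_space UNIV :: 'x measure"
  let ?m = "real (card W)"
  have S: "sigma_finite_measure ?S" by (rule sigma_finite_measure_count_space)
  have m: "?m > 0" using W by (simp add: card_gt_0_iff)
  \<comment> \<open>The joint density, written as a finite sum over w' so that its measurability in
    the pair follows termwise.\<close>
  define Pxy where "Pxy = (\<lambda>(w, z). \<Sum>w'\<in>W. (if w = w' then p w' z / ?m else 0))"
  define Py where "Py = (\<lambda>z. \<Sum>w\<in>W. p w z / ?m)"
  have Pxy_eq: "Pxy (w, z) = (if w \<in> W then p w z / ?m else 0)" for w z
    using W by (simp add: Pxy_def)
  have Pxy_m[measurable]: "Pxy \<in> borel_measurable (?S \<Otimes>\<^sub>M T)"
    unfolding Pxy_def split_beta' by measurable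
  have Py_m[measurable]: "Py \<in> borel_measurable T" unfolding Py_def by measurable
  have Pxy0: "Pxy x \<ge> 0" for x using p0 m by (cases x) (auto simp: Pxy_eq)
  have Py0: "Py z \<ge> 0" for z unfolding Py_def using p0 m by (auto intro!: sum_nonneg)
  have nn_sum: "(\<integral>\<^sup>+x. F x \<partial>(?S \<Otimes>\<^sub>M T)) = (\<Sum>w\<in>W. \<integral>\<^sup>+z. F (w, z) \<partial>T)"
    if F: "F \<in> borel_measurable (?S \<Otimes>\<^sub>M T)" and F0: "\<And>w z. w \<notin> W \<Longrightarrow> F (w, z) = 0" for F
  proof -
    have "(\<integral>\<^sup>+x. F x \<partial>(?S \<Otimes>\<^sub>M T)) = (\<integral>\<^sup>+w. \<integral>\<^sup>+z. F (w, z) \<partial>T \<partial>?S)"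
      by (rule T.nn_integral_fst[symmetric]) (rule F)
    also have "\<dots> = (\<Sum>w\<in>W. \<integral>\<^sup>+z. F (w, z) \<partial>T)"
      using W by (intro nn_integral_count_space'[of W]) (auto simp: F0)
    finally show ?thesis .
  qed
  have dxy: "(\<integral>\<^sup>+\<omega>. F (X \<omega>, Z \<omega>) \<partial>M) = (\<integral>\<^sup>+x. ennreal (Pxy x) * F x \<partial>(?S \<Otimes>\<^sub>M T))"
    if F[measurable]: "F \<in> borel_measurable (?S \<Otimes>\<^sub>M T)" for F
  proof -
    have "(\<integral>\<^sup>+x. ennreal (Pxy x) * F x \<partial>(?S \<Otimes>\<^sub>M T)) = (\<Sum>w\<in>W. \<integral>\<^sup>+z. ennreal (Pxy (w, z)) * F (w, z) \<partial>T)"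
      by (rule nn_sum) (auto simp: Pxy_eq)
    also have "\<dots> = (\<Sum>w\<in>W. \<integral>\<^sup>+z. ennreal (1 / ?m) * (F (w, z) * ennreal (p w z)) \<partial>T)"
      using p0 m
      by (intro sum.cong nn_integral_cong refl)
         (simp add: Pxy_eq ennreal_mult' divide_inverse mult_ac)
    also have "\<dots> = ennreal (1 / ?m) * (\<Sum>w\<in>W. \<integral>\<^sup>+z. F (w, z) * ennreal (p w z) \<partial>T)"
      by (simp add: sum_distrib_left) (intro sum.cong refl nn_integral_cmult, measurable)
    finally show ?thesis using dist[OF F] by simp
  qed
  have dist_xy: "distributed M (?S \<Otimes>\<^sub>M T) (\<lambda>x. (X x, Z x)) Pxy"
  proof -
    have "distr M (?S \<Otimes>\<^sub>M T) (\<lambda>x. (X x, Z x)) = density (?S \<Otimes>\<^sub>M T) Pxy"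
    proof (rule measure_eqI)
      fix A assume "A \<in> sets (distr M (?S \<Otimes>\<^sub>M T) (\<lambda>x. (X x, Z x)))"
      then have A[measurable]: "A \<in> sets (?S \<Otimes>\<^sub>M T)" by simp
      have "emeasure (distr M (?S \<Otimes>\<^sub>M T) (\<lambda>x. (X x, Z x))) A = (\<integral>\<^sup>+\<omega>. indicator A (X \<omega>, Z \<omega>) \<partial>M)"
        by (subst nn_integral_indicator[symmetric], simp, subst nn_integral_distr) (simp_all del: nn_integral_indicator)
      also have "\<dots> = emeasure (density (?S \<Otimes>\<^sub>M T) Pxy) A"
        by (subst dxy) (auto simp: emeasure_density)
      finally show "emeasure (distr M (?S \<Otimes>\<^sub>M T) (\<lambda>x. (X x, Z x))) A = emeasure (density (?S \<Otimes>\<^sub>M T) Pxy) A" .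
    qed simp
    then show ?thesis by (simp add: distributed_def)
  qed
  have dist_y: "distributed M T Z Py"
  proof -
    have "distr M T Z = density T Py"
    proof (rule measure_eqI)
      fix A assume "A \<in> sets (distr M T Z)"
      then have A[measurable]: "A \<in> sets T" by simp
      have "emeasure (distr M T Z) A = (\<integral>\<^sup>+\<omega>. indicator A (snd (X \<omega>, Z \<omega>)) \<partial>M)"
        by (subst nn_integral_indicator[symmetric], simp, subst nn_integral_distr) (simp_all del: nn_integral_indicator)
      also have "\<dots> = (\<integral>\<^sup>+x. ennreal (Pxy x) * indicator A (snd x) \<partial>(?S \<Otimes>\<^sub>M T))"
        by (rule dxy) measurable
      also have "\<dots> = (\<Sum>w\<in>W. \<integral>\<^sup>+z. ennreal (Pxy (w, z)) * indicator A z \<partial>T)"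
        by (subst nn_sum) (auto simp: Pxy_eq)
      also have "\<dots> = (\<integral>\<^sup>+z. (\<Sum>w\<in>W. ennreal (Pxy (w, z)) * indicator A z) \<partial>T)"
        by (rule nn_integral_sum[symmetric]) (simp add: Pxy_eq)
      also have "\<dots> = (\<integral>\<^sup>+z. ennreal (Py z) * indicator A z \<partial>T)"
        using p0 m by (intro nn_integral_cong) (simp add: sum_distrib_right[symmetric] Pxy_eq Py_def sum_ennreal)
      also have "\<dots> = emeasure (density T Py) A" by (simp add: emeasure_density)
      finally show "emeasure (distr M T Z) A = emeasure (density T Py) A" .
    qed simp
    then show ?thesis by (simp add: distributed_def)
  qed
  have iPxy: "(\<integral>\<^sup>+x. ennreal (Pxy x) \<partial>(?S \<Otimes>\<^sub>M T)) = ennreal 1"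
    using dxy[of "\<lambda>_. 1"] by (simp add: emeasure_space_1)
  have iPy: "(\<integral>\<^sup>+z. ennreal (Py z) \<partial>T) = 1"
  proof -
    have "emeasure (distr M T Z) (space T) = 1"
      using prob_space.emeasure_space_1[OF prob_space_distr[OF Z]] by simp
    then show ?thesis unfolding distributed_distr_eq_density[OF dist_y] by (simp add: emeasure_density cong: nn_integral_cong)
  qed
  have le: "Pxy (w, z) \<le> Py z" for w z
  proof (cases "w \<in> W")
    case True
    then show ?thesis unfolding Pxy_eq Py_def using W p0 m by (auto intro!: member_le_sum)
  next
    case False
    then show ?thesis using Py0 by (simp add: Pxy_eq)
  qed
  \<comment> \<open>\<open>g2\<close> is q times the posterior of w and integrates to at most 1.
    \<open>g3\<close> has total mass card W and, divided by ln 2, dominates f. The integral of f is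
    minus the conditional entropy.\<close>
  define g2 where "g2 = (\<lambda>(w, z). q z * (Pxy (w, z) / Py z))"
  define g3 where "g3 = (\<lambda>(w, z). indicator W w * Py z :: real)"
  define f where "f = (\<lambda>(w, z). Pxy (w, z) * log 2 (Pxy (w, z) / Py z))"
  have g2_m[measurable]: "g2 \<in> borel_measurable (?S \<Otimes>\<^sub>M T)" unfolding g2_def split_beta' by measurable
  have g3_m[measurable]: "g3 \<in> borel_measurable (?S \<Otimes>\<^sub>M T)" unfolding g3_def split_beta' by measurable
  have f_m[measurable]: "f \<in> borel_measurable (?S \<Otimes>\<^sub>M T)" unfolding f_def split_beta' by measurable
  have g20: "g2 x \<ge> 0" for x using q0 Pxy0 Py0 by (cases x) (auto simp: g2_def)
  have g30: "g3 x \<ge> 0" for x using Py0 by (cases x) (auto simp: g3_def)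
  have i1: "integrable (?S \<Otimes>\<^sub>M T) Pxy" "(\<integral>x. Pxy x \<partial>(?S \<Otimes>\<^sub>M T)) = 1"
    using integral_of_nn_integral[OF Pxy_m Pxy0 iPxy] by auto
  have n2: "(\<integral>\<^sup>+x. ennreal (g2 x) \<partial>(?S \<Otimes>\<^sub>M T)) \<le> 1"
  proof -
    have "(\<integral>\<^sup>+x. ennreal (g2 x) \<partial>(?S \<Otimes>\<^sub>M T)) = (\<Sum>w\<in>W. \<integral>\<^sup>+z. ennreal (g2 (w, z)) \<partial>T)"
    proof (rule nn_sum)
      show "(\<lambda>x. ennreal (g2 x)) \<in> borel_measurable (?S \<Otimes>\<^sub>M T)" by measurable
    qed (simp add: g2_def Pxy_eq)
    also have "\<dots> = (\<integral>\<^sup>+z. (\<Sum>w\<in>W. ennreal (g2 (w, z))) \<partial>T)"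
      by (rule nn_integral_sum[symmetric]) (simp add: g2_def Pxy_eq)
    also have "\<dots> \<le> (\<integral>\<^sup>+z. ennreal (q z) \<partial>T)"
    proof (rule nn_integral_mono)
      fix z
      have "(\<Sum>w\<in>W. ennreal (g2 (w, z))) = ennreal (\<Sum>w\<in>W. g2 (w, z))" using g20 by (simp add: sum_ennreal)
      \<comment> \<open>The quotient is 1, or 0 where the density of Z vanishes; the bound by q
        holds in both cases.\<close>
      also have "(\<Sum>w\<in>W. g2 (w, z)) = q z * (Py z / Py z)"
        by (simp add: g2_def sum_distrib_left[symmetric] sum_divide_distrib[symmetric] Pxy_eq Py_def)
      also have "ennreal \<dots> \<le> ennreal (q z)" using q0 by (intro ennreal_leI) (simp add: divide_self_if)
      finally show "(\<Sum>w\<in>W. ennreal (g2 (w, z))) \<le> ennreal (q z)" .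
    qed
    finally show ?thesis using q1 by (rule order_trans)
  qed
  have i2: "integrable (?S \<Otimes>\<^sub>M T) g2"
    by (rule integrableI_nonneg) (use n2 g20 in \<open>auto intro: le_less_trans\<close>)
  have l2: "(\<integral>x. g2 x \<partial>(?S \<Otimes>\<^sub>M T)) \<le> 1"
    using n2 g20 by (subst integral_eq_nn_integral) (auto intro: enn2real_leI)
  have i3: "integrable (?S \<Otimes>\<^sub>M T) g3"
  proof (rule integrableI_nonneg)
    have "(\<integral>\<^sup>+x. ennreal (g3 x) \<partial>(?S \<Otimes>\<^sub>M T)) = (\<Sum>w\<in>W. \<integral>\<^sup>+z. ennreal (g3 (w, z)) \<partial>T)"
    proof (rule nn_sum)
      show "(\<lambda>x. ennreal (g3 x)) \<in> borel_measurable (?S \<Otimes>\<^sub>M T)" by measurable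
    qed (simp add: g3_def)
    also have "\<dots> = (\<Sum>w\<in>W. 1)" by (rule sum.cong) (auto simp: g3_def iPy)
    also have "\<dots> < \<infinity>" by (simp add: ennreal_of_nat_eq_real_of_nat)
    finally show "(\<integral>\<^sup>+x. ennreal (g3 x) \<partial>(?S \<Otimes>\<^sub>M T)) < \<infinity>" .
  qed (use g30 in auto)
  have pw: "- f (w, z) \<ge> Pxy (w, z) * (log 2 (?m / C) + 1 / ln 2) - g2 (w, z) / ln 2" "f (w, z) \<le> 0" "- f (w, z) \<le> g3 (w, z) / ln 2"
    if z: "z \<in> space T" for w z
  proof -
    have "- f (w, z) \<ge> Pxy (w, z) * (log 2 (?m / C) + 1 / ln 2) - g2 (w, z) / ln 2 \<and> f (w, z) \<le> 0 \<and> - f (w, z) \<le> g3 (w, z) / ln 2"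
    proof (cases "Pxy (w, z) = 0")
      case True
      then show ?thesis using g20 g30 by (auto simp: f_def)
    next
      case False
      then have P: "Pxy (w, z) > 0" using Pxy0[of "(w, z)"] by simp
      then have w: "w \<in> W" by (auto simp: Pxy_eq split: if_splits)
      have Y: "Py z > 0" using P le[of w z] by simp
      define t where "t = Pxy (w, z) / Py z"
      have t: "t > 0" "t \<le> 1" using P Y le[of w z] by (auto simp: t_def)
      have mC: "?m / C > 0" using m C by simp
      have f: "f (w, z) = Pxy (w, z) * (ln t / ln 2)" by (simp add: f_def t_def log_def)
      have "ln (t * (?m / C)) \<le> t * (?m / C) - 1" using t mC by (intro ln_le_minus_one mult_pos_pos)
      then have "ln t \<le> t * (?m / C) - 1 - ln (?m / C)" unfolding ln_mult_pos[OF t(1) mC] by linarith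
      then have "Pxy (w, z) * ln t \<le> Pxy (w, z) * (t * (?m / C) - 1 - ln (?m / C))"
        using P by (intro mult_left_mono) auto
      also have "\<dots> = Pxy (w, z) * (?m / C) * t - Pxy (w, z) * (1 + ln (?m / C))" by (simp add: algebra_simps)
      also have "Pxy (w, z) * (?m / C) * t \<le> q z * t"
        using pq[OF w z] w m C t by (intro mult_right_mono) (auto simp: Pxy_eq field_simps)
      finally have "Pxy (w, z) * ln t \<le> q z * t - Pxy (w, z) * (1 + ln (?m / C))" by simp
      then have "Pxy (w, z) * ln t / ln 2 \<le> (q z * t - Pxy (w, z) * (1 + ln (?m / C))) / ln 2"
        by (rule divide_right_mono) simp
      moreover have "(q z * t - Pxy (w, z) * (1 + ln (?m / C))) / ln 2 =
          g2 (w, z) / ln 2 - Pxy (w, z) * (log 2 (?m / C) + 1 / ln 2)"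
        unfolding g2_def log_def t_def by (simp add: diff_divide_distrib distrib_left add_divide_distrib)
      ultimately have 1: "- f (w, z) \<ge> Pxy (w, z) * (log 2 (?m / C) + 1 / ln 2) - g2 (w, z) / ln 2"
        using f by simp
      have 2: "f (w, z) \<le> 0" unfolding f using P t by (simp add: mult_le_0_iff divide_le_0_iff)
      \<comment> \<open>This yields integrability of f: - ln t is at most 1 / t, and Pxy / t is the
        marginal density.\<close>
      have "ln (1 / t) \<le> 1 / t - 1" using t by (intro ln_le_minus_one) simp
      then have "- ln t \<le> 1 / t" using t by (simp add: ln_div)
      then have "Pxy (w, z) * (- ln t) \<le> Pxy (w, z) * (1 / t)" using P by (intro mult_left_mono) auto
      also have "\<dots> = Py z" using P by (simp add: t_def)
      finally have "Pxy (w, z) * (- ln t) / ln 2 \<le> Py z / ln 2" by (intro divide_right_mono) auto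
      then show ?thesis using 1 2 f w by (simp add: g3_def)
    qed
    then show "- f (w, z) \<ge> Pxy (w, z) * (log 2 (?m / C) + 1 / ln 2) - g2 (w, z) / ln 2" "f (w, z) \<le> 0" "- f (w, z) \<le> g3 (w, z) / ln 2"
      by auto
  qed
  have fi: "integrable (?S \<Otimes>\<^sub>M T) f"
  proof (rule Bochner_Integration.integrable_bound)
    show "integrable (?S \<Otimes>\<^sub>M T) (\<lambda>x. g3 x / ln 2)" using i3 by simp
    show "AE x in ?S \<Otimes>\<^sub>M T. norm (f x) \<le> norm (g3 x / ln 2)"
    proof (rule AE_I2)
      fix x assume "x \<in> space (?S \<Otimes>\<^sub>M T)"
      then show "norm (f x) \<le> norm (g3 x / ln 2)"
        using pw(2,3)[of "snd x" "fst x"] g30[of x] by (auto simp: space_pair_measure)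
    qed
  qed simp
  have "log 2 ?m - log 2 C = log 2 (?m / C)" using m C by (simp add: log_divide)
  also have "\<dots> \<le> (log 2 (?m / C) + 1 / ln 2) - (\<integral>x. g2 x \<partial>(?S \<Otimes>\<^sub>M T)) / ln 2"
    using l2 divide_right_mono[OF l2, of "ln 2"] by simp
  also have "\<dots> = (\<integral>x. Pxy x * (log 2 (?m / C) + 1 / ln 2) - g2 x / ln 2 \<partial>(?S \<Otimes>\<^sub>M T))"
    using i1 i2 by simp
  also have "\<dots> \<le> (\<integral>x. - f x \<partial>(?S \<Otimes>\<^sub>M T))"
  proof (rule integral_mono)
    fix x assume "x \<in> space (?S \<Otimes>\<^sub>M T)"
    then show "Pxy x * (log 2 (?m / C) + 1 / ln 2) - g2 x / ln 2 \<le> - f x"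
      using pw(1)[of "snd x" "fst x"] by (auto simp: space_pair_measure)
  qed (use i1 i2 fi in auto)
  also have "\<dots> = conditional_entropy 2 ?S T X Z"
    using conditional_entropy_generic_eq[OF S T dist_y Py0 dist_xy Pxy0] by (simp add: f_def)
  finally show ?thesis .
qed

text \<open>Redraws the wiretapper noise independently, leaving its outer copy as a dummy. This
  isolates that noise while the outer integral stays over the same space on which \<open>mix\<close>
  is defined.\<close>

lemma nn_integral_noise_resample2:
  assumes pos: "Q > 0" "v1 > 0" "v2 > 0" and F[measurable]: "F \<in> borel_measurable (noise_space N Q v1 v2)"
  shows "(\<integral>\<^sup>+x. F x \<partial>noise_space N Q v1 v2) =
    (\<integral>\<^sup>+x. \<integral>\<^sup>+e. F (fst x, fst (snd x), e, snd (snd (snd x))) \<partial>noises N v2 \<partial>noise_space N Q v1 v2)"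
proof -
  let ?G = "\<lambda>v. noises N v"
  let ?R = "?G v1 \<Otimes>\<^sub>M unit_unif \<Otimes>\<^sub>M unit_unif"
  let ?n = "noise_space N Q v1 v2"
  interpret E2: prob_space "?G v2" using pos by (intro prob_space_PiM_gauss)
  interpret T: prob_space "unit_unif \<Otimes>\<^sub>M unit_unif" by (intro prob_space_pair prob_space_unit_unif)
  interpret R: prob_space ?R
    using pos by (intro prob_space_pair prob_space_PiM_gauss prob_space_unit_unif)
  interpret ET: prob_space "?G v1 \<Otimes>\<^sub>M ?G v2 \<Otimes>\<^sub>M unit_unif \<Otimes>\<^sub>M unit_unif"
    using pos by (intro prob_space_pair prob_space_PiM_gauss prob_space_unit_unif)
  have inner: "(\<integral>\<^sup>+x. H x \<partial>?n) = (\<integral>\<^sup>+s. \<integral>\<^sup>+y. \<integral>\<^sup>+e. H (s, fst y, e, snd y) \<partial>?G v2 \<partial>?R \<partial>?G Q)"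
    if H: "H \<in> borel_measurable ?n" for H
  proof -
    note [measurable] = H[unfolded noise_space_def]
    have "(\<integral>\<^sup>+x. H x \<partial>?n) = (\<integral>\<^sup>+s. \<integral>\<^sup>+x. H (s, x) \<partial>(?G v1 \<Otimes>\<^sub>M ?G v2 \<Otimes>\<^sub>M unit_unif \<Otimes>\<^sub>M unit_unif) \<partial>?G Q)"
      unfolding noise_space_def by (subst ET.nn_integral_fst[symmetric]) (rule H[unfolded noise_space_def], rule refl)
    also have "\<dots> = (\<integral>\<^sup>+s. \<integral>\<^sup>+y. \<integral>\<^sup>+e. H (s, fst y, e, snd y) \<partial>?G v2 \<partial>?R \<partial>?G Q)"
    proof (rule nn_integral_cong)
      fix s assume s: "s \<in> space (?G Q)"
      have "(\<lambda>x. H (s, x)) \<in> borel_measurable (?G v1 \<Otimes>\<^sub>M ?G v2 \<Otimes>\<^sub>M unit_unif \<Otimes>\<^sub>M unit_unif)"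
        using measurable_compose[OF measurable_Pair1'[OF s] H[unfolded noise_space_def]] by simp
      from nn_integral_pair_middle[OF prob_space_PiM_gauss[OF pos(2)] prob_space_PiM_gauss[OF pos(3)] T.prob_space_axioms this]
      show "(\<integral>\<^sup>+x. H (s, x) \<partial>(?G v1 \<Otimes>\<^sub>M ?G v2 \<Otimes>\<^sub>M unit_unif \<Otimes>\<^sub>M unit_unif)) = (\<integral>\<^sup>+y. \<integral>\<^sup>+e. H (s, fst y, e, snd y) \<partial>?G v2 \<partial>?R)" .
    qed
    finally show ?thesis .
  qed
  have "(\<lambda>x. \<integral>\<^sup>+e. F (fst x, fst (snd x), e, snd (snd (snd x))) \<partial>?G v2) \<in> borel_measurable ?n"
  proof (rule E2.borel_measurable_nn_integral)
    have "(\<lambda>z. (fst (fst z), fst (snd (fst z)), snd z, snd (snd (snd (fst z))))) \<in> (?n \<Otimes>\<^sub>M ?G v2) \<rightarrow>\<^sub>M ?n"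
      unfolding noise_space_def by measurable
    from measurable_compose[OF this F]
    show "(\<lambda>(x, e). F (fst x, fst (snd x), e, snd (snd (snd x)))) \<in> borel_measurable (?n \<Otimes>\<^sub>M ?G v2)"
      by (simp add: split_beta')
  qed
  from inner[OF this] show ?thesis by (simp add: inner[OF F] E2.emeasure_space_1)
qed

text \<open>The width of the wider density absorbs a bounded shift of the mean.\<close>
lemma normal_density_shift_le:
  assumes v: "v > 0" and x: "\<bar>x\<bar> \<le> B"
  shows "phi v (t - x) \<le> sqrt 2 * exp (B\<^sup>2 / (2 * v)) * phi (2 * v) t"
proof -
  have "x\<^sup>2 \<le> B\<^sup>2" using x by (metis abs_le_square_iff abs_of_nonneg abs_ge_zero order_trans)
  \<comment> \<open>This square is the inequality (t - x)^2 \<ge> t^2 / 2 - x^2, whose halved t^2 is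
    the exponent of variance 2 * v.\<close>
  moreover have "0 \<le> (t - 2 * x)\<^sup>2" by simp
  then have "2 * (t * t) \<ge> t * t + 4 * (t * x) - 4 * (x * x)" by (simp add: power2_eq_square algebra_simps)
  then have "- (t - x)\<^sup>2 * 2 \<le> 2 * x\<^sup>2 - t\<^sup>2" by (simp add: power2_eq_square algebra_simps)
  ultimately have "- (t - x)\<^sup>2 * 2 \<le> 2 * B\<^sup>2 - t\<^sup>2" by linarith
  then have "(- (t - x)\<^sup>2 * 2) / (4 * v) \<le> (2 * B\<^sup>2 - t\<^sup>2) / (4 * v)" using v by (intro divide_right_mono) auto
  then have "- (t - x)\<^sup>2 / (2 * v) \<le> B\<^sup>2 / (2 * v) + - t\<^sup>2 / (4 * v)" using v by (simp add: field_simps)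
  then have "exp (- (t - x)\<^sup>2 / (2 * v)) \<le> exp (B\<^sup>2 / (2 * v)) * exp (- t\<^sup>2 / (4 * v))"
    by (simp flip: exp_add)
  moreover have "1 / sqrt (2 * pi * v) = sqrt 2 * (1 / sqrt (2 * pi * (2 * v)))"
  proof -
    have "sqrt (2 * pi * (2 * v)) = sqrt 2 * sqrt (2 * pi * v)" by (simp add: real_sqrt_mult)
    then show ?thesis using v by simp
  qed
  ultimately show ?thesis using v
    by (simp add: normal_density_def mult_ac divide_right_mono)
qed

lemma normal_density_le: "v > 0 \<Longrightarrow> phi v t \<le> 1 / sqrt (2 * pi * v)"
  by (simp add: normal_density_def divide_right_mono)

section \<open>The wiretap observation as a Gaussian mixture\<close>

context
  fixes f1 :: enc1 and f2 :: enc2 and N M1 M2 :: nat and Q v1 v2 B :: real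
  assumes enc: "causal_encoders N f1 f2"
    and pos: "Q > 0" "v1 > 0" "v2 > 0" "M1 > 0" "M2 > 0" and N: "N \<ge> 2"
    and close: "\<And>w1 w2 x i. w1 \<in> {1..M1} \<Longrightarrow> w2 \<in> {1..M2} \<Longrightarrow> i < N \<Longrightarrow>
      \<bar>chY f1 f2 N (w1, w2, x) i - chY f1 f2 N (1, 1, x) i\<bar> \<le> (if i < 2 then B else 0)"
begin

private abbreviation "noise \<equiv> noise_space N Q v1 v2"
private abbreviation "Y w x \<equiv> chY f1 f2 N (fst w, snd w, x)"

text \<open>For \<sigma> constantly v2 this is the density of the wiretap observation given the
  message pair w. Variances may differ between times so that the widened comparison density has the
  same form.\<close>

private definition mix :: "(nat \<Rightarrow> real) \<Rightarrow> nat \<times> nat \<Rightarrow> (nat \<Rightarrow> real) \<Rightarrow> ennreal" where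
  "mix \<sigma> w z = (\<integral>\<^sup>+x. (\<Prod>i<N. ennreal (phi (\<sigma> i) (z i - Y w x i))) \<partial>noise)"

private lemma Y_measurable:
  assumes "w \<in> {1..M1} \<times> {1..M2}"
  shows "(\<lambda>x. Y w x) \<in> noise \<rightarrow>\<^sub>M seqs N"
proof -
  have "(\<lambda>x. (fst w, snd w, x)) \<in> noise \<rightarrow>\<^sub>M chan_space N M1 M2 Q v1 v2"
    unfolding chan_space_eq using assms by (intro measurable_Pair) (auto simp: space_uniform_count_measure)
  moreover have "chY f1 f2 N \<in> chan_space N M1 M2 Q v1 v2 \<rightarrow>\<^sub>M seqs N"
    by (rule measurable_chY) (rule enc)
  ultimately show ?thesis by (rule measurable_compose)
qed

private lemma kernel_measurable:
  assumes w: "w \<in> {1..M1} \<times> {1..M2}"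
  shows "(\<lambda>(z, x). \<Prod>i<N. ennreal (phi (\<sigma> i) (z i - Y w x i)))
    \<in> borel_measurable (seqs N \<Otimes>\<^sub>M noise)"
  unfolding split_beta'
proof (rule borel_measurable_prod_ennreal)
  fix i assume i: "i \<in> {..<N}"
  note [measurable] = Y_measurable[OF w]
  have "(\<lambda>z. Y w (snd z)) \<in> (seqs N \<Otimes>\<^sub>M noise) \<rightarrow>\<^sub>M seqs N"
    by (rule measurable_compose[OF measurable_snd]) measurable
  from measurable_compose[OF this measurable_component_singleton[OF i]]
  have [measurable]: "(\<lambda>z. Y w (snd z) i) \<in> borel_measurable (seqs N \<Otimes>\<^sub>M noise)" .
  have [measurable]: "(\<lambda>z. fst z i) \<in> borel_measurable (seqs N \<Otimes>\<^sub>M noise)"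
    using i by measurable
  show "(\<lambda>z. ennreal (phi (\<sigma> i) (fst z i - Y w (snd z) i))) \<in> borel_measurable (seqs N \<Otimes>\<^sub>M noise)"
    by measurable
qed

private lemma mix_measurable:
  assumes w: "w \<in> {1..M1} \<times> {1..M2}"
  shows "mix \<sigma> w \<in> borel_measurable (lebs N)"
proof -
  interpret n: prob_space noise using pos by (intro prob_space_noise_space)
  have "(\<lambda>z. mix \<sigma> w z) \<in> borel_measurable (seqs N)"
    unfolding mix_def by (rule n.borel_measurable_nn_integral) (rule kernel_measurable[OF w])
  then show ?thesis by (simp cong: measurable_cong_sets add: sets_PiM_lborel)
qed

private lemma nn_integral_mix:
  assumes w: "w \<in> {1..M1} \<times> {1..M2}" and F: "F \<in> borel_measurable (seqs N)"
  shows "(\<integral>\<^sup>+z. F z * mix \<sigma> w z \<partial>lebs N) =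
    (\<integral>\<^sup>+x. \<integral>\<^sup>+z. F z * (\<Prod>i<N. ennreal (phi (\<sigma> i) (z i - Y w x i))) \<partial>lebs N \<partial>noise)"
proof -
  interpret n: prob_space noise using pos by (intro prob_space_noise_space)
  interpret leb: sigma_finite_measure "lebs N" by (rule lebs.sigma_finite) simp
  interpret ln: pair_sigma_finite "lebs N" noise ..
  let ?K = "\<lambda>z x. \<Prod>i<N. ennreal (phi (\<sigma> i) (z i - Y w x i))"
  have K[measurable]: "(\<lambda>y. ?K (fst y) (snd y)) \<in> borel_measurable (seqs N \<Otimes>\<^sub>M noise)"
    using kernel_measurable[OF w, of \<sigma>] by (simp add: split_beta')
  note [measurable] = F
  have "(\<lambda>(z, x). F z * ?K z x) \<in> borel_measurable (seqs N \<Otimes>\<^sub>M noise)"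
    by (simp only: split_beta') measurable
  then have FK: "(\<lambda>(z, x). F z * ?K z x) \<in> borel_measurable (lebs N \<Otimes>\<^sub>M noise)"
    by (subst measurable_cong_sets[OF sets_pair_measure_cong[OF sets_PiM_lborel refl] refl])
  have "(\<integral>\<^sup>+z. F z * mix \<sigma> w z \<partial>lebs N) = (\<integral>\<^sup>+z. \<integral>\<^sup>+x. F z * ?K z x \<partial>noise \<partial>lebs N)"
  proof (rule nn_integral_cong)
    fix z assume "z \<in> space (lebs N)"
    then have z: "z \<in> space (seqs N)" by (simp add: space_PiM)
    have "(\<lambda>x. ?K z x) \<in> borel_measurable noise"
      using measurable_compose[OF measurable_Pair1'[OF z] K] by simp
    then show "F z * mix \<sigma> w z = (\<integral>\<^sup>+x. F z * ?K z x \<partial>noise)"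
      unfolding mix_def by (rule nn_integral_cmult[symmetric])
  qed
  also have "\<dots> = (\<integral>\<^sup>+x. \<integral>\<^sup>+z. F z * ?K z x \<partial>lebs N \<partial>noise)"
    by (rule ln.Fubini'[symmetric]) (rule FK)
  finally show ?thesis .
qed

private lemma mix_total:
  assumes w: "w \<in> {1..M1} \<times> {1..M2}" and \<sigma>: "\<And>i. \<sigma> i > 0"
  shows "(\<integral>\<^sup>+z. mix \<sigma> w z \<partial>lebs N) = 1"
proof -
  interpret n: prob_space noise using pos by (intro prob_space_noise_space)
  have "(\<integral>\<^sup>+z. (\<Prod>i<N. ennreal (phi (\<sigma> i) (z i - y i))) \<partial>lebs N) = 1" for y
  proof -
    have "(\<integral>\<^sup>+z. (\<Prod>i<N. ennreal (phi (\<sigma> i) (z i - y i))) \<partial>lebs N) =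
      (\<Prod>i<N. \<integral>\<^sup>+t. ennreal (phi (\<sigma> i) (t - y i)) \<partial>lborel)"
      by (rule lebs.product_nn_integral_prod) auto
    also have "\<dots> = (\<Prod>i<N. 1)"
    proof (rule prod.cong)
      fix i
      have "phi (\<sigma> i) (t - y i) = normal_density (y i) (sqrt (\<sigma> i)) t" for t
        by (simp add: normal_density_def)
      then show "(\<integral>\<^sup>+t. ennreal (phi (\<sigma> i) (t - y i)) \<partial>lborel) = 1"
        using nn_integral_normal_density[OF \<sigma>[of i], of "y i"] by simp
    qed simp
    finally show ?thesis by simp
  qed
  then show ?thesis using nn_integral_mix[OF w, of "\<lambda>_. 1" \<sigma>] by (simp add: n.emeasure_space_1)
qed

text \<open>The output Y ignores the wiretapper noise, so once that noise is redrawn the observation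
  is a Gaussian centred at a fixed Y.\<close>

private lemma law_Z:
  assumes w: "w \<in> {1..M1} \<times> {1..M2}" and F: "F \<in> borel_measurable (seqs N)"
  shows "(\<integral>\<^sup>+x. F (chZ f1 f2 N (fst w, snd w, x)) \<partial>noise) = (\<integral>\<^sup>+z. F z * mix (\<lambda>_. v2) w z \<partial>lebs N)"
proof -
  let ?Z = "\<lambda>x. chZ f1 f2 N (fst w, snd w, x)"
  let ?upd = "\<lambda>x e. (fst x, fst (snd x), e, snd (snd (snd x)))"
  note [measurable] = F
  have Zm: "?Z \<in> noise \<rightarrow>\<^sub>M seqs N"
  proof -
    have "(\<lambda>x. (fst w, snd w, x)) \<in> noise \<rightarrow>\<^sub>M chan_space N M1 M2 Q v1 v2"
      unfolding chan_space_eq using w by (intro measurable_Pair) (auto simp: space_uniform_count_measure)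
    moreover have "chZ f1 f2 N \<in> chan_space N M1 M2 Q v1 v2 \<rightarrow>\<^sub>M seqs N"
      by (rule measurable_chZ) (rule enc)
    ultimately show ?thesis by (rule measurable_compose)
  qed
  have Yupd: "Y w (?upd x e) = Y w x" for x e
  proof -
    have "drift f1 f2 N (fst w, snd w, ?upd x e) = drift f1 f2 N (fst w, snd w, x)"
      by (intro ext) (simp add: drift_def oW1_def oW2_def oS_def oT1_def oT2_def)
    then show ?thesis by (simp add: chY_eq_tri oE1_def)
  qed
  \<comment> \<open>Adding a fixed sequence is the triangular map whose drift ignores the past, so
    \<open>nn_integral_tri\<close> performs the translation.\<close>
  have Zupd: "?Z (?upd x e) = tri (\<lambda>i _. Y w x i) N e" for x e
  proof
    fix i show "?Z (?upd x e) i = tri (\<lambda>i _. Y w x i) N e i"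
    proof (cases "i < N")
      case True
      then have "?Z (?upd x e) i = Y w (?upd x e) i + e i" by (simp add: chZ_def oE2_def)
      then show ?thesis using True unfolding Yupd by (simp add: tri_nth)
    next
      case False
      then show ?thesis by (simp add: chZ_def tri_undefined)
    qed
  qed
  have "(\<integral>\<^sup>+x. F (?Z x) \<partial>noise) = (\<integral>\<^sup>+x. \<integral>\<^sup>+e. F (?Z (?upd x e)) \<partial>noises N v2 \<partial>noise)"
    by (rule nn_integral_noise_resample2[OF pos(1-3)]) (rule measurable_compose[OF Zm F])
  also have "\<dots> = (\<integral>\<^sup>+x. \<integral>\<^sup>+z. F z * (\<Prod>i<N. ennreal (phi v2 (z i - Y w x i))) \<partial>lebs N \<partial>noise)"
  proof (rule nn_integral_cong)
    fix x
    let ?g = "\<lambda>i (_ :: nat \<Rightarrow> real). Y w x i"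
    have [measurable]: "tri ?g N \<in> seqs N \<rightarrow>\<^sub>M seqs N"
      by (rule measurable_tri') simp
    have "(\<integral>\<^sup>+e. F (?Z (?upd x e)) \<partial>noises N v2) =
       (\<integral>\<^sup>+e. (\<Prod>i<N. ennreal (phi v2 (e i))) * F (tri ?g N e) \<partial>lebs N)"
      unfolding Zupd by (rule nn_integral_PiM_gauss[OF pos(3)]) (simp, measurable)
    also have "\<dots> = (\<integral>\<^sup>+e. (\<lambda>z. F z * (\<Prod>i<N. ennreal (phi v2 (z i - Y w x i)))) (tri ?g N e) \<partial>lebs N)"
    proof (rule nn_integral_cong)
      fix e
      have "(\<Prod>i<N. ennreal (phi v2 (e i))) = (\<Prod>i<N. ennreal (phi v2 (tri ?g N e i - Y w x i)))"
        by (rule prod.cong) (auto simp: tri_nth)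
      then show "(\<Prod>i<N. ennreal (phi v2 (e i))) * F (tri ?g N e) =
        (\<lambda>z. F z * (\<Prod>i<N. ennreal (phi v2 (z i - Y w x i)))) (tri ?g N e)"
        by (simp add: mult.commute)
    qed
    also have "\<dots> = (\<integral>\<^sup>+z. F z * (\<Prod>i<N. ennreal (phi v2 (z i - Y w x i))) \<partial>lebs N)"
      by (rule nn_integral_tri) simp_all
    finally show "(\<integral>\<^sup>+e. F (?Z (?upd x e)) \<partial>noises N v2) =
       (\<integral>\<^sup>+z. F z * (\<Prod>i<N. ennreal (phi v2 (z i - Y w x i))) \<partial>lebs N)" .
  qed
  also have "\<dots> = (\<integral>\<^sup>+z. F z * mix (\<lambda>_. v2) w z \<partial>lebs N)"
    by (rule nn_integral_mix[OF w F, symmetric])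
  finally show ?thesis .
qed

text \<open>Normal densities of fixed variance are bounded; this makes the passage to real-valued
  densities by \<open>enn2real\<close> lossless.\<close>

private lemma mix_finite:
  assumes \<sigma>: "\<And>i. \<sigma> i > 0"
  shows "mix \<sigma> w z < \<infinity>"
proof -
  interpret n: prob_space noise using pos by (intro prob_space_noise_space)
  have "(\<Prod>i<N. ennreal (phi (\<sigma> i) (z i - Y w x i))) \<le> (\<Prod>i<N. ennreal (1 / sqrt (2 * pi * \<sigma> i)))" for x
    by (rule prod_mono_ennreal) (auto intro!: ennreal_leI normal_density_le \<sigma>)
  then have "mix \<sigma> w z \<le> (\<integral>\<^sup>+x. (\<Prod>i<N. ennreal (1 / sqrt (2 * pi * \<sigma> i))) \<partial>noise)"
    unfolding mix_def by (intro nn_integral_mono)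
  also have "\<dots> = ennreal (\<Prod>i<N. 1 / sqrt (2 * pi * \<sigma> i))"
    using \<sigma> by (simp add: n.emeasure_space_1 prod_ennreal less_imp_le)
  finally show ?thesis by (rule le_less_trans) simp
qed

text \<open>Pointwise comparison under the same noise: at two times the shift is absorbed by
  doubling the variance, at all others the outputs coincide. The constant is the square of that of
  \<open>normal_density_shift_le\<close>, independent of N.\<close>

private lemma mix_le:
  assumes w: "w \<in> {1..M1} \<times> {1..M2}" and z: "z \<in> space (seqs N)"
  shows "mix (\<lambda>_. v2) w z \<le> ennreal (2 * exp (B\<^sup>2 / v2)) * mix (\<lambda>i. if i < 2 then 2 * v2 else v2) (1, 1) z"
proof -
  let ?c = "\<lambda>i. if i < 2 then sqrt 2 * exp (B\<^sup>2 / (2 * v2)) else 1"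
  let ?\<sigma> = "\<lambda>i. if i < 2 then 2 * v2 else v2"
  have c: "(\<Prod>i<N. ?c i) = 2 * exp (B\<^sup>2 / v2)"
  proof -
    have "(\<Prod>i<N. ?c i) = (\<Prod>i\<in>{0, 1::nat}. ?c i)"
      by (rule prod.mono_neutral_right) (use N in auto)
    also have "\<dots> = (sqrt 2 * sqrt 2) * (exp (B\<^sup>2 / (2 * v2)) * exp (B\<^sup>2 / (2 * v2)))"
      by (simp add: mult_ac)
    also have "\<dots> = 2 * exp (B\<^sup>2 / v2)" by (simp flip: exp_add)
    finally show ?thesis .
  qed
  have w1: "(1, 1) \<in> {1..M1} \<times> {1..M2}" using pos by auto
  have "mix (\<lambda>_. v2) w z \<le> (\<integral>\<^sup>+x. ennreal (2 * exp (B\<^sup>2 / v2)) *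
      (\<Prod>i<N. ennreal (phi (?\<sigma> i) (z i - Y (1, 1) x i))) \<partial>noise)"
    unfolding mix_def
  proof (rule nn_integral_mono)
    fix x
    have "(\<Prod>i<N. ennreal (phi v2 (z i - Y w x i))) \<le>
       (\<Prod>i<N. ennreal (?c i) * ennreal (phi (?\<sigma> i) (z i - Y (1, 1) x i)))"
    proof (rule prod_mono_ennreal)
      fix i assume "i \<in> {..<N}"
      then have d: "\<bar>Y w x i - Y (1, 1) x i\<bar> \<le> (if i < 2 then B else 0)"
        using close[of "fst w" "snd w" i x] w by auto
      have "phi v2 (z i - Y w x i) \<le> ?c i * phi (?\<sigma> i) (z i - Y (1, 1) x i)"
      proof (cases "i < 2")
        case True
        then show ?thesis
          using normal_density_shift_le[OF pos(3), of "Y w x i - Y (1, 1) x i" B "z i - Y (1, 1) x i"] d by simp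
      next
        case False
        then show ?thesis using d by simp
      qed
      then show "ennreal (phi v2 (z i - Y w x i)) \<le> ennreal (?c i) * ennreal (phi (?\<sigma> i) (z i - Y (1, 1) x i))"
        by (simp add: ennreal_mult[symmetric] ennreal_leI)
    qed
    also have "\<dots> = ennreal (2 * exp (B\<^sup>2 / v2)) * (\<Prod>i<N. ennreal (phi (?\<sigma> i) (z i - Y (1, 1) x i)))"
      unfolding prod.distrib c[symmetric] by (subst prod_ennreal) auto
    finally show "(\<Prod>i<N. ennreal (phi v2 (z i - Y w x i))) \<le>
       ennreal (2 * exp (B\<^sup>2 / v2)) * (\<Prod>i<N. ennreal (phi (?\<sigma> i) (z i - Y (1, 1) x i)))" .
  qed
  also have "\<dots> = ennreal (2 * exp (B\<^sup>2 / v2)) * mix ?\<sigma> (1, 1) z"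
    unfolding mix_def
    using measurable_compose[OF measurable_Pair1'[OF z] kernel_measurable[OF w1, of ?\<sigma>]]
    by (intro nn_integral_cmult) simp
  finally show ?thesis .
qed

text \<open>The common subdensity is the widened mixture of the reference pair (1, 1). The loss is a
  fixed number of bits per block and vanishes after division by N.\<close>

lemma equivocation_ge:
  "(log 2 (real M1 * real M2) - log 2 (2 * exp (B\<^sup>2 / v2))) / N \<le> equivocation N M1 M2 Q v1 v2 f1 f2"
proof -
  let ?P = "chan_space N M1 M2 Q v1 v2" and ?W = "{1..M1} \<times> {1..M2}"
  interpret prob_space ?P using pos by (rule prob_space_chan_space)
  let ?C = "2 * exp (B\<^sup>2 / v2)" and ?\<sigma> = "\<lambda>i. if i < 2 then 2 * v2 else v2"
  have w1: "(1, 1) \<in> ?W" using pos by auto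
  have \<sigma>: "?\<sigma> i > 0" for i using pos by auto
  have fin: "ennreal (enn2real (mix \<sigma> w z)) = mix \<sigma> w z" if "\<And>i. \<sigma> i > 0" for \<sigma> w z
    using mix_finite[of \<sigma> w z] that by simp
  have "(\<lambda>\<omega>. (oW1 \<omega>, oW2 \<omega>)) \<in> ?P \<rightarrow>\<^sub>M count_space UNIV \<Otimes>\<^sub>M count_space UNIV" by measurable
  then have Wm: "(\<lambda>\<omega>. (oW1 \<omega>, oW2 \<omega>)) \<in> ?P \<rightarrow>\<^sub>M count_space UNIV" by (simp add: pair_measure_countable)
  have Zm': "chZ f1 f2 N \<in> ?P \<rightarrow>\<^sub>M seqs N"
    by (rule measurable_chZ) (rule enc)
  then have Zm: "chZ f1 f2 N \<in> ?P \<rightarrow>\<^sub>M lebs N" by (simp cong: measurable_cong_sets add: sets_PiM_lborel)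
  have "log 2 (real (card ?W)) - log 2 ?C \<le>
      conditional_entropy 2 (count_space UNIV) (lebs N) (\<lambda>\<omega>. (oW1 \<omega>, oW2 \<omega>)) (chZ f1 f2 N)"
  proof (rule conditional_entropy_ge)
    show "sigma_finite_measure (lebs N)" by (rule lebs.sigma_finite) simp
    show "?W \<noteq> {}" using w1 by blast
    show "(\<lambda>z. enn2real (mix (\<lambda>_. v2) w z)) \<in> borel_measurable (lebs N)" if "w \<in> ?W" for w
      using mix_measurable[OF that] by measurable
    show "(\<lambda>z. enn2real (mix ?\<sigma> (1, 1) z)) \<in> borel_measurable (lebs N)"
      using mix_measurable[OF w1] by measurable
    show "(\<integral>\<^sup>+z. ennreal (enn2real (mix ?\<sigma> (1, 1) z)) \<partial>lebs N) \<le> 1"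
    proof -
      have "(\<integral>\<^sup>+z. mix ?\<sigma> (1, 1) z \<partial>lebs N) = 1" by (rule mix_total[OF w1]) (use pos in auto)
      moreover have "ennreal (enn2real (mix ?\<sigma> (1, 1) z)) = mix ?\<sigma> (1, 1) z" for z
        by (rule fin) (use pos in auto)
      ultimately show ?thesis by simp
    qed
    show "enn2real (mix (\<lambda>_. v2) w z) \<le> ?C * enn2real (mix ?\<sigma> (1, 1) z)" if "w \<in> ?W" "z \<in> space (lebs N)" for w z
    proof -
      have "z \<in> space (seqs N)" using that(2) by (simp add: space_PiM)
      from mix_le[OF that(1) this]
      have "ennreal (enn2real (mix (\<lambda>_. v2) w z)) \<le> ennreal (?C * enn2real (mix ?\<sigma> (1, 1) z))"
        using fin[of "\<lambda>_. v2" w z] fin[of ?\<sigma> "(1, 1)" z] pos by (simp add: ennreal_mult)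
      then show ?thesis by (subst (asm) ennreal_le_iff) auto
    qed
    fix F :: "(nat \<times> nat) \<times> (nat \<Rightarrow> real) \<Rightarrow> ennreal"
    assume F: "F \<in> borel_measurable (count_space UNIV \<Otimes>\<^sub>M lebs N)"
    have Fw: "(\<lambda>z. F (w, z)) \<in> borel_measurable (seqs N)" for w
      using measurable_compose[OF measurable_Pair1'[of w "count_space UNIV"] F]
      by (simp cong: measurable_cong_sets add: sets_PiM_lborel)
    have "(\<lambda>\<omega>. ((oW1 \<omega>, oW2 \<omega>), chZ f1 f2 N \<omega>)) \<in> ?P \<rightarrow>\<^sub>M count_space UNIV \<Otimes>\<^sub>M lebs N"
      using Wm Zm by (rule measurable_Pair)
    from nn_integral_chan_space[OF pos measurable_compose[OF this F]]
    have "(\<integral>\<^sup>+\<omega>. F ((oW1 \<omega>, oW2 \<omega>), chZ f1 f2 N \<omega>) \<partial>?P) = ennreal (1 / (real M1 * real M2)) *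
       (\<Sum>w1\<in>{1..M1}. \<Sum>w2\<in>{1..M2}. \<integral>\<^sup>+x. F ((w1, w2), chZ f1 f2 N (w1, w2, x)) \<partial>noise)"
      by (simp add: oW1_def oW2_def)
    also have "(\<Sum>w1\<in>{1..M1}. \<Sum>w2\<in>{1..M2}. \<integral>\<^sup>+x. F ((w1, w2), chZ f1 f2 N (w1, w2, x)) \<partial>noise) =
       (\<Sum>w\<in>?W. \<integral>\<^sup>+x. F (w, chZ f1 f2 N (fst w, snd w, x)) \<partial>noise)"
      by (simp add: sum.cartesian_product split_beta')
    also have "\<dots> = (\<Sum>w\<in>?W. \<integral>\<^sup>+z. F (w, z) * ennreal (enn2real (mix (\<lambda>_. v2) w z)) \<partial>lebs N)"
      by (rule sum.cong) (simp_all add: law_Z[OF _ Fw] fin[OF pos(3)])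
    finally show "(\<integral>\<^sup>+\<omega>. F ((oW1 \<omega>, oW2 \<omega>), chZ f1 f2 N \<omega>) \<partial>?P) = ennreal (1 / real (card ?W)) *
       (\<Sum>w\<in>?W. \<integral>\<^sup>+z. F (w, z) * ennreal (enn2real (mix (\<lambda>_. v2) w z)) \<partial>lebs N)"
      by (simp add: card_cartesian_product)
  qed (use Wm Zm in auto)
  then show ?thesis unfolding equivocation_def
    by (intro divide_right_mono) (simp_all add: card_cartesian_product)
qed

end

section \<open>The linear feedback scheme\<close>

lemma weighted_square_le:
  fixes w x :: "'a \<Rightarrow> real"
  assumes "\<And>j. j \<in> J \<Longrightarrow> w j \<ge> 0"
  shows "(\<Sum>j\<in>J. w j * x j)\<^sup>2 \<le> (\<Sum>j\<in>J. w j) * (\<Sum>j\<in>J. w j * (x j)\<^sup>2)"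
proof -
  have "(\<Sum>j\<in>J. sqrt (w j) * (sqrt (w j) * x j))\<^sup>2 \<le> (\<Sum>j\<in>J. (sqrt (w j))\<^sup>2) * (\<Sum>j\<in>J. (sqrt (w j) * x j)\<^sup>2)"
    by (rule Cauchy_Schwarz_ineq_sum)
  then show ?thesis using assms
    by (simp add: power_mult_distrib mult.assoc[symmetric] cong: sum.cong)
qed

text \<open>Bounds the power spent on removing the state in advance: the weights there have bounded
  sums and the terms uniformly bounded second moments, whatever their dependence.\<close>

lemma nn_integral_weighted_square_le:
  fixes w :: "'a \<Rightarrow> real" and f :: "'a \<Rightarrow> 'b \<Rightarrow> real"
  assumes w: "\<And>j. j \<in> J \<Longrightarrow> w j \<ge> 0" and f: "\<And>j. j \<in> J \<Longrightarrow> f j \<in> borel_measurable M"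
    and K: "\<And>j. j \<in> J \<Longrightarrow> (\<integral>\<^sup>+x. ennreal ((f j x)\<^sup>2) \<partial>M) \<le> ennreal K" and K0: "K \<ge> 0"
    and W: "(\<Sum>j\<in>J. w j) \<le> W"
  shows "(\<integral>\<^sup>+x. ennreal ((\<Sum>j\<in>J. w j * f j x)\<^sup>2) \<partial>M) \<le> ennreal (W\<^sup>2 * K)"
proof -
  let ?W = "\<Sum>j\<in>J. w j"
  have W0: "?W \<ge> 0" using w by (rule sum_nonneg)
  have "(\<integral>\<^sup>+x. ennreal ((\<Sum>j\<in>J. w j * f j x)\<^sup>2) \<partial>M) \<le>
     (\<integral>\<^sup>+x. (\<Sum>j\<in>J. ennreal (?W * w j) * ennreal ((f j x)\<^sup>2)) \<partial>M)"
  proof (rule nn_integral_mono)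
    fix x
    have "ennreal ((\<Sum>j\<in>J. w j * f j x)\<^sup>2) \<le> ennreal (\<Sum>j\<in>J. (?W * w j) * (f j x)\<^sup>2)"
      using weighted_square_le[of J w "\<lambda>j. f j x"] w
      by (intro ennreal_leI) (simp add: sum_distrib_left mult.assoc)
    also have "\<dots> = (\<Sum>j\<in>J. ennreal (?W * w j) * ennreal ((f j x)\<^sup>2))"
      using w W0 by (subst sum_ennreal[symmetric]) (auto simp: ennreal_mult intro!: sum.cong)
    finally show "ennreal ((\<Sum>j\<in>J. w j * f j x)\<^sup>2) \<le> \<dots>" .
  qed
  also have "\<dots> = (\<Sum>j\<in>J. ennreal (?W * w j) * (\<integral>\<^sup>+x. ennreal ((f j x)\<^sup>2) \<partial>M))"
  proof (subst nn_integral_sum)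
    show "(\<lambda>x. ennreal (?W * w j) * ennreal ((f j x)\<^sup>2)) \<in> borel_measurable M" if "j \<in> J" for j
      using f[OF that] by measurable
    show "(\<Sum>j\<in>J. \<integral>\<^sup>+x. ennreal (?W * w j) * ennreal ((f j x)\<^sup>2) \<partial>M) = (\<Sum>j\<in>J. ennreal (?W * w j) * (\<integral>\<^sup>+x. ennreal ((f j x)\<^sup>2) \<partial>M))"
    proof (rule sum.cong)
      fix j assume "j \<in> J"
      note [measurable] = f[OF this]
      show "(\<integral>\<^sup>+x. ennreal (?W * w j) * ennreal ((f j x)\<^sup>2) \<partial>M) = ennreal (?W * w j) * (\<integral>\<^sup>+x. ennreal ((f j x)\<^sup>2) \<partial>M)"
        by (rule nn_integral_cmult) measurable
    qed simp
  qed
  also have "\<dots> \<le> (\<Sum>j\<in>J. ennreal (?W * w j) * ennreal K)"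
    by (intro sum_mono mult_left_mono K) auto
  also have "\<dots> = ennreal (\<Sum>j\<in>J. ?W * w j * K)"
    using w W0 K0 by (subst sum_ennreal[symmetric]) (auto simp: ennreal_mult intro!: sum.cong)
  also have "(\<Sum>j\<in>J. ?W * w j * K) = ?W\<^sup>2 * K"
    by (simp add: sum_distrib_left[symmetric] sum_distrib_right[symmetric] power2_eq_square)
  also have "ennreal (?W\<^sup>2 * K) \<le> ennreal (W\<^sup>2 * K)"
    using W W0 K0 by (intro ennreal_leI mult_right_mono power_mono)
  finally show ?thesis .
qed

lemma square_sum_le: "(x + y)\<^sup>2 \<le> 2 * x\<^sup>2 + 2 * (y::real)\<^sup>2"
  using zero_le_power2[of "x - y"] by (simp add: power2_sum power2_diff)

lemma nn_integral_square_sum_le: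
  fixes f g :: "'b \<Rightarrow> real"
  assumes [measurable]: "f \<in> borel_measurable M" "g \<in> borel_measurable M"
    and K: "(\<integral>\<^sup>+x. ennreal ((f x)\<^sup>2) \<partial>M) \<le> ennreal K" "(\<integral>\<^sup>+x. ennreal ((g x)\<^sup>2) \<partial>M) \<le> ennreal L" "K \<ge> 0" "L \<ge> 0"
  shows "(\<integral>\<^sup>+x. ennreal ((f x + g x)\<^sup>2) \<partial>M) \<le> ennreal (2 * K + 2 * L)"
proof -
  have "(\<integral>\<^sup>+x. ennreal ((f x + g x)\<^sup>2) \<partial>M) \<le> (\<integral>\<^sup>+x. 2 * ennreal ((f x)\<^sup>2) + 2 * ennreal ((g x)\<^sup>2) \<partial>M)"
  proof (rule nn_integral_mono)
    fix x
    have "ennreal ((f x + g x)\<^sup>2) \<le> ennreal (2 * (f x)\<^sup>2 + 2 * (g x)\<^sup>2)"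
      by (intro ennreal_leI square_sum_le)
    then show "ennreal ((f x + g x)\<^sup>2) \<le> 2 * ennreal ((f x)\<^sup>2) + 2 * ennreal ((g x)\<^sup>2)"
      by (simp add: ennreal_plus ennreal_mult)
  qed
  also have "\<dots> = 2 * (\<integral>\<^sup>+x. ennreal ((f x)\<^sup>2) \<partial>M) + 2 * (\<integral>\<^sup>+x. ennreal ((g x)\<^sup>2) \<partial>M)"
    by (subst nn_integral_add) (auto simp: nn_integral_cmult)
  also have "\<dots> \<le> 2 * ennreal K + 2 * ennreal L"
    by (intro add_mono mult_left_mono K) auto
  also have "\<dots> = ennreal (2 * K + 2 * L)" using K(3,4) by (simp add: ennreal_plus ennreal_mult)
  finally show ?thesis .
qed

lemma nn_integral_PiM_component:
  assumes v: "v > 0" and i: "finite I" "i \<in> I" and F[measurable]: "F \<in> borel_measurable borel"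
  shows "(\<integral>\<^sup>+x. F (x i) \<partial>PiM I (\<lambda>_. gauss v)) = (\<integral>\<^sup>+y. F y \<partial>gauss v)"
proof -
  interpret g: prob_space "gauss v" using v by (rule prob_space_gauss)
  interpret p: product_prob_space "\<lambda>_. gauss v" by unfold_locales
  have "distr (PiM I (\<lambda>_. gauss v)) (gauss v) (\<lambda>x. x i) = gauss v"
    by (rule distr_PiM_component) (use i g.prob_space_axioms in auto)
  then have "(\<integral>\<^sup>+y. F y \<partial>gauss v) = (\<integral>\<^sup>+y. F y \<partial>distr (PiM I (\<lambda>_. gauss v)) (gauss v) (\<lambda>x. x i))" by simp
  also have "\<dots> = (\<integral>\<^sup>+x. F (x i) \<partial>PiM I (\<lambda>_. gauss v))"
    by (rule nn_integral_distr) (use i in auto)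
  finally show ?thesis by simp
qed

text \<open>Independence of state and receiver noise. The power of the scheme uses it to separate
  the decision to transmit from the estimation errors.\<close>

lemma nn_integral_chan_state_noise:
  assumes pos: "Q > 0" "v1 > 0" "v2 > 0" "M1 > 0" "M2 > 0"
    and F[measurable]: "F \<in> borel_measurable (seqs N)"
    and G[measurable]: "G \<in> borel_measurable (seqs N)"
  shows "(\<integral>\<^sup>+\<omega>. F (oS \<omega>) * G (oE1 \<omega>) \<partial>chan_space N M1 M2 Q v1 v2) =
    (\<integral>\<^sup>+s. F s \<partial>noises N Q) * (\<integral>\<^sup>+e. G e \<partial>noises N v1)"
proof -
  let ?rest = "noises N v2 \<Otimes>\<^sub>M unit_unif \<Otimes>\<^sub>M unit_unif"
  interpret r: prob_space ?rest
    using pos by (intro prob_space_pair prob_space_PiM_gauss prob_space_unit_unif)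
  have m: "(\<lambda>\<omega>. F (oS \<omega>) * G (oE1 \<omega>)) \<in> borel_measurable (chan_space N M1 M2 Q v1 v2)" by measurable
  have sec: "(\<integral>\<^sup>+x. F (oS (w1, w2, x)) * G (oE1 (w1, w2, x)) \<partial>noise_space N Q v1 v2) =
     (\<integral>\<^sup>+s. F s \<partial>noises N Q) * (\<integral>\<^sup>+e. G e \<partial>noises N v1)" for w1 w2 :: nat
  proof -
    have "(\<integral>\<^sup>+x. F (oS (w1, w2, x)) * G (oE1 (w1, w2, x)) \<partial>noise_space N Q v1 v2) =
      (\<integral>\<^sup>+x. \<integral>\<^sup>+e. F (fst x) * G e \<partial>noises N v1 \<partial>(noises N Q \<Otimes>\<^sub>M ?rest))"
      by (subst nn_integral_noise_inner1) (use pos in \<open>simp_all add: oS_def oE1_def\<close>)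
    also have "\<dots> = (\<integral>\<^sup>+x. F (fst x) * (\<integral>\<^sup>+e. G e \<partial>noises N v1) \<partial>(noises N Q \<Otimes>\<^sub>M ?rest))"
      by (intro nn_integral_cong nn_integral_cmult) measurable
    also have "\<dots> = (\<integral>\<^sup>+x. F (fst x) \<partial>(noises N Q \<Otimes>\<^sub>M ?rest)) * (\<integral>\<^sup>+e. G e \<partial>noises N v1)"
      by (rule nn_integral_multc) measurable
    also have "(\<integral>\<^sup>+x. F (fst x) \<partial>(noises N Q \<Otimes>\<^sub>M ?rest)) = (\<integral>\<^sup>+s. F s \<partial>noises N Q)"
      by (subst r.nn_integral_fst[symmetric]) (simp_all add: r.emeasure_space_1)
    finally show ?thesis .
  qed
  show ?thesis
    unfolding nn_integral_chan_space[OF pos m] sec using pos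
    by (simp add: mult.assoc[symmetric] ennreal_mult[symmetric] ennreal_of_nat_eq_real_of_nat)
qed

section \<open>The two-layer scheme and its error recursion\<close>

locale schalkwijk_kailath =
  fixes a1 a2 b v :: real and n M1 M2 :: nat and t :: real
  assumes a1: "a1 > 0" and a2: "a2 \<ge> 0" and b: "b > 0" and v: "v > 0" and M1: "M1 > 0" and M2: "M2 > 0"
begin

text \<open>Both encoders know the first message and send the same coherent error, so their
  amplitudes add. For an observation a u + b u' + e with u, u' orthonormal and e of variance v,
  \<open>g1\<close> is the best linear coefficient for u and \<open>r1\<close> the root mean square
  error left. \<open>g2\<close> and \<open>r2\<close> are the same for u' seen in b u' + e.
  \<open>c\<close> and \<open>d\<close> are the weights of the j-th refinement in the unnormalised
  estimates.\<close>

definition "a = a1 + a2"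
definition "r1 = sqrt ((b\<^sup>2 + v) / (a\<^sup>2 + b\<^sup>2 + v))"
definition "r2 = sqrt (v / (b\<^sup>2 + v))"
definition "g1 = a / (a\<^sup>2 + b\<^sup>2 + v)"
definition "g2 = b / (b\<^sup>2 + v)"
definition "c j = sqrt v * g1 * r1 ^ j"
definition "d j = sqrt v * g2 * r2 ^ j"

text \<open>Normalised estimation errors of the two noise samples \<open>e 0\<close> and \<open>e 1\<close> after k refinements.
  They stay orthonormal, which is what makes the coherent layer see white noise.\<close>
primrec err :: "nat \<Rightarrow> (nat \<Rightarrow> real) \<Rightarrow> real \<times> real" where
  "err 0 e = (e 0 / sqrt v, e 1 / sqrt v)"
| "err (Suc k) e =
    ((fst (err k e) - g1 * (a * fst (err k e) + b * snd (err k e) + e (k + 2))) / r1,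
     (snd (err k e) - g2 * (b * snd (err k e) + e (k + 2))) / r2)"

abbreviation "u k e \<equiv> fst (err k e)"
abbreviation "u' k e \<equiv> snd (err k e)"

lemma a_pos: "a > 0" using a1 a2 by (simp add: a_def)
lemma den_pos: "b\<^sup>2 + v > 0" "a\<^sup>2 + b\<^sup>2 + v > 0" using v by (auto intro: add_nonneg_pos)
lemma r_pos: "r1 > 0" "r2 > 0" using v den_pos by (auto simp: r1_def r2_def)
lemma r_less_1: "r1 < 1" "r2 < 1" using v a_pos b den_pos by (auto simp: r1_def r2_def)
lemma g_nonneg: "g1 \<ge> 0" "g2 \<ge> 0" using a_pos b den_pos by (auto simp: g1_def g2_def intro!: divide_nonneg_nonneg)
lemma r_sq: "r1\<^sup>2 = (b\<^sup>2 + v) / (a\<^sup>2 + b\<^sup>2 + v)" "r2\<^sup>2 = v / (b\<^sup>2 + v)"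
  using v den_pos by (auto simp: r1_def r2_def)

lemma err_upd: "i \<ge> k + 2 \<Longrightarrow> err k (e(i := y)) = err k e"
  by (induction k) auto

lemma measurable_err:
  assumes "k + 2 \<le> N"
  shows "(\<lambda>e. u k e) \<in> borel_measurable (seqs N) \<and> (\<lambda>e. u' k e) \<in> borel_measurable (seqs N)"
  using assms
proof (induction k)
  case 0
  then have [measurable]: "(\<lambda>e. e 0 :: real) \<in> borel_measurable (seqs N)"
    "(\<lambda>e. e (Suc 0) :: real) \<in> borel_measurable (seqs N)" by auto
  show ?case by auto
next
  case (Suc k)
  then have [measurable]: "(\<lambda>e. u k e) \<in> borel_measurable (seqs N)" "(\<lambda>e. u' k e) \<in> borel_measurable (seqs N)"
    by auto
  have [measurable]: "(\<lambda>e. e (Suc (Suc k)) :: real) \<in> borel_measurable (seqs N)" using Suc.prems by auto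
  show ?case by auto
qed

text \<open>Orthonormality, stated through all linear combinations at once. The new noise sample is
  independent of the old errors, so one step maps (\<alpha>, \<beta>) to new coefficients plus a
  fresh variance term.\<close>

lemma err_moment:
  assumes "k + 2 \<le> N"
  shows "(\<integral>\<^sup>+e. ennreal ((\<alpha> * u k e + \<beta> * u' k e)\<^sup>2) \<partial>noises N v) = ennreal (\<alpha>\<^sup>2 + \<beta>\<^sup>2)"
  using assms
proof (induction k arbitrary: \<alpha> \<beta>)
  case 0
  interpret g: prob_space "noises N v" using v by (rule prob_space_PiM_gauss)
  have m: "(\<lambda>e. \<alpha> / sqrt v * e 0) \<in> borel_measurable (seqs N)" using 0 by simp
  have "(\<integral>\<^sup>+e. ennreal ((\<alpha> / sqrt v * e 0 + \<beta> / sqrt v * e 1)\<^sup>2) \<partial>noises N v) =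
     (\<integral>\<^sup>+e. ennreal ((\<alpha> / sqrt v * e 0)\<^sup>2) \<partial>noises N v) + ennreal ((\<beta> / sqrt v)\<^sup>2 * v)"
    by (rule gauss_resample[OF v _ _ m]) (use 0 in auto)
  also have "(\<integral>\<^sup>+e. ennreal ((\<alpha> / sqrt v * e 0)\<^sup>2) \<partial>noises N v) = ennreal ((\<alpha> / sqrt v)\<^sup>2 * v)"
    using gauss_resample[OF v, of "{..<N}" 0 "\<lambda>_. 0" "\<alpha> / sqrt v"] 0 by simp
  finally show ?case using v by (simp add: power_divide ennreal_plus[symmetric] del: ennreal_plus)
next
  case (Suc k)
  have m: "(\<lambda>e. u k e) \<in> borel_measurable (seqs N)" "(\<lambda>e. u' k e) \<in> borel_measurable (seqs N)"
    using measurable_err[of k N] Suc.prems by auto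
  define x where "x = \<alpha> / r1"
  define y where "y = \<beta> / r2"
  let ?A = "x * (1 - g1 * a)" and ?B = "y * (1 - g2 * b) - x * g1 * b" and ?C = "- (x * g1 + y * g2)"
  have eq: "\<alpha> * u (Suc k) e + \<beta> * u' (Suc k) e = (?A * u k e + ?B * u' k e) + ?C * e (k + 2)" for e
    by (simp add: x_def y_def algebra_simps diff_divide_distrib add_divide_distrib)
  have "(\<integral>\<^sup>+e. ennreal ((\<alpha> * u (Suc k) e + \<beta> * u' (Suc k) e)\<^sup>2) \<partial>noises N v) =
     (\<integral>\<^sup>+e. ennreal ((?A * u k e + ?B * u' k e)\<^sup>2) \<partial>noises N v) + ennreal (?C\<^sup>2 * v)"
    unfolding eq
  proof (rule gauss_resample[OF v])
    show "(\<lambda>e. ?A * u k e + ?B * u' k e) \<in> borel_measurable (seqs N)" using m by measurable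
    show "?A * u k (e(k + 2 := z)) + ?B * u' k (e(k + 2 := z)) = ?A * u k e + ?B * u' k e" for e z
      by (simp add: err_upd)
  qed (use Suc.prems in auto)
  also have "\<dots> = ennreal (?A\<^sup>2 + ?B\<^sup>2 + ?C\<^sup>2 * v)"
    using Suc v by (simp add: ennreal_plus[symmetric] del: ennreal_plus)
  also have "?A\<^sup>2 + ?B\<^sup>2 + ?C\<^sup>2 * v = \<alpha>\<^sup>2 + \<beta>\<^sup>2"
  proof -
    let ?D = "a\<^sup>2 + b\<^sup>2 + v" and ?E = "b\<^sup>2 + v"
    have D: "?D \<noteq> 0" "?E \<noteq> 0" using den_pos by auto
    have h1: "1 - g1 * a = ?E / ?D" using D by (simp add: g1_def field_simps power2_eq_square)
    have h2: "1 - g2 * b = v / ?E" using D by (simp add: g2_def field_simps power2_eq_square)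
    have "?A\<^sup>2 + ?B\<^sup>2 + ?C\<^sup>2 * v = x\<^sup>2 * ((1 - g1 * a)\<^sup>2 + g1\<^sup>2 * ?E) + y\<^sup>2 * ((1 - g2 * b)\<^sup>2 + g2\<^sup>2 * v)
        + 2 * x * y * g1 * (g2 * v - b * (1 - g2 * b))"
      by (simp add: power2_eq_square algebra_simps)
    also have "(1 - g1 * a)\<^sup>2 + g1\<^sup>2 * ?E = r1\<^sup>2"
    proof -
      have "(1 - g1 * a)\<^sup>2 + g1\<^sup>2 * ?E = ?E * (?E + a\<^sup>2) / ?D\<^sup>2"
        unfolding h1 unfolding g1_def by (simp add: power_divide add_divide_distrib[symmetric]) (simp add: power2_eq_square algebra_simps)
      also have "?E + a\<^sup>2 = ?D" by simp
      also have "?E * ?D / ?D\<^sup>2 = ?E / ?D" using D(1) by (simp only: power2_eq_square) simp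
      finally show ?thesis by (simp add: r_sq)
    qed
    also have "(1 - g2 * b)\<^sup>2 + g2\<^sup>2 * v = r2\<^sup>2"
    proof -
      have "(1 - g2 * b)\<^sup>2 + g2\<^sup>2 * v = v * ?E / ?E\<^sup>2"
        unfolding h2 unfolding g2_def by (simp add: power_divide add_divide_distrib[symmetric]) (simp add: power2_eq_square algebra_simps)
      also have "\<dots> = v / ?E" using D(2) by (simp add: power2_eq_square)
      finally show ?thesis by (simp add: r_sq)
    qed
    \<comment> \<open>Orthogonality principle: the new private error is uncorrelated with b u' + e,
      the only part through which it could correlate with the new coherent error.\<close>
    also have "g2 * v - b * (1 - g2 * b) = 0" unfolding h2 unfolding g2_def by simp
    also have "x\<^sup>2 * r1\<^sup>2 + y\<^sup>2 * r2\<^sup>2 + 2 * x * y * g1 * 0 = \<alpha>\<^sup>2 + \<beta>\<^sup>2"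
      using r_pos by (simp add: x_def y_def power_divide)
    finally show ?thesis .
  qed
  finally show ?case .
qed

text \<open>Message points have spacing 1 / M and lie in (0, 1], so changing a message moves its
  point by at most 1.\<close>

definition "pt w M = real w / real (M :: nat)"

text \<open>The receiver-side versions \<open>obs1\<close>, \<open>obs2\<close> of the unnormalised errors omit the part of the
  state that only the encoders know; \<open>est1\<close>, \<open>est2\<close> include it.\<close>
definition "lin1 s = - s 0 + (\<Sum>j<n. c j * s (j + 2))"
definition "obs1 k w1 y = y 0 - pt w1 M1 - (\<Sum>j<k. c j * y (j + 2))"
definition "est1 k w1 s y = obs1 k w1 y - (\<Sum>j\<in>{k..<n}. c j * s (j + 2))"
definition "gain k = 1 / (sqrt v * r1 ^ k)"
definition "gain' k = 1 / (sqrt v * r2 ^ k)"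
text \<open>To isolate the private layer the receiver subtracts
  \<open>a * gain k * obs1 k w1 y\<close> from output k + 2 in place of the coherent input a u. The
  two differ by the state tail that \<open>est1\<close> removes from \<open>obs1\<close>;
  \<open>state'\<close> is the state together with this discrepancy.\<close>

definition "state' k s = s (k + 2) - a * gain k * (\<Sum>j\<in>{k..<n}. c j * s (j + 2))"
text \<open>The private counterpart of \<open>lin1\<close>. The refinements of the second estimate
  see \<open>state'\<close> instead of the state, and their weighted total is known to the second
  encoder before transmission.\<close>

definition "lin2 s = - s 1 + (\<Sum>j<n. d j * state' j s)"
definition "obs2 k w1 w2 y = y 1 - pt w2 M2 - (\<Sum>j<k. d j * (y (j + 2) - a * gain j * obs1 j w1 y))"
definition "est2 k w1 w2 s y = obs2 k w1 w2 y - (\<Sum>j\<in>{k..<n}. d j * state' j s)"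

definition enc_1 :: enc1 where
  "enc_1 i = (\<lambda>(w1, s, y, _). if s 0 > t then
     (if i = 0 then pt w1 M1 + lin1 s else if i = 1 then 0 else a1 * (gain (i - 2) * est1 (i - 2) w1 s y)) else 0)"

definition enc_2 :: enc2 where
  "enc_2 i = (\<lambda>(w1, w2, s, y, _). if s 0 > t then
     (if i = 0 then 0 else if i = 1 then pt w2 M2 + lin2 s else
       a2 * (gain (i - 2) * est1 (i - 2) w1 s y) + b * (gain' (i - 2) * est2 (i - 2) w1 w2 s y)) else 0)"

definition "rnd x = nat \<lfloor>x + 1 / 2\<rfloor>"

text \<open>Successive decoding. Message 0 has point 0, so \<open>obs1 n 0\<close> is the first
  message point plus the estimation error; the decoded value then serves to remove the coherent
  layer from the second estimate.\<close>

definition decoder :: "(nat \<Rightarrow> real) \<Rightarrow> nat \<times> nat" where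
  "decoder y = (let m = rnd (M1 * obs1 n 0 y) in (m, rnd (M2 * obs2 n m 0 y)))"

abbreviation "Yo \<omega> \<equiv> chY enc_1 enc_2 (n + 2) \<omega>"

lemma obs1_cong: "(\<And>j. j < k + 2 \<Longrightarrow> y j = y' j) \<Longrightarrow> obs1 k w1 y = obs1 k w1 y'"
  by (simp add: obs1_def)

lemma obs2_cong: "(\<And>j. j < k + 2 \<Longrightarrow> y j = y' j) \<Longrightarrow> obs2 k w1 w2 y = obs2 k w1 w2 y'"
  unfolding obs2_def
  by (intro arg_cong2[where f="(-)"] sum.cong arg_cong2[where f="(*)"] obs1_cong refl) auto

lemma ypast_nth: "j < i \<Longrightarrow> i \<le> N \<Longrightarrow> ypast f1 f2 N i \<omega> j = chY f1 f2 N \<omega> j"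
  using restrict_chY[of i N f1 f2 \<omega>] by (metis lessThan_iff restrict_apply')

lemma est_restrict:
  assumes "k \<le> n"
  shows "est1 k w1 (restrict s {..<n+2}) (ypast enc_1 enc_2 (n + 2) (k + 2) \<omega>) = est1 k w1 s (Yo \<omega>)"
    and "est2 k w1 w2 (restrict s {..<n+2}) (ypast enc_1 enc_2 (n + 2) (k + 2) \<omega>) = est2 k w1 w2 s (Yo \<omega>)"
proof -
  have st: "state' j (restrict s {..<n+2}) = state' j s" if "j < n" for j
    using that by (simp add: state'_def)
  have y: "ypast enc_1 enc_2 (n + 2) (k + 2) \<omega> j = Yo \<omega> j" if "j < k + 2" for j
    by (rule ypast_nth) (use that assms in auto)
  show "est1 k w1 (restrict s {..<n+2}) (ypast enc_1 enc_2 (n + 2) (k + 2) \<omega>) = est1 k w1 s (Yo \<omega>)"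
    unfolding est1_def by (subst obs1_cong[OF y]) (auto simp del: add_2_eq_Suc')
  show "est2 k w1 w2 (restrict s {..<n+2}) (ypast enc_1 enc_2 (n + 2) (k + 2) \<omega>) = est2 k w1 w2 s (Yo \<omega>)"
    unfolding est2_def by (subst obs2_cong[OF y]) (auto simp: st simp del: add_2_eq_Suc')
qed

lemma lin_restrict: "lin1 (restrict s {..<n+2}) = lin1 s" "lin2 (restrict s {..<n+2}) = lin2 s"
  by (simp_all add: lin1_def lin2_def state'_def)

lemma X_formulas:
  fixes \<omega> :: outcome
  shows "chX1 enc_1 enc_2 (n + 2) 0 \<omega> = (if oS \<omega> 0 > t then pt (oW1 \<omega>) M1 + lin1 (oS \<omega>) else 0)"
    and "chX2 enc_1 enc_2 (n + 2) 0 \<omega> = 0"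
    and "chX1 enc_1 enc_2 (n + 2) 1 \<omega> = 0"
    and "chX2 enc_1 enc_2 (n + 2) 1 \<omega> = (if oS \<omega> 0 > t then pt (oW2 \<omega>) M2 + lin2 (oS \<omega>) else 0)"
    and "k \<le> n \<Longrightarrow> chX1 enc_1 enc_2 (n + 2) (k + 2) \<omega> =
      (if oS \<omega> 0 > t then a1 * (gain k * est1 k (oW1 \<omega>) (oS \<omega>) (Yo \<omega>)) else 0)"
    and "k \<le> n \<Longrightarrow> chX2 enc_1 enc_2 (n + 2) (k + 2) \<omega> =
      (if oS \<omega> 0 > t then a2 * (gain k * est1 k (oW1 \<omega>) (oS \<omega>) (Yo \<omega>))
         + b * (gain' k * est2 k (oW1 \<omega>) (oW2 \<omega>) (oS \<omega>) (Yo \<omega>)) else 0)"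
  using lin_restrict[of "oS \<omega>"] est_restrict[of k]
  by (simp_all add: chX1_def chX2_def enc_1_def enc_2_def)

text \<open>The state terms placed in the two initial inputs are exactly those the estimates
  accumulate later. Each refinement uses up one of them, so that only the noise recursion
  \<open>err\<close> survives.\<close>

lemma trajectory:
  assumes "oS \<omega> 0 > t" "k \<le> n"
  shows "est1 k (oW1 \<omega>) (oS \<omega>) (Yo \<omega>) = sqrt v * r1 ^ k * u k (oE1 \<omega>) \<and>
    est2 k (oW1 \<omega>) (oW2 \<omega>) (oS \<omega>) (Yo \<omega>) = sqrt v * r2 ^ k * u' k (oE1 \<omega>)"
  using assms(2)
proof (induction k)
  case 0
  have y0: "Yo \<omega> 0 = pt (oW1 \<omega>) M1 + lin1 (oS \<omega>) + oS \<omega> 0 + oE1 \<omega> 0"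
    using chY_nth[of 0 "n+2" enc_1 enc_2 \<omega>] X_formulas(1,2)[of \<omega>] assms(1) by simp
  have y1: "Yo \<omega> 1 = pt (oW2 \<omega>) M2 + lin2 (oS \<omega>) + oS \<omega> 1 + oE1 \<omega> 1"
    using chY_nth[of 1 "n+2" enc_1 enc_2 \<omega>] X_formulas(3,4)[of \<omega>] assms(1) by simp
  show ?case using v y0 y1
    by (simp add: est1_def obs1_def lin1_def est2_def obs2_def lin2_def atLeast0LessThan)
next
  case (Suc k)
  let ?w1 = "oW1 \<omega>" and ?w2 = "oW2 \<omega>" and ?s = "oS \<omega>" and ?e = "oE1 \<omega>" and ?y = "Yo \<omega>"
  have k: "k < n" using Suc.prems by simp
  have IH: "est1 k ?w1 ?s ?y = sqrt v * r1 ^ k * u k ?e" "est2 k ?w1 ?w2 ?s ?y = sqrt v * r2 ^ k * u' k ?e"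
    using Suc by auto
  have nz: "sqrt v * r1 ^ k \<noteq> 0" "sqrt v * r2 ^ k \<noteq> 0" using v r_pos by auto
  have ga: "gain k * est1 k ?w1 ?s ?y = u k ?e" "gain' k * est2 k ?w1 ?w2 ?s ?y = u' k ?e"
    using nz unfolding IH gain_def gain'_def by auto
  have Y: "?y (k + 2) = a * u k ?e + b * u' k ?e + ?s (k + 2) + ?e (k + 2)"
    using chY_nth[of "k+2" "n+2" enc_1 enc_2 \<omega>] X_formulas(5,6)[of k \<omega>] assms(1) k
    by (simp add: ga a_def distrib_right del: add_2_eq_Suc')
  have split: "(\<Sum>j\<in>{k..<n}. f j) = f k + (\<Sum>j\<in>{Suc k..<n}. f j)" for f :: "nat \<Rightarrow> real"
    using k by (rule sum.atLeast_Suc_lessThan)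
  have e1: "est1 (Suc k) ?w1 ?s ?y = est1 k ?w1 ?s ?y - c k * (?y (k + 2) - ?s (k + 2))"
    unfolding est1_def obs1_def split by (simp add: algebra_simps)
  \<comment> \<open>The receiver holds \<open>obs1\<close>, not \<open>est1\<close>; subtracting its
    scaled version turns the state at this time into \<open>state'\<close>.\<close>
  have "obs1 k ?w1 ?y = est1 k ?w1 ?s ?y + (\<Sum>j\<in>{k..<n}. c j * ?s (j + 2))" by (simp add: est1_def)
  then have "a * gain k * obs1 k ?w1 ?y = a * (gain k * est1 k ?w1 ?s ?y) + (?s (k + 2) - state' k ?s)"
    by (simp add: state'_def algebra_simps)
  then have o: "a * gain k * obs1 k ?w1 ?y = a * u k ?e + (?s (k + 2) - state' k ?s)" unfolding ga .
  have e2: "est2 (Suc k) ?w1 ?w2 ?s ?y = est2 k ?w1 ?w2 ?s ?y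
      - d k * (?y (k + 2) - a * gain k * obs1 k ?w1 ?y - state' k ?s)"
    unfolding est2_def obs2_def split by (simp add: algebra_simps)
  have step: "sqrt v * r1 ^ Suc k * u (Suc k) ?e = sqrt v * r1 ^ k * (u k ?e - g1 * (a * u k ?e + b * u' k ?e + ?e (k + 2)))"
    "sqrt v * r2 ^ Suc k * u' (Suc k) ?e = sqrt v * r2 ^ k * (u' k ?e - g2 * (b * u' k ?e + ?e (k + 2)))"
    using r_pos by simp_all
  have 1: "est1 (Suc k) ?w1 ?s ?y = sqrt v * r1 ^ Suc k * u (Suc k) ?e"
    unfolding step e1 IH Y by (simp add: c_def algebra_simps)
  have 2: "est2 (Suc k) ?w1 ?w2 ?s ?y = sqrt v * r2 ^ Suc k * u' (Suc k) ?e"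
    unfolding step e2 IH Y o by (simp add: d_def algebra_simps)
  from 1 2 show ?case by blast
qed

text \<open>While transmission is active these inputs depend on the receiver noise alone. Their
  power, and the fact that later outputs do not distinguish messages, both rest on this.\<close>

lemma X_on:
  assumes "oS \<omega> 0 > t" "k \<le> n"
  shows "chX1 enc_1 enc_2 (n + 2) (k + 2) \<omega> = a1 * u k (oE1 \<omega>)"
    and "chX2 enc_1 enc_2 (n + 2) (k + 2) \<omega> = a2 * u k (oE1 \<omega>) + b * u' k (oE1 \<omega>)"
proof -
  have nz: "sqrt v * r1 ^ k \<noteq> 0" "sqrt v * r2 ^ k \<noteq> 0" using v r_pos by auto
  have ga: "gain k * est1 k (oW1 \<omega>) (oS \<omega>) (Yo \<omega>) = u k (oE1 \<omega>)"
    "gain' k * est2 k (oW1 \<omega>) (oW2 \<omega>) (oS \<omega>) (Yo \<omega>) = u' k (oE1 \<omega>)"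
    using trajectory[OF assms] nz unfolding gain_def gain'_def by auto
  show "chX1 enc_1 enc_2 (n + 2) (k + 2) \<omega> = a1 * u k (oE1 \<omega>)"
    and "chX2 enc_1 enc_2 (n + 2) (k + 2) \<omega> = a2 * u k (oE1 \<omega>) + b * u' k (oE1 \<omega>)"
    using X_formulas(5,6)[of k \<omega>] assms by (simp_all add: ga del: add_2_eq_Suc')
qed

lemma rnd_correct:
  assumes "M > 0" "\<bar>real M * x\<bar> < 1 / 2"
  shows "rnd (real M * (pt w M + x)) = w"
proof -
  have "real M * (pt w M + x) = real w + real M * x" using assms(1) by (simp add: pt_def distrib_left)
  moreover have "\<lfloor>real w + real M * x + 1 / 2\<rfloor> = int w"
    using assms(2) by (intro floor_unique) (auto simp: abs_less_iff)
  ultimately show ?thesis by (simp add: rnd_def)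
qed

lemma decoder_correct:
  assumes "oS \<omega> 0 > t" "\<bar>real M1 * (sqrt v * r1 ^ n * u n (oE1 \<omega>))\<bar> < 1 / 2"
    "\<bar>real M2 * (sqrt v * r2 ^ n * u' n (oE1 \<omega>))\<bar> < 1 / 2"
  shows "decoder (Yo \<omega>) = (oW1 \<omega>, oW2 \<omega>)"
proof -
  note tr = trajectory[OF assms(1) order_refl]
  have "obs1 n 0 (Yo \<omega>) = pt (oW1 \<omega>) M1 + est1 n (oW1 \<omega>) (oS \<omega>) (Yo \<omega>)"
    by (simp add: est1_def obs1_def pt_def)
  then have 1: "rnd (M1 * obs1 n 0 (Yo \<omega>)) = oW1 \<omega>"
    using rnd_correct[OF M1] tr assms(2) by simp
  have "obs2 n (oW1 \<omega>) 0 (Yo \<omega>) = pt (oW2 \<omega>) M2 + est2 n (oW1 \<omega>) (oW2 \<omega>) (oS \<omega>) (Yo \<omega>)"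
    by (simp add: est2_def obs2_def pt_def)
  then have "rnd (M2 * obs2 n (oW1 \<omega>) 0 (Yo \<omega>)) = oW2 \<omega>"
    using rnd_correct[OF M2] tr assms(3) by simp
  then show ?thesis using 1 by (simp add: decoder_def Let_def)
qed

text \<open>With noise and state fixed, another message pair moves only the two initial inputs, each
  by a difference of points in (0, 1]. On the silent event all inputs vanish.\<close>

lemma Y_close:
  assumes w: "w1 \<in> {1..M1}" "w2 \<in> {1..M2}" and i: "i < n + 2"
  shows "\<bar>Yo (w1, w2, x) i - Yo (1, 1, x) i\<bar> \<le> (if i < 2 then 1 else 0)"
proof -
  let ?\<omega> = "(w1, w2, x)" and ?\<omega>' = "(1, 1, x)"
  have same: "oS ?\<omega> = oS ?\<omega>'" "oE1 ?\<omega> = oE1 ?\<omega>'" by (simp_all add: oS_def oE1_def)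
  have pt: "\<bar>pt w M - pt 1 M\<bar> \<le> 1" if "w \<in> {1..M}" for w M
  proof -
    have "\<bar>real w - 1\<bar> \<le> real M" using that by auto
    then show ?thesis using that by (simp add: pt_def diff_divide_distrib[symmetric] abs_divide)
  qed
  note Y = chY_nth[OF i, of enc_1 enc_2 ?\<omega>] chY_nth[OF i, of enc_1 enc_2 ?\<omega>']
  show ?thesis
  proof (cases "oS ?\<omega> 0 > t")
    case True
    then have T': "oS ?\<omega>' 0 > t" using same by simp
    consider "i = 0" | "i = 1" | k where "i = k + 2" "k < n"
      using i by (metis One_nat_def Suc_1 add.commute add_2_eq_Suc' less_Suc_eq_0_disj less_add_same_cancel1 nat_add_left_cancel_less not0_implies_Suc)
    then show ?thesis
    proof cases
      case 1
      then show ?thesis using Y X_formulas(1,2)[of ?\<omega>] X_formulas(1,2)[of ?\<omega>'] True T' same pt[OF w(1)]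
        by (simp add: oW1_def)
    next
      case 2
      then show ?thesis using Y X_formulas(3,4)[of ?\<omega>] X_formulas(3,4)[of ?\<omega>'] True T' same pt[OF w(2)]
        by (simp add: oW2_def)
    next
      case 3
      then show ?thesis using Y X_on[OF True, of k] X_on[OF T', of k] same by simp
    qed
  next
    case False
    have z: "chX1 enc_1 enc_2 (n + 2) i \<omega> = 0" "chX2 enc_1 enc_2 (n + 2) i \<omega> = 0" if "\<not> oS \<omega> 0 > t" for \<omega> :: outcome
      using that by (simp_all add: chX1_def chX2_def enc_1_def enc_2_def)
    show ?thesis using Y False z[of ?\<omega>] z[of ?\<omega>'] same by simp
  qed
qed

end

lemmas arith_measurable = borel_measurable_add borel_measurable_diff borel_measurable_uminus
  borel_measurable_sum borel_measurable_times borel_measurable_const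

lemma geometric_sum_le:
  fixes r :: real
  assumes "0 < r" "r < 1"
  shows "(\<Sum>j<m. r ^ j) \<le> 1 / (1 - r)"
proof -
  have "(\<Sum>j<m. r ^ j) = (1 - r ^ m) / (1 - r)" using assms by (simp add: sum_gp_strict)
  also have "\<dots> \<le> 1 / (1 - r)" using assms by (intro divide_right_mono) auto
  finally show ?thesis .
qed

context schalkwijk_kailath
begin

declare add_2_eq_Suc' [simp del]

text \<open>Messages, state and outputs are arbitrary measurable functions on X because the
  estimates occur on encoder arguments, in the decoder with a decoded message in place of w1, and as
  functions of the state alone.\<close>

context
  fixes X :: "'x measure" and w1 w2 :: "'x \<Rightarrow> nat" and s y :: "'x \<Rightarrow> nat \<Rightarrow> real" and m :: nat
  assumes w1: "w1 \<in> X \<rightarrow>\<^sub>M count_space UNIV" and w2: "w2 \<in> X \<rightarrow>\<^sub>M count_space UNIV"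
    and s: "s \<in> X \<rightarrow>\<^sub>M seqs (n + 2)" and y: "y \<in> X \<rightarrow>\<^sub>M seqs m"
begin

private lemma s_nth: "j < n + 2 \<Longrightarrow> (\<lambda>x. s x j) \<in> borel_measurable X"
  by (rule measurable_compose[OF s]) simp

private lemma y_nth: "j < m \<Longrightarrow> (\<lambda>x. y x j) \<in> borel_measurable X"
  by (rule measurable_compose[OF y]) simp

lemma measurable_pt: "(\<lambda>x. pt (w1 x) M) \<in> borel_measurable X" "(\<lambda>x. pt (w2 x) M) \<in> borel_measurable X"
  by (rule measurable_compose[OF w1], simp) (rule measurable_compose[OF w2], simp)

lemma measurable_lin1: "(\<lambda>x. lin1 (s x)) \<in> borel_measurable X"
  unfolding lin1_def
  by (intro arith_measurable s_nth) auto

lemma measurable_state': "k < n \<Longrightarrow> (\<lambda>x. state' k (s x)) \<in> borel_measurable X"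
  unfolding state'_def
  by (intro arith_measurable s_nth) auto

lemma measurable_lin2: "(\<lambda>x. lin2 (s x)) \<in> borel_measurable X"
  unfolding lin2_def
  by (intro arith_measurable s_nth measurable_state') auto

lemma measurable_obs1: "k + 2 \<le> m \<Longrightarrow> (\<lambda>x. obs1 k (w1 x) (y x)) \<in> borel_measurable X"
  unfolding obs1_def
  by (intro arith_measurable y_nth measurable_pt) auto

lemma measurable_obs2: "k + 2 \<le> m \<Longrightarrow> (\<lambda>x. obs2 k (w1 x) (w2 x) (y x)) \<in> borel_measurable X"
  unfolding obs2_def
  by (intro arith_measurable y_nth measurable_pt measurable_obs1) auto

lemma measurable_est1: "k + 2 \<le> m \<Longrightarrow> (\<lambda>x. est1 k (w1 x) (s x) (y x)) \<in> borel_measurable X"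
  unfolding est1_def
  by (intro arith_measurable s_nth measurable_obs1) auto

lemma measurable_est2: "k + 2 \<le> m \<Longrightarrow> (\<lambda>x. est2 k (w1 x) (w2 x) (s x) (y x)) \<in> borel_measurable X"
  unfolding est2_def
  by (intro arith_measurable measurable_state' measurable_obs2) auto

lemma measurable_above: "Measurable.pred X (\<lambda>x. s x 0 > t)"
  using s_nth[of 0] by measurable

end

lemma measurable_enc_1:
  assumes "i < n + 2"
  shows "enc_1 i \<in> measurable (count_space UNIV \<Otimes>\<^sub>M seqs (n + 2) \<Otimes>\<^sub>M seqs i \<Otimes>\<^sub>M borel) borel"
    (is "_ \<in> measurable ?X borel")
proof -
  let ?w = "\<lambda>x. fst x" and ?s = "\<lambda>x. fst (snd x)"
    and ?y = "\<lambda>x. fst (snd (snd x))"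
  have w: "?w \<in> ?X \<rightarrow>\<^sub>M count_space UNIV" and s: "?s \<in> ?X \<rightarrow>\<^sub>M seqs (n + 2)" and y: "?y \<in> ?X \<rightarrow>\<^sub>M seqs i"
    by measurable
  note [measurable] = measurable_pt(1)[OF w w s y] measurable_lin1[OF w w s y] measurable_above[OF w w s y]
  have e: "i \<ge> 2 \<Longrightarrow> (\<lambda>x. est1 (i - 2) (?w x) (?s x) (?y x)) \<in> borel_measurable ?X"
    by (rule measurable_est1[OF w w s y]) simp
  have "(\<lambda>x. if ?s x 0 > t then
     (if i = 0 then pt (?w x) M1 + lin1 (?s x) else if i = 1 then 0 else a1 * (gain (i - 2) * est1 (i - 2) (?w x) (?s x) (?y x))) else 0) \<in> borel_measurable ?X" (is "?f \<in> _")
  proof (cases "i \<ge> 2")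
    case True
    note [measurable] = e[OF True]
    show ?thesis by measurable
  next
    case False
    show ?thesis
    proof (cases "i = 0")
      case True
      have eq: "?f = (\<lambda>x. if ?s x 0 > t then pt (?w x) M1 + lin1 (?s x) else 0)" using True by auto
      show ?thesis unfolding eq by measurable
    next
      case i: False
      have eq: "?f = (\<lambda>x. if ?s x 0 > t then 0 else 0)" using False i by auto
      show ?thesis unfolding eq by measurable
    qed
  qed
  then show ?thesis unfolding enc_1_def by (simp add: split_beta')
qed

lemma measurable_enc_2:
  assumes "i < n + 2"
  shows "enc_2 i \<in> measurable (count_space UNIV \<Otimes>\<^sub>M count_space UNIV \<Otimes>\<^sub>M seqs (n + 2) \<Otimes>\<^sub>M seqs i \<Otimes>\<^sub>M borel) borel"
    (is "_ \<in> measurable ?X borel")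
proof -
  let ?w1 = "\<lambda>x. fst x"
    and ?w2 = "\<lambda>x. fst (snd x)"
    and ?s = "\<lambda>x. fst (snd (snd x))"
    and ?y = "\<lambda>x. fst (snd (snd (snd x)))"
  have w1: "?w1 \<in> ?X \<rightarrow>\<^sub>M count_space UNIV" and w2: "?w2 \<in> ?X \<rightarrow>\<^sub>M count_space UNIV"
    and s: "?s \<in> ?X \<rightarrow>\<^sub>M seqs (n + 2)" and y: "?y \<in> ?X \<rightarrow>\<^sub>M seqs i"
    by measurable
  note [measurable] = measurable_pt(2)[OF w1 w2 s y] measurable_lin2[OF w1 w2 s y] measurable_above[OF w1 w2 s y]
  have e: "i \<ge> 2 \<Longrightarrow> (\<lambda>x. est1 (i - 2) (?w1 x) (?s x) (?y x)) \<in> borel_measurable ?X"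
    "i \<ge> 2 \<Longrightarrow> (\<lambda>x. est2 (i - 2) (?w1 x) (?w2 x) (?s x) (?y x)) \<in> borel_measurable ?X"
    by (rule measurable_est1[OF w1 w2 s y], simp) (rule measurable_est2[OF w1 w2 s y], simp)
  have "(\<lambda>x. if ?s x 0 > t then
     (if i = 0 then 0 else if i = 1 then pt (?w2 x) M2 + lin2 (?s x) else
       a2 * (gain (i - 2) * est1 (i - 2) (?w1 x) (?s x) (?y x)) + b * (gain' (i - 2) * est2 (i - 2) (?w1 x) (?w2 x) (?s x) (?y x))) else 0) \<in> borel_measurable ?X" (is "?f \<in> _")
  proof (cases "i \<ge> 2")
    case True
    note [measurable] = e(1)[OF True] e(2)[OF True]
    show ?thesis by measurable
  next
    case False
    show ?thesis
    proof (cases "i = 0")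
      case True
      have eq: "?f = (\<lambda>x. if ?s x 0 > t then 0 else 0)" using True by auto
      show ?thesis unfolding eq by measurable
    next
      case i: False
      have eq: "?f = (\<lambda>x. if ?s x 0 > t then pt (?w2 x) M2 + lin2 (?s x) else 0)" using False i by auto
      show ?thesis unfolding eq by measurable
    qed
  qed
  then show ?thesis unfolding enc_2_def by (simp add: split_beta')
qed

lemma causal_scheme: "causal_encoders (n + 2) enc_1 enc_2"
  using measurable_enc_1 measurable_enc_2 by (simp add: causal_encoders_def)

lemma measurable_decoder: "decoder \<in> measurable (seqs (n + 2)) (count_space UNIV)"
proof -
  let ?X = "seqs (n + 2)"
  have z: "(\<lambda>_. 0) \<in> ?X \<rightarrow>\<^sub>M count_space UNIV" and i: "(\<lambda>y. y) \<in> ?X \<rightarrow>\<^sub>M ?X" by auto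
  have rnd: "(\<lambda>y. rnd (f y)) \<in> ?X \<rightarrow>\<^sub>M count_space UNIV" if [measurable]: "f \<in> borel_measurable ?X" for f :: "(nat \<Rightarrow> real) \<Rightarrow> real"
  proof -
    have "(\<lambda>y. \<lfloor>f y + 1 / 2\<rfloor>) \<in> ?X \<rightarrow>\<^sub>M count_space UNIV" by measurable
    then show ?thesis unfolding rnd_def by (rule measurable_compose) simp
  qed
  define m where "m = (\<lambda>y. rnd (M1 * obs1 n 0 y))"
  have m: "m \<in> ?X \<rightarrow>\<^sub>M count_space UNIV"
    unfolding m_def using measurable_obs1[OF z z i i, of n] by (intro rnd borel_measurable_times) auto
  have 2: "(\<lambda>y. rnd (M2 * obs2 n (m y) 0 y)) \<in> ?X \<rightarrow>\<^sub>M count_space UNIV"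
    using measurable_obs2[OF m z i i, of n] by (intro rnd borel_measurable_times) auto
  have "(\<lambda>y. (m y, rnd (M2 * obs2 n (m y) 0 y))) \<in> ?X \<rightarrow>\<^sub>M count_space UNIV \<Otimes>\<^sub>M count_space UNIV"
    using m 2 by (rule measurable_Pair)
  then show ?thesis unfolding decoder_def[abs_def] m_def Let_def by (simp add: pair_measure_countable)
qed

text \<open>Bounds for the second moments of \<open>lin1\<close>, \<open>state'\<close> and
  \<open>lin2\<close>. The weights are geometric, so the bounds involve neither the block length nor
  the message counts; the factors 2 come from (x + y)^2 \<le> 2 x^2 + 2 y^2.\<close>

definition "K1 Q = 2 * Q + 2 * ((sqrt v * g1 / (1 - r1))\<^sup>2 * Q)"
definition "Ks Q = 2 * Q + 2 * ((a * g1 / (1 - r1))\<^sup>2 * Q)"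
definition "K2 Q = 2 * Q + 2 * ((sqrt v * g2 / (1 - r2))\<^sup>2 * Ks Q)"

section \<open>Power, error probability and equivocation of the scheme\<close>

context
  fixes Q v2 :: real
  assumes Q: "Q > 0" and v2: "v2 > 0"
begin

private abbreviation "PS \<equiv> noises (n + 2) Q"
private abbreviation "CH \<equiv> chan_space (n + 2) M1 M2 Q v v2"

private lemma S_id: "(\<lambda>s. s) \<in> PS \<rightarrow>\<^sub>M seqs (n + 2)"
  by measurable

private lemma S_zero: "(\<lambda>_. 0) \<in> PS \<rightarrow>\<^sub>M count_space UNIV" by simp

private lemmas S_meas = S_zero S_zero S_id S_id

private lemma S_nth: "j < n + 2 \<Longrightarrow> (\<lambda>s. s j) \<in> borel_measurable PS"
  by (rule measurable_compose[OF S_id]) simp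

private lemma S_moment:
  assumes "j < n + 2"
  shows "(\<integral>\<^sup>+s. ennreal ((s j)\<^sup>2) \<partial>PS) = ennreal Q"
  using nn_integral_PiM_component[OF Q, of "{..<n+2}" j "\<lambda>x. ennreal (x\<^sup>2)"] assms gauss_second_moment[OF Q, of 0 1]
  by simp

lemma lin1_moment: "(\<integral>\<^sup>+s. ennreal ((lin1 s)\<^sup>2) \<partial>PS) \<le> ennreal (K1 Q)"
  unfolding lin1_def K1_def
proof (rule nn_integral_square_sum_le)
  have c0: "c j \<ge> 0" for j using g_nonneg r_pos v by (simp add: c_def)
  show "(\<integral>\<^sup>+s. ennreal ((\<Sum>j<n. c j * s (j + 2))\<^sup>2) \<partial>PS) \<le> ennreal ((sqrt v * g1 / (1 - r1))\<^sup>2 * Q)"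
  proof (rule nn_integral_weighted_square_le)
    have "(\<Sum>j<n. c j) = sqrt v * g1 * (\<Sum>j<n. r1 ^ j)" by (simp add: c_def sum_distrib_left)
    also have "\<dots> \<le> sqrt v * g1 * (1 / (1 - r1))"
      using g_nonneg v r_pos r_less_1 by (intro mult_left_mono geometric_sum_le) auto
    finally show "(\<Sum>j<n. c j) \<le> sqrt v * g1 / (1 - r1)" by simp
  qed (use c0 S_nth S_moment Q in auto)
  show "(\<lambda>s. \<Sum>j<n. c j * s (j + 2)) \<in> borel_measurable PS"
    by (intro arith_measurable S_nth) auto
qed (use S_nth[of 0] S_moment[of 0] Q in auto)

lemma state'_moment:
  assumes k: "k < n"
  shows "(\<integral>\<^sup>+s. ennreal ((state' k s)\<^sup>2) \<partial>PS) \<le> ennreal (Ks Q)"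
proof -
  have w0: "a * gain k * c j \<ge> 0" for j using g_nonneg r_pos v a_pos by (simp add: c_def gain_def)
  have eq: "state' k s = s (k + 2) + - (\<Sum>j\<in>{k..<n}. a * gain k * c j * s (j + 2))" for s
    by (simp add: state'_def sum_distrib_left mult.assoc)
  \<comment> \<open>The growing gain meets a tail of equally small weights, so the product depends
    only on j - k and its sum is bounded uniformly in k.\<close>
  have w: "a * gain k * c j = a * g1 * r1 ^ (j - k)" if "k \<le> j" for j
    using that v r_pos by (simp add: gain_def c_def power_diff)
  show ?thesis unfolding eq Ks_def
  proof (rule nn_integral_square_sum_le)
    have "(\<integral>\<^sup>+s. ennreal ((\<Sum>j\<in>{k..<n}. a * gain k * c j * s (j + 2))\<^sup>2) \<partial>PS) \<le> ennreal ((a * g1 / (1 - r1))\<^sup>2 * Q)"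
    proof (rule nn_integral_weighted_square_le)
      have "(\<Sum>j\<in>{k..<n}. a * gain k * c j) = (\<Sum>j\<in>{k..<n}. a * g1 * r1 ^ (j - k))"
        by (rule sum.cong) (auto simp: w)
      also have "\<dots> = a * g1 * (\<Sum>j<n - k. r1 ^ j)"
        by (simp add: sum_distrib_left[symmetric] sum.atLeastLessThan_shift_0[of _ k n] atLeast0LessThan)
      also have "\<dots> \<le> a * g1 * (1 / (1 - r1))"
        using g_nonneg a_pos r_pos r_less_1 by (intro mult_left_mono geometric_sum_le) auto
      finally show "(\<Sum>j\<in>{k..<n}. a * gain k * c j) \<le> a * g1 / (1 - r1)" by simp
    qed (use w0 S_nth S_moment Q in auto)
    then show "(\<integral>\<^sup>+s. ennreal ((- (\<Sum>j\<in>{k..<n}. a * gain k * c j * s (j + 2)))\<^sup>2) \<partial>PS) \<le> ennreal ((a * g1 / (1 - r1))\<^sup>2 * Q)"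
      by simp
    show "(\<lambda>s. - (\<Sum>j\<in>{k..<n}. a * gain k * c j * s (j + 2))) \<in> borel_measurable PS"
      by (intro arith_measurable S_nth) auto
  qed (use k S_nth[of "k + 2"] S_moment[of "k + 2"] Q in auto)
qed

lemma lin2_moment: "(\<integral>\<^sup>+s. ennreal ((lin2 s)\<^sup>2) \<partial>PS) \<le> ennreal (K2 Q)"
  unfolding lin2_def K2_def
proof (rule nn_integral_square_sum_le)
  have d0: "d j \<ge> 0" for j using g_nonneg r_pos v by (simp add: d_def)
  have Ks: "Ks Q \<ge> 0" using Q by (simp add: Ks_def)
  then show "0 \<le> (sqrt v * g2 / (1 - r2))\<^sup>2 * Ks Q" by simp
  show "(\<integral>\<^sup>+s. ennreal ((\<Sum>j<n. d j * state' j s)\<^sup>2) \<partial>PS) \<le> ennreal ((sqrt v * g2 / (1 - r2))\<^sup>2 * Ks Q)"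
  proof (rule nn_integral_weighted_square_le)
    have "(\<Sum>j<n. d j) = sqrt v * g2 * (\<Sum>j<n. r2 ^ j)" by (simp add: d_def sum_distrib_left)
    also have "\<dots> \<le> sqrt v * g2 * (1 / (1 - r2))"
      using g_nonneg v r_pos r_less_1 by (intro mult_left_mono geometric_sum_le) auto
    finally show "(\<Sum>j<n. d j) \<le> sqrt v * g2 / (1 - r2)" by simp
  qed (use d0 measurable_state'[OF S_meas] state'_moment Ks in auto)
  show "(\<lambda>s. \<Sum>j<n. d j * state' j s) \<in> borel_measurable PS"
    by (intro arith_measurable measurable_state'[OF S_meas]) auto
qed (use S_nth[of 1] S_moment[of 1] Q in auto)

definition "active_prob = measure (gauss Q) {t<..}"

private lemma pos': "Q > 0" "v > 0" "v2 > 0" "M1 > 0" "M2 > 0" using Q v v2 M1 M2 by auto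

private lemma above_prob:
  "(\<integral>\<^sup>+s. indicator {t<..} (s 0) \<partial>PS) = ennreal active_prob" "(\<integral>\<^sup>+s. indicator {..t} (s 0) \<partial>PS) = ennreal (1 - active_prob)"
proof -
  interpret g: prob_space "gauss Q" using Q by (rule prob_space_gauss)
  show "(\<integral>\<^sup>+s. indicator {t<..} (s 0) \<partial>PS) = ennreal active_prob"
    using nn_integral_PiM_component[OF Q, of "{..<n+2}" 0 "indicator {t<..}"]
    by (simp add: active_prob_def g.emeasure_eq_measure)
  have "{..t} = space (gauss Q) - {t<..}" by auto
  then have "measure (gauss Q) {..t} = 1 - active_prob" unfolding active_prob_def using g.prob_compl[of "{t<..}"] by simp
  then show "(\<integral>\<^sup>+s. indicator {..t} (s 0) \<partial>PS) = ennreal (1 - active_prob)"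
    using nn_integral_PiM_component[OF Q, of "{..<n+2}" 0 "indicator {..t}"]
    by (simp add: g.emeasure_eq_measure)
qed

text \<open>A crude bound that drops the activity condition; it suffices because each encoder pays
  it once per block.\<close>

private lemma initial_power:
  assumes L: "L \<in> borel_measurable PS" and K: "(\<integral>\<^sup>+s. ennreal ((L s)\<^sup>2) \<partial>PS) \<le> ennreal K" "K \<ge> 0"
    and p: "\<And>\<omega>. \<omega> \<in> space CH \<Longrightarrow> \<bar>p \<omega>\<bar> \<le> (1::real)"
  shows "(\<integral>\<^sup>+\<omega>. ennreal ((if oS \<omega> 0 > t then p \<omega> + L (oS \<omega>) else 0)\<^sup>2) \<partial>CH) \<le> ennreal (2 + 2 * K)"
proof -
  interpret s: prob_space PS using Q by (rule prob_space_PiM_gauss)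
  interpret e: prob_space "noises (n + 2) v" using v by (rule prob_space_PiM_gauss)
  have [measurable]: "L \<in> borel_measurable (seqs (n + 2))"
    using L by (simp cong: measurable_cong_sets add: sets_PiM_gauss)
  have "(\<integral>\<^sup>+\<omega>. ennreal ((if oS \<omega> 0 > t then p \<omega> + L (oS \<omega>) else 0)\<^sup>2) \<partial>CH) \<le>
      (\<integral>\<^sup>+\<omega>. ennreal (2 + 2 * (L (oS \<omega>))\<^sup>2) * 1 \<partial>CH)"
  proof (rule nn_integral_mono)
    fix \<omega> assume "\<omega> \<in> space CH"
    then have "(p \<omega>)\<^sup>2 \<le> 1" using p[of \<omega>] by (simp add: abs_square_le_1)
    then have "(p \<omega> + L (oS \<omega>))\<^sup>2 \<le> 2 + 2 * (L (oS \<omega>))\<^sup>2"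
      using square_sum_le[of "p \<omega>" "L (oS \<omega>)"] by linarith
    then show "ennreal ((if oS \<omega> 0 > t then p \<omega> + L (oS \<omega>) else 0)\<^sup>2) \<le> ennreal (2 + 2 * (L (oS \<omega>))\<^sup>2) * 1"
      by (auto intro!: ennreal_leI simp del: ennreal_plus)
  qed
  also have "\<dots> = (\<integral>\<^sup>+s. ennreal (2 + 2 * (L s)\<^sup>2) \<partial>PS)"
    by (subst nn_integral_chan_state_noise[OF pos', where G = "\<lambda>_. 1"]) (auto simp: e.emeasure_space_1)
  also have "\<dots> = (\<integral>\<^sup>+s. 2 + 2 * ennreal ((L s)\<^sup>2) \<partial>PS)"
    by (simp add: ennreal_plus ennreal_mult)
  also have "\<dots> = 2 + 2 * (\<integral>\<^sup>+s. ennreal ((L s)\<^sup>2) \<partial>PS)"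
    using L by (subst nn_integral_add) (auto simp: nn_integral_cmult s.emeasure_space_1)
  also have "\<dots> \<le> 2 + 2 * ennreal K" by (intro add_left_mono mult_left_mono K) auto
  also have "\<dots> = ennreal (2 + 2 * K)" using K by (simp add: ennreal_plus ennreal_mult)
  finally show ?thesis .
qed

text \<open>Activity is decided by the state and the errors by the noise, so the expectation
  factors. The factor \<open>active_prob\<close> is the power that silence saves.\<close>

private lemma later_power:
  assumes k: "k < n" and X: "\<And>\<omega>. X \<omega> = (if oS \<omega> 0 > t then \<alpha> * u k (oE1 \<omega>) + \<beta> * u' k (oE1 \<omega>) else 0)"
  shows "(\<integral>\<^sup>+\<omega>. ennreal ((X \<omega>)\<^sup>2) \<partial>CH) = ennreal (active_prob * (\<alpha>\<^sup>2 + \<beta>\<^sup>2))"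
proof -
  have [measurable]: "(\<lambda>e. u k e) \<in> borel_measurable (seqs (n + 2))" "(\<lambda>e. u' k e) \<in> borel_measurable (seqs (n + 2))"
    using measurable_err[of k "n + 2"] k by auto
  have [measurable]: "(\<lambda>s. indicator {t<..} (s 0) :: ennreal) \<in> borel_measurable (seqs (n + 2))"
    by (rule measurable_compose[OF measurable_component_singleton[of 0]]) auto
  have "(\<integral>\<^sup>+\<omega>. ennreal ((X \<omega>)\<^sup>2) \<partial>CH) =
     (\<integral>\<^sup>+\<omega>. indicator {t<..} (oS \<omega> 0) * ennreal ((\<alpha> * u k (oE1 \<omega>) + \<beta> * u' k (oE1 \<omega>))\<^sup>2) \<partial>CH)"
    by (rule nn_integral_cong) (simp add: X)
  also have "\<dots> = ennreal active_prob * ennreal (\<alpha>\<^sup>2 + \<beta>\<^sup>2)"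
    by (subst nn_integral_chan_state_noise[OF pos', where F = "\<lambda>s. indicator {t<..} (s 0)"
          and G = "\<lambda>e. ennreal ((\<alpha> * u k e + \<beta> * u' k e)\<^sup>2)"])
       (use k in \<open>auto simp: above_prob err_moment\<close>)
  also have "\<dots> = ennreal (active_prob * (\<alpha>\<^sup>2 + \<beta>\<^sup>2))" by (simp add: ennreal_mult active_prob_def)
  finally show ?thesis .
qed

private lemma sum_split: "(\<Sum>i<n + 2. f i) = f 0 + (f 1 + (\<Sum>k<n. f (k + 2)))" for f :: "nat \<Rightarrow> ennreal"
  by (simp add: sum.lessThan_Suc_shift add_2_eq_Suc' del: sum.lessThan_Suc)

private lemma pt_le: "\<omega> \<in> space CH \<Longrightarrow> \<bar>pt (oW1 \<omega>) M1\<bar> \<le> 1" "\<omega> \<in> space CH \<Longrightarrow> \<bar>pt (oW2 \<omega>) M2\<bar> \<le> 1"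
  by (auto simp: chan_space_eq space_pair_measure space_uniform_count_measure oW1_def oW2_def pt_def divide_le_eq)

lemma valid_code_scheme:
  fixes P1 P2 :: real
  assumes p1: "2 + 2 * K1 Q + n * (active_prob * a1\<^sup>2) \<le> (n + 2) * P1"
    and p2: "2 + 2 * K2 Q + n * (active_prob * (a2\<^sup>2 + b\<^sup>2)) \<le> (n + 2) * P2"
  shows "valid_code (n + 2) M1 M2 P1 P2 Q v v2 enc_1 enc_2 decoder"
  unfolding valid_code_def
proof (intro conjI allI impI)
  have \<pi>0: "active_prob \<ge> 0" by (simp add: active_prob_def)
  have K0: "K1 Q \<ge> 0" "K2 Q \<ge> 0" using Q by (auto simp: K1_def K2_def Ks_def)
  let ?F1 = "\<lambda>i. \<integral>\<^sup>+\<omega>. ennreal ((chX1 enc_1 enc_2 (n + 2) i \<omega>)\<^sup>2) \<partial>CH"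
  let ?F2 = "\<lambda>i. \<integral>\<^sup>+\<omega>. ennreal ((chX2 enc_1 enc_2 (n + 2) i \<omega>)\<^sup>2) \<partial>CH"
  have 10: "?F1 0 \<le> ennreal (2 + 2 * K1 Q)"
    unfolding X_formulas by (rule initial_power[OF measurable_lin1[OF S_meas] lin1_moment K0(1) pt_le(1)])
  have 11: "?F1 1 = 0" unfolding X_formulas by simp
  have 20: "?F2 0 = 0" unfolding X_formulas by simp
  have 21: "?F2 1 \<le> ennreal (2 + 2 * K2 Q)"
    unfolding X_formulas by (rule initial_power[OF measurable_lin2[OF S_meas] lin2_moment K0(2) pt_le(2)])
  have off: "chX1 enc_1 enc_2 (n + 2) i \<omega> = 0" "chX2 enc_1 enc_2 (n + 2) i \<omega> = 0" if "\<not> oS \<omega> 0 > t" for \<omega> :: outcome and i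
    using that by (simp_all add: chX1_def chX2_def enc_1_def enc_2_def)
  have 12: "?F1 (k + 2) = ennreal (active_prob * (a1\<^sup>2 + 0\<^sup>2))" if "k < n" for k
    by (rule later_power[OF that]) (use X_on(1)[of _ k] off that in \<open>simp del: add_2_eq_Suc'\<close>)
  have 22: "?F2 (k + 2) = ennreal (active_prob * (a2\<^sup>2 + b\<^sup>2))" if "k < n" for k
    by (rule later_power[OF that]) (use X_on(2)[of _ k] off that in \<open>simp del: add_2_eq_Suc'\<close>)
  have cs: "(\<Sum>k<n. ennreal x) = ennreal (real n * x)" if "0 \<le> x" for x :: real
    using that by (simp add: ennreal_mult ennreal_of_nat_eq_real_of_nat)
  have x0: "0 \<le> active_prob * a1\<^sup>2" "0 \<le> active_prob * (a2\<^sup>2 + b\<^sup>2)" using \<pi>0 by auto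
  have "(\<Sum>i<n + 2. ?F1 i) \<le> ennreal (2 + 2 * K1 Q) + (0 + (\<Sum>k<n. ennreal (active_prob * a1\<^sup>2)))"
    unfolding sum_split by (intro add_mono 10 sum_mono) (use 11 12 in auto)
  also have "\<dots> = ennreal (2 + 2 * K1 Q + n * (active_prob * a1\<^sup>2))"
    using x0 K0 by (simp add: cs[OF x0(1)] ennreal_plus[symmetric] del: ennreal_plus sum_constant)
  also have "\<dots> \<le> ennreal (real (n + 2) * P1)" using p1 by (intro ennreal_leI) simp
  finally show "(\<Sum>i<n + 2. ?F1 i) \<le> ennreal (real (n + 2) * P1)" .
  have "(\<Sum>i<n + 2. ?F2 i) \<le> 0 + (ennreal (2 + 2 * K2 Q) + (\<Sum>k<n. ennreal (active_prob * (a2\<^sup>2 + b\<^sup>2))))"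
    unfolding sum_split by (intro add_mono 21 sum_mono) (use 20 22 in auto)
  also have "\<dots> = ennreal (2 + 2 * K2 Q + n * (active_prob * (a2\<^sup>2 + b\<^sup>2)))"
    using x0 K0 by (simp add: cs[OF x0(2)] ennreal_plus[symmetric] del: ennreal_plus sum_constant)
  also have "\<dots> \<le> ennreal (real (n + 2) * P2)" using p2 by (intro ennreal_leI) simp
  finally show "(\<Sum>i<n + 2. ?F2 i) \<le> ennreal (real (n + 2) * P2)" .
qed (use causal_scheme measurable_decoder in \<open>auto simp: causal_encoders_def\<close>)

text \<open>Union bound over silence and two Chebyshev estimates. The factor 4 comes from the
  rounding threshold 1/2, and the unit second moments leave M^2 times the squared error
  scale.\<close>

lemma err_prob_scheme:
  "err_prob (n + 2) M1 M2 Q v v2 enc_1 enc_2 decoder \<le>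
     (1 - active_prob) + 4 * v * ((real M1)\<^sup>2 * r1 ^ (2 * n)) + 4 * v * ((real M2)\<^sup>2 * r2 ^ (2 * n))"
proof -
  interpret C: prob_space CH using pos' by (rule prob_space_chan_space)
  interpret s: prob_space PS using Q by (rule prob_space_PiM_gauss)
  interpret e: prob_space "noises (n + 2) v" using v by (rule prob_space_PiM_gauss)
  interpret g: prob_space "gauss Q" using Q by (rule prob_space_gauss)
  have \<pi>: "0 \<le> 1 - active_prob" by (simp add: active_prob_def)
  let ?\<alpha> = "2 * real M1 * (sqrt v * r1 ^ n)" and ?\<beta> = "2 * real M2 * (sqrt v * r2 ^ n)"
  let ?E = "{\<omega> \<in> space CH. decoder (Yo \<omega>) \<noteq> (oW1 \<omega>, oW2 \<omega>)}"
  have [measurable]: "(\<lambda>e. u n e) \<in> borel_measurable (seqs (n + 2))" "(\<lambda>e. u' n e) \<in> borel_measurable (seqs (n + 2))"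
    using measurable_err[of n "n + 2"] by auto
  have [measurable]: "(\<lambda>s. indicator {..t} (s 0) :: ennreal) \<in> borel_measurable (seqs (n + 2))"
    by (rule measurable_compose[OF measurable_component_singleton[of 0]]) auto
  have Ym: "(\<lambda>\<omega>. Yo \<omega>) \<in> CH \<rightarrow>\<^sub>M seqs (n + 2)"
    by (rule measurable_chY[OF causal_scheme])
  have fI: "(\<integral>\<^sup>+\<omega>. F (oS \<omega>) \<partial>CH) = (\<integral>\<^sup>+s. F s \<partial>PS)" if "F \<in> borel_measurable (seqs (n + 2))" for F
    using nn_integral_chan_state_noise[OF pos' that, of "\<lambda>_. 1"] by (simp add: e.emeasure_space_1)
  have gI: "(\<integral>\<^sup>+\<omega>. G (oE1 \<omega>) \<partial>CH) = (\<integral>\<^sup>+e. G e \<partial>noises (n + 2) v)" if "G \<in> borel_measurable (seqs (n + 2))" for G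
    using nn_integral_chan_state_noise[OF pos' _ that, of "\<lambda>_. 1"] by (simp add: s.emeasure_space_1)
  have m1: "(\<integral>\<^sup>+e. ennreal ((x * u n e)\<^sup>2) \<partial>noises (n + 2) v) = ennreal (x\<^sup>2)" for x
    using err_moment[of n "n + 2" x 0] by simp
  have m2: "(\<integral>\<^sup>+e. ennreal ((x * u' n e)\<^sup>2) \<partial>noises (n + 2) v) = ennreal (x\<^sup>2)" for x
    using err_moment[of n "n + 2" 0 x] by simp
  have big: "1 \<le> (2 * x)\<^sup>2" if "\<not> \<bar>x\<bar> < 1 / 2" for x :: real
    using that abs_square_less_1[of "2 * x"] by (auto simp: not_less abs_mult)
  have "(\<integral>\<^sup>+\<omega>. indicator ?E \<omega> \<partial>CH) \<le> (\<integral>\<^sup>+\<omega>. indicator {..t} (oS \<omega> 0) + (ennreal ((?\<alpha> * u n (oE1 \<omega>))\<^sup>2) + ennreal ((?\<beta> * u' n (oE1 \<omega>))\<^sup>2)) \<partial>CH)"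
  proof (rule nn_integral_mono)
    fix \<omega>
    show "indicator ?E \<omega> \<le> indicator {..t} (oS \<omega> 0) + (ennreal ((?\<alpha> * u n (oE1 \<omega>))\<^sup>2) + ennreal ((?\<beta> * u' n (oE1 \<omega>))\<^sup>2))"
    proof (cases "\<omega> \<in> ?E \<and> oS \<omega> 0 > t")
      case True
      then have "\<not> \<bar>real M1 * (sqrt v * r1 ^ n * u n (oE1 \<omega>))\<bar> < 1 / 2 \<or>
          \<not> \<bar>real M2 * (sqrt v * r2 ^ n * u' n (oE1 \<omega>))\<bar> < 1 / 2"
        using decoder_correct[of \<omega>] by blast
      then have "1 \<le> (?\<alpha> * u n (oE1 \<omega>))\<^sup>2 \<or> 1 \<le> (?\<beta> * u' n (oE1 \<omega>))\<^sup>2"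
        using big by (metis (no_types, opaque_lifting) mult.assoc)
      then have "1 \<le> (?\<alpha> * u n (oE1 \<omega>))\<^sup>2 + (?\<beta> * u' n (oE1 \<omega>))\<^sup>2"
        by (auto intro: add_increasing add_increasing2)
      then have "ennreal 1 \<le> ennreal ((?\<alpha> * u n (oE1 \<omega>))\<^sup>2 + (?\<beta> * u' n (oE1 \<omega>))\<^sup>2)" by (rule ennreal_leI)
      then show ?thesis using True by (simp add: ennreal_plus)
    qed (auto simp: indicator_def not_less)
  qed
  also have "\<dots> = (\<integral>\<^sup>+\<omega>. indicator {..t} (oS \<omega> 0) \<partial>CH) +
      ((\<integral>\<^sup>+\<omega>. ennreal ((?\<alpha> * u n (oE1 \<omega>))\<^sup>2) \<partial>CH) + (\<integral>\<^sup>+\<omega>. ennreal ((?\<beta> * u' n (oE1 \<omega>))\<^sup>2) \<partial>CH))"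
  proof -
    have [measurable]: "(\<lambda>\<omega>. indicator {..t} (oS \<omega> 0) :: ennreal) \<in> borel_measurable CH"
      by (rule measurable_compose[OF measurable_oS]) measurable
    have [measurable]: "(\<lambda>\<omega>. u n (oE1 \<omega>)) \<in> borel_measurable CH" "(\<lambda>\<omega>. u' n (oE1 \<omega>)) \<in> borel_measurable CH"
      by (rule measurable_compose[OF measurable_oE1], measurable)+
    show ?thesis by (simp add: nn_integral_add)
  qed
  also have "\<dots> = ennreal (1 - active_prob) + (ennreal (?\<alpha>\<^sup>2) + ennreal (?\<beta>\<^sup>2))"
  proof -
    have "(\<integral>\<^sup>+\<omega>. indicator {..t} (oS \<omega> 0) \<partial>CH) = ennreal (1 - active_prob)"
      using fI[of "\<lambda>s. indicator {..t} (s 0)"] above_prob(2) by simp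
    moreover have "(\<integral>\<^sup>+\<omega>. ennreal ((?\<alpha> * u n (oE1 \<omega>))\<^sup>2) \<partial>CH) = ennreal (?\<alpha>\<^sup>2)"
      using gI[of "\<lambda>e. ennreal ((?\<alpha> * u n e)\<^sup>2)"] m1[of ?\<alpha>] by simp
    moreover have "(\<integral>\<^sup>+\<omega>. ennreal ((?\<beta> * u' n (oE1 \<omega>))\<^sup>2) \<partial>CH) = ennreal (?\<beta>\<^sup>2)"
      using gI[of "\<lambda>e. ennreal ((?\<beta> * u' n e)\<^sup>2)"] m2[of ?\<beta>] by simp
    ultimately show ?thesis by simp
  qed
  also have "\<dots> = ennreal ((1 - active_prob) + (?\<alpha>\<^sup>2 + ?\<beta>\<^sup>2))" using \<pi> by (simp add: ennreal_plus)
  finally have le: "(\<integral>\<^sup>+\<omega>. indicator ?E \<omega> \<partial>CH) \<le> ennreal ((1 - active_prob) + (?\<alpha>\<^sup>2 + ?\<beta>\<^sup>2))" .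
  have "C.prob ?E \<le> (1 - active_prob) + (?\<alpha>\<^sup>2 + ?\<beta>\<^sup>2)"
  \<comment> \<open>A set outside the sigma-algebra has measure 0 by convention, so the bound is
    immediate in that case.\<close>
  proof (cases "?E \<in> sets CH")
    case True
    then have "ennreal (C.prob ?E) \<le> ennreal ((1 - active_prob) + (?\<alpha>\<^sup>2 + ?\<beta>\<^sup>2))"
      using le by (simp add: C.emeasure_eq_measure)
    then show ?thesis using \<pi> by (subst (asm) ennreal_le_iff) auto
  next
    case False
    then show ?thesis using \<pi> by (simp add: measure_notin_sets)
  qed
  moreover have "?\<alpha>\<^sup>2 = 4 * v * ((real M1)\<^sup>2 * r1 ^ (2 * n))" "?\<beta>\<^sup>2 = 4 * v * ((real M2)\<^sup>2 * r2 ^ (2 * n))"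
    using v by (simp_all add: power_mult_distrib power_mult[symmetric] mult.commute[of n 2])
  ultimately show ?thesis unfolding err_prob_def by simp
qed

lemma equivocation_scheme:
  "(log 2 (real M1 * real M2) - log 2 (2 * exp (1 / v2))) / (n + 2) \<le> equivocation (n + 2) M1 M2 Q v v2 enc_1 enc_2"
  using equivocation_ge[of "n + 2" enc_1 enc_2 Q v v2 M1 M2 1, OF causal_scheme pos' _ Y_close]
  by simp

end

end

section \<open>The capacity region\<close>

text \<open>Two opposite demands on the threshold: silence must be rare enough for the error budget,
  yet of positive probability, as it is the only source of spare power. The second holds because the
  density is positive everywhere.\<close>

lemma gauss_small_tail:
  assumes v: "v > 0" and \<epsilon>: "\<epsilon> > 0"
  obtains t where "measure (gauss v) {t<..} < 1" "1 - \<epsilon> \<le> measure (gauss v) {t<..}"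
proof -
  interpret prob_space "gauss v" using v by (rule prob_space_gauss)
  have compl: "prob {t<..} = 1 - prob {..t}" for t
  proof -
    have "{t<..} = space (gauss v) - {..t}" by auto
    then show ?thesis using prob_compl[of "{..t}"] by simp
  qed
  have pos: "prob {..t} > 0" for t
  proof (rule ccontr)
    assume "\<not> prob {..t} > 0"
    then have "emeasure (gauss v) {..t} = 0" by (simp add: emeasure_eq_measure not_less measure_le_0_iff)
    then have "(\<integral>\<^sup>+x. ennreal (phi v x) * indicator {..t} x \<partial>lborel) = 0"
      unfolding gauss_def by (subst (asm) emeasure_density) auto
    then have "AE x in lborel. ennreal (phi v x) * indicator {..t} x = 0"
      by (subst (asm) nn_integral_0_iff_AE) auto
    then have "AE x in lborel. x \<notin> {t-1..t}"
    proof eventually_elim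
      case (elim x)
      have "phi v x > 0" using v by (intro normal_density_pos) simp
      then show ?case using elim by (auto simp: indicator_def split: if_splits)
    qed
    then have "{t-1..t} \<in> null_sets lborel" by (subst AE_iff_null_sets) auto
    then have "emeasure lborel {t-1..t} = 0" by (rule null_setsD1)
    then show False using emeasure_lborel_Icc[of "t - 1" t] by simp
  qed
  have "(\<lambda>m. prob {..- real m}) \<longlonglongrightarrow> prob (\<Inter>m. {..- real m})"
    by (rule finite_Lim_measure_decseq) (auto simp: decseq_def)
  moreover have "(\<Inter>m. {..- real m}) = {}"
  proof -
    have "\<exists>m. \<not> x \<le> - real m" for x :: real
    proof -
      obtain m where "- x < real m" using reals_Archimedean2 by blast
      then have "\<not> x \<le> - real m" by linarith
      then show ?thesis ..
    qed
    then show ?thesis by blast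
  qed
  ultimately have "(\<lambda>m. prob {..- real m}) \<longlonglongrightarrow> 0" by simp
  from order_tendstoD(2)[OF this \<epsilon>] obtain m where m: "prob {..- real m} < \<epsilon>"
    by (auto simp: eventually_sequentially)
  show thesis by (rule that[of "- real m"]) (use compl pos m in auto)
qed

text \<open>Rounding up at most doubles the message count, because the power of 2 is at least 1 for
  R \<ge> 0. The squared count thus grows like a constant times (2 powr (2 * R)) ^ n.\<close>

lemma message_error_tendsto_0:
  assumes R: "R \<ge> 0" and q: "q \<ge> 0" "2 powr (2 * R) * q < 1"
  shows "(\<lambda>n. (real (msgs (n + 2) R))\<^sup>2 * q ^ n) \<longlonglongrightarrow> 0"
proof (rule tendsto_sandwich[of "\<lambda>_. 0"])
  let ?x = "2 powr (2 * R)"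
  show "(\<lambda>n. 4 * ?x\<^sup>2 * (?x * q) ^ n) \<longlonglongrightarrow> 0"
    using q by (intro tendsto_mult_right_zero LIMSEQ_power_zero) simp
  show "\<forall>\<^sub>F n in sequentially. (real (msgs (n + 2) R))\<^sup>2 * q ^ n \<le> 4 * ?x\<^sup>2 * (?x * q) ^ n"
  proof (intro always_eventually allI)
    fix n
    let ?y = "2 powr (real (n + 2) * R)"
    have "?y \<ge> 1" using R by (intro ge_one_powr_ge_zero) auto
    then have "real (nat \<lceil>?y\<rceil>) \<le> 2 * ?y" using le_nat_ceiling_powr(3)[of "real (n + 2) * R"] by linarith
    then have "(real (nat \<lceil>?y\<rceil>))\<^sup>2 \<le> (2 * ?y)\<^sup>2" by (rule power_mono) (rule of_nat_0_le_iff)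
    also have "\<dots> = 4 * (?x ^ (n + 2))"
    proof -
      have "?y\<^sup>2 = 2 powr (real (n + 2) * R + real (n + 2) * R)" by (simp only: power2_eq_square powr_add)
      also have "real (n + 2) * R + real (n + 2) * R = (2 * R) * real (n + 2)" by simp
      also have "2 powr \<dots> = ?x powr real (n + 2)" by (rule powr_powr[symmetric])
      also have "\<dots> = ?x ^ (n + 2)" by (rule powr_realpow) simp
      finally show ?thesis by (simp add: power_mult_distrib)
    qed
    finally have "(real (nat \<lceil>?y\<rceil>))\<^sup>2 * q ^ n \<le> 4 * ?x ^ (n + 2) * q ^ n"
      using q by (intro mult_right_mono) auto
    then show "(real (nat \<lceil>?y\<rceil>))\<^sup>2 * q ^ n \<le> 4 * ?x\<^sup>2 * (?x * q) ^ n"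
      by (simp add: power_add power_mult_distrib power2_eq_square mult_ac)
  qed
qed (use q in auto)

lemma eventually_linear_le:
  fixes x y C :: real
  assumes "x < y" "y > 0"
  shows "\<forall>\<^sub>F n in sequentially. C + real n * x \<le> real (n + 2) * y"
proof -
  obtain n0 :: nat where n0: "C / (y - x) < real n0" using reals_Archimedean2 by blast
  show ?thesis
  proof (rule eventually_sequentiallyI)
    fix n assume "n0 \<le> n"
    then have "C / (y - x) \<le> real n" using n0 by linarith
    then have "C \<le> real n * (y - x)" using assms(1) by (simp add: pos_divide_le_eq)
    then show "C + real n * x \<le> real (n + 2) * y" using assms(2) by (simp add: algebra_simps)
  qed
qed

text \<open>Transmitting only while the first state sample exceeds a low threshold frees enough average
  power to run the scheme above the nominal power, so that boundary points are achieved as well.\<close>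
lemma achievability:
  assumes pos: "P1 > 0" "P2 > 0" "Q > 0" "v1 > 0" "v2 > 0"
    and R: "R1 \<ge> 0" "R2 \<ge> 0" and \<rho>: "\<rho> \<in> {0..1}" and rp: "rate_pair P1 P2 v1 \<rho> R1 R2"
  shows "achievable True P1 P2 Q v1 v2 R1 R2"
  unfolding achievable_def Let_def
proof (intro conjI allI impI R)
  fix \<epsilon> :: real assume \<epsilon>: "\<epsilon> > 0"
  \<comment> \<open>Half of the error budget pays for silence; each message receives a
    quarter.\<close>
  obtain t where t: "measure (gauss Q) {t<..} < 1" "1 - \<epsilon> / 2 \<le> measure (gauss Q) {t<..}"
    using gauss_small_tail[OF pos(3), of "\<epsilon> / 2"] \<epsilon> by auto
  define p where "p = measure (gauss Q) {t<..}"
  have p: "0 \<le> p" "p < 1" using t by (auto simp: p_def)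
  \<comment> \<open>A power factor strictly between 1 and 1 / p: the scheme runs above nominal power
    when active, yet stays below it on average.\<close>
  define k where "k = 2 / (1 + p)"
  have k: "k > 1" "p * k < 1" using p by (auto simp: k_def field_simps)
  obtain a1 a2 b where ab: "a1 > 0" "a2 \<ge> 0" "b > 0" "a1\<^sup>2 \<le> k * P1" "a2\<^sup>2 + b\<^sup>2 \<le> k * P2"
    "2 powr (2 * R1) < ((a1 + a2)\<^sup>2 + b\<^sup>2 + v1) / (b\<^sup>2 + v1)" "2 powr (2 * R2) < (b\<^sup>2 + v1) / v1"
    using superposition_parameters[OF pos(1,2,4) k(1) \<rho> R rp] by blast
  have less: "p * x < P" if "x \<le> k * P" "P > 0" for x P :: real
  proof -
    have "p * x \<le> p * (k * P)" using p that by (intro mult_left_mono)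
    also have "\<dots> = (p * k) * P" by simp
    also have "\<dots> < 1 * P" using k that by (intro mult_strict_right_mono)
    finally show ?thesis by simp
  qed
  \<comment> \<open>The squared contraction factors of the two layers. The strict rate inequalities
    say that squared message counts grow more slowly than squared errors shrink.\<close>
  let ?q1 = "(b\<^sup>2 + v1) / ((a1 + a2)\<^sup>2 + b\<^sup>2 + v1)" and ?q2 = "v1 / (b\<^sup>2 + v1)"
  have den: "b\<^sup>2 + v1 > 0" "(a1 + a2)\<^sup>2 + b\<^sup>2 + v1 > 0" using pos by (auto intro: add_nonneg_pos)
  have q: "?q1 \<ge> 0" "?q2 \<ge> 0" "2 powr (2 * R1) * ?q1 < 1" "2 powr (2 * R2) * ?q2 < 1"
    using ab den pos by (auto simp: pos_less_divide_eq pos_divide_less_eq intro!: divide_nonneg_nonneg)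
  let ?M = "\<lambda>n R. msgs (n + 2) R"
  let ?K1 = "schalkwijk_kailath.K1 a1 a2 b v1 Q" and ?K2 = "schalkwijk_kailath.K2 a1 a2 b v1 Q"
  have lim: "(\<lambda>n. 4 * v1 * ((real (?M n R))\<^sup>2 * q ^ n)) \<longlonglongrightarrow> 0"
    if "R \<ge> 0" "q \<ge> 0" "2 powr (2 * R) * q < 1" for R q
    using message_error_tendsto_0[OF that] by (rule tendsto_mult_right_zero)
  have ev1: "\<forall>\<^sub>F n in sequentially. 4 * v1 * ((real (?M n R1))\<^sup>2 * ?q1 ^ n) < \<epsilon> / 4"
    by (rule order_tendstoD(2)[OF lim[OF R(1) q(1,3)]]) (use \<epsilon> in simp)
  have ev2: "\<forall>\<^sub>F n in sequentially. 4 * v1 * ((real (?M n R2))\<^sup>2 * ?q2 ^ n) < \<epsilon> / 4"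
    by (rule order_tendstoD(2)[OF lim[OF R(2) q(2,4)]]) (use \<epsilon> in simp)
  have ev3: "\<forall>\<^sub>F n in sequentially. (2 + 2 * ?K1) + real n * (p * a1\<^sup>2) \<le> real (n + 2) * P1"
    by (rule eventually_linear_le) (use less[OF ab(4)] pos in auto)
  have ev4: "\<forall>\<^sub>F n in sequentially. (2 + 2 * ?K2) + real n * (p * (a2\<^sup>2 + b\<^sup>2)) \<le> real (n + 2) * P2"
    by (rule eventually_linear_le) (use less[OF ab(5)] pos in auto)
  \<comment> \<open>The leakage is constant in bits, so from some block length on it is at most
    \<epsilon> per use.\<close>
  have ev5: "\<forall>\<^sub>F n in sequentially. log 2 (2 * exp (1 / v2)) + real n * 0 \<le> real (n + 2) * \<epsilon>"
    by (rule eventually_linear_le) (use \<epsilon> in auto)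
  define G where "G n \<longleftrightarrow> 4 * v1 * ((real (?M n R1))\<^sup>2 * ?q1 ^ n) < \<epsilon> / 4 \<and>
     4 * v1 * ((real (?M n R2))\<^sup>2 * ?q2 ^ n) < \<epsilon> / 4 \<and>
     (2 + 2 * ?K1) + real n * (p * a1\<^sup>2) \<le> real (n + 2) * P1 \<and>
     (2 + 2 * ?K2) + real n * (p * (a2\<^sup>2 + b\<^sup>2)) \<le> real (n + 2) * P2 \<and>
     log 2 (2 * exp (1 / v2)) + real n * 0 \<le> real (n + 2) * \<epsilon>" for n
  have "eventually G sequentially"
    unfolding G_def by (intro eventually_conj ev1 ev2 ev3 ev4 ev5)
  then obtain n0 where n0: "\<And>n. n \<ge> n0 \<Longrightarrow> G n"
    by (auto simp: eventually_sequentially)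
  show "\<exists>N0. \<forall>N\<ge>N0. \<exists>f1 f2 dec.
      valid_code N (msgs N R1) (msgs N R2) P1 P2 Q v1 v2 f1 f2 dec \<and>
      err_prob N (msgs N R1) (msgs N R2) Q v1 v2 f1 f2 dec \<le> \<epsilon> \<and>
      (True \<longrightarrow> R1 + R2 - \<epsilon> \<le> equivocation N (msgs N R1) (msgs N R2) Q v1 v2 f1 f2)"
  proof (intro exI[of _ "n0 + 2"] allI impI)
    fix N assume "N \<ge> n0 + 2"
    define n where "n = N - 2"
    have n: "N = n + 2" "n \<ge> n0" using \<open>N \<ge> n0 + 2\<close> by (auto simp: n_def)
    note F = n0[OF n(2), unfolded G_def]
    define M1 where "M1 = ?M n R1"
    define M2 where "M2 = ?M n R2"
    have M: "M1 > 0" "M2 > 0" "2 powr (real (n + 2) * R1) \<le> M1" "2 powr (real (n + 2) * R2) \<le> M2"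
      unfolding M1_def M2_def by (rule le_nat_ceiling_powr)+
    interpret S: schalkwijk_kailath a1 a2 b v1 n M1 M2 t
      by unfold_locales (use ab pos M in auto)
    have pi: "S.active_prob Q = p" by (simp add: S.active_prob_def[OF pos(3,5)] p_def)
    have rr: "S.r1 ^ (2 * n) = ?q1 ^ n" "S.r2 ^ (2 * n) = ?q2 ^ n"
      by (simp_all add: power_mult S.r_sq S.a_def)
    have valid: "valid_code (n + 2) M1 M2 P1 P2 Q v1 v2 S.enc_1 S.enc_2 S.decoder"
      by (rule S.valid_code_scheme[OF pos(3,5)]) (use F pi in auto)
    have err: "err_prob (n + 2) M1 M2 Q v1 v2 S.enc_1 S.enc_2 S.decoder \<le> \<epsilon>"
      using S.err_prob_scheme[OF pos(3,5)] F t(2) unfolding pi rr M1_def[symmetric] M2_def[symmetric] p_def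
      by linarith
    have eq: "R1 + R2 - \<epsilon> \<le> equivocation (n + 2) M1 M2 Q v1 v2 S.enc_1 S.enc_2"
    proof -
      have "2 powr (real (n + 2) * (R1 + R2)) \<le> real M1 * real M2"
        using mult_mono[OF M(3,4)] by (simp add: powr_add distrib_left)
      then have "real (n + 2) * (R1 + R2) \<le> log 2 (real M1 * real M2)"
        using M(1,2) by (subst le_log_iff) auto
      moreover have "log 2 (2 * exp (1 / v2)) \<le> real (n + 2) * \<epsilon>" using F by simp
      ultimately have "(R1 + R2 - \<epsilon>) * real (n + 2) \<le> log 2 (real M1 * real M2) - log 2 (2 * exp (1 / v2))"
        by (simp add: algebra_simps)
      then have "R1 + R2 - \<epsilon> \<le> (log 2 (real M1 * real M2) - log 2 (2 * exp (1 / v2))) / real (n + 2)"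
        by (subst pos_le_divide_eq) auto
      then show ?thesis using S.equivocation_scheme[OF pos(3,5)] by linarith
    qed
    show "\<exists>f1 f2 dec.
      valid_code N (msgs N R1) (msgs N R2) P1 P2 Q v1 v2 f1 f2 dec \<and>
      err_prob N (msgs N R1) (msgs N R2) Q v1 v2 f1 f2 dec \<le> \<epsilon> \<and>
      (True \<longrightarrow> R1 + R2 - \<epsilon> \<le> equivocation N (msgs N R1) (msgs N R2) Q v1 v2 f1 f2)"
      unfolding n(1) M1_def[symmetric] M2_def[symmetric] using valid err eq by blast
  qed
qed

lemma achievable_without_secrecy:
  assumes "achievable True P1 P2 Q v1 v2 R1 R2"
  shows "achievable False P1 P2 Q v1 v2 R1 R2"
  unfolding achievable_def Let_def
proof (intro conjI allI impI)
  fix \<epsilon> :: real assume "\<epsilon> > 0"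
  then obtain N0 where N0: "\<And>N. N \<ge> N0 \<Longrightarrow> \<exists>f1 f2 dec.
      valid_code N (msgs N R1) (msgs N R2) P1 P2 Q v1 v2 f1 f2 dec \<and>
      err_prob N (msgs N R1) (msgs N R2) Q v1 v2 f1 f2 dec \<le> \<epsilon>"
    using assms unfolding achievable_def Let_def by meson
  show "\<exists>N0. \<forall>N\<ge>N0. \<exists>f1 f2 dec.
      valid_code N (msgs N R1) (msgs N R2) P1 P2 Q v1 v2 f1 f2 dec \<and>
      err_prob N (msgs N R1) (msgs N R2) Q v1 v2 f1 f2 dec \<le> \<epsilon> \<and>
      (False \<longrightarrow> R1 + R2 - \<epsilon> \<le> equivocation N (msgs N R1) (msgs N R2) Q v1 v2 f1 f2)"
    using N0 by simp blast
qed (use assms in \<open>simp_all add: achievable_def\<close>)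

theorem theorem10:
  fixes P1 P2 Q v1 v2 :: real
  assumes "P1 > 0" "P2 > 0" "Q > 0" "v1 > 0" "v2 > 0"
  defines "R \<equiv> (\<Union>\<rho>\<in>{0..1::real}. {(R1, R2). R1 \<ge> 0 \<and> R2 \<ge> 0 \<and>
              R2 \<le> 1/2 * log 2 (1 + P2 * (1 - \<rho>\<^sup>2) / v1) \<and>
              R1 + R2 \<le> 1/2 * log 2 (1 + (P1 + P2 + 2 * sqrt (P1 * P2) * \<rho>) / v1)})"
  shows "cap_region True P1 P2 Q v1 v2 = R \<and> cap_region False P1 P2 Q v1 v2 = R"
proof -
  have R: "(R1, R2) \<in> R \<longleftrightarrow> R1 \<ge> 0 \<and> R2 \<ge> 0 \<and> (\<exists>\<rho>\<in>{0..1}. rate_pair P1 P2 v1 \<rho> R1 R2)" for R1 R2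
    by (auto simp: R_def rate_pair_def)
  have "R \<subseteq> cap_region True P1 P2 Q v1 v2"
    using achievability[OF assms(1-5)] R by (auto simp: cap_region_def)
  moreover have "cap_region True P1 P2 Q v1 v2 \<subseteq> cap_region False P1 P2 Q v1 v2"
    using achievable_without_secrecy by (auto simp: cap_region_def)
  moreover have "cap_region False P1 P2 Q v1 v2 \<subseteq> R"
  proof
    fix x assume "x \<in> cap_region False P1 P2 Q v1 v2"
    then obtain R1 R2 where x: "x = (R1, R2)" and ach: "achievable False P1 P2 Q v1 v2 R1 R2"
      by (auto simp: cap_region_def)
    then have "R1 \<ge> 0" "R2 \<ge> 0" by (auto simp: achievable_def)
    then show "x \<in> R" using x R converse[OF assms(1-5) ach] by blast
  qed
  ultimately show ?thesis by blast
qed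

end
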